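(* Let $k\ge1$ be an integer and let $Bes_0^k$ be the Bessel bridge of dimension $k$ on $[0,1]$ from $0$ to $0$. Let $\psi:[0,1]\to\mathbb{R}$ be positive and twice continuously differentiable on $[0,1]$, and let $\vartheta=\int_0^1\sqrt{\psi(t)}\,dt$. Then, as $\varepsilon\to0+$, $$ \mathsf{P}\{\|Bes_0^k\|_\psi\leq\varepsilon\}\sim \frac{2\sqrt2}{\sqrt\pi}\, (k\vartheta)^{(k-2)/2}\,\psi^{k/8}(0)\,\psi^{k/8}(1)\, \varepsilon^{-(k-1)} \exp\left(-\frac{k^2\vartheta^2}{8}\varepsilon^{-2}\right). $$
   Context: For a process $X(t)$, $0\le t\le 1$, and a non-negative weight $\psi$ on $[0,1]$, $\|X\|_\psi=\left(\int_0^1X^2(t)\psi(t)\,dt\right)^{1/2}$. $Bes_0^k$ is the process $\left(\sum_{i=1}^kB_i^2(t)\right)^{1/2}$, $0\le t\le 1$, where $B_1,\dots,B_k$ are independent standard Brownian bridges on $[0,1]$. The notation $f(\varepsilon)\sim g(\varepsilon)$ means $f(\varepsilon)/g(\varepsilon)\to1$. $\psi^{a}(t)$ means $(\psi(t))^{a}$. *)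

theory Defs
  imports "HOL-Probability.Probability" "HOL-Library.Landau_Symbols"
begin

text \<open>One-sided derivatives are used at the end points of the interval.\<close>

definition C2_on_interval :: "real \<Rightarrow> real \<Rightarrow> (real \<Rightarrow> real) \<Rightarrow> bool" where
  "C2_on_interval a b f \<longleftrightarrow>
    (\<exists>f' f''.
      (\<forall>t\<in>{a..b}. (f has_real_derivative f' t) (at t within {a..b})) \<and>
      (\<forall>t\<in>{a..b}. (f' has_real_derivative f'' t) (at t within {a..b})) \<and>
      continuous_on {a..b} f'')"

text \<open>Constants count as Gaussian, so that a process may be deterministic at some times.\<close>

definition gaussian_rv :: "'a measure \<Rightarrow> ('a \<Rightarrow> real) \<Rightarrow> bool" where
  "gaussian_rv M X \<longleftrightarrow>
    (\<exists>\<mu>. X \<in> borel_measurable M \<and> (AE \<omega> in M. X \<omega> = \<mu>)) \<or>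
    (\<exists>\<mu> \<sigma>. \<sigma> > 0 \<and> distributed M lborel X (normal_density \<mu> \<sigma>))"

definition gaussian_process :: "'a measure \<Rightarrow> 'i set \<Rightarrow> ('i \<Rightarrow> 'a \<Rightarrow> real) \<Rightarrow> bool" where
  "gaussian_process M T X \<longleftrightarrow>
    (\<forall>S c. finite S \<and> S \<subseteq> T \<longrightarrow> gaussian_rv M (\<lambda>\<omega>. \<Sum>t\<in>S. c t * X t \<omega>))"

definition brownian_bridge :: "'a measure \<Rightarrow> (real \<Rightarrow> 'a \<Rightarrow> real) \<Rightarrow> bool" where
  "brownian_bridge M B \<longleftrightarrow>
    prob_space M \<and>
    gaussian_process M {0..1} B \<and>
    (\<forall>t\<in>{0..1}. (LINT \<omega>|M. B t \<omega>) = 0) \<and>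
    (\<forall>s\<in>{0..1}. \<forall>t\<in>{0..1}. (LINT \<omega>|M. B s \<omega> * B t \<omega>) = min s t - s * t) \<and>
    (\<forall>\<omega>\<in>space M. continuous_on {0..1} (\<lambda>t. B t \<omega>))"

text \<open>
  Independence is that of the processes as a whole: each one is regarded as a
  random element of the product space of real functions on the unit interval.
\<close>

definition bessel_bridge :: "'a measure \<Rightarrow> nat \<Rightarrow> (real \<Rightarrow> 'a \<Rightarrow> real) \<Rightarrow> bool" where
  "bessel_bridge M k R \<longleftrightarrow>
    (\<exists>B :: nat \<Rightarrow> real \<Rightarrow> 'a \<Rightarrow> real.
      (\<forall>i\<in>{1..k}. brownian_bridge M (B i)) \<and>
      prob_space.indep_vars M (\<lambda>_. \<Pi>\<^sub>M t\<in>{0..1}. borel)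
        (\<lambda>i \<omega>. \<lambda>t\<in>{0..1}. B i t \<omega>) {1..k} \<and>
      (\<forall>t\<in>{0..1}. \<forall>\<omega>\<in>space M. R t \<omega> = sqrt (\<Sum>i=1..k. (B i t \<omega>)\<^sup>2)))"

definition weighted_norm :: "(real \<Rightarrow> real) \<Rightarrow> (real \<Rightarrow> real) \<Rightarrow> real" where
  "weighted_norm \<psi> x = sqrt (LBINT t:{0..1}. (x t)\<^sup>2 * \<psi> t)"

end

theory Submission
  imports Defs "HOL-Complex_Analysis.Complex_Analysis" "HOL-Real_Asymp.Real_Asymp"
begin

text \<open>
  Let \<open>Q\<close> be the squared norm. For the Riemann sums of \<open>Q\<close> the Laplace transform is computed by a
  three-term recursion, whose limit is the Cauchy problem \<open>u'' = 2z\<psi>u\<close>, \<open>u(0) = 0\<close>, \<open>u'(0) = 1\<close>;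
  hence \<open>L(z) = E exp (-zQ)\<close> satisfies \<open>L(z)\<^sup>2 u(1)\<^sup>k = 1\<close> for real and, by analytic continuation, for
  all \<open>z\<close> in the right half-plane. The Liouville--Green approximation gives the behaviour of \<open>u(1)\<close>,
  and so of \<open>L(z)\<close>, uniformly as \<open>Re z\<close> tends to infinity. Laplace inversion along the vertical line through
  the saddle point of \<open>zx - c\<surd>z\<close>, with \<open>c = k\<theta>/\<surd>2\<close> and \<open>x = \<epsilon>\<^sup>2\<close>, and dominated convergence on that
  line then give the asymptotics of the distribution function of \<open>Q\<close> itself.
\<close>

section \<open>The Cauchy problem as a Volterra equation\<close>

text \<open>The behaviour of \<open>L\<close> on the real axis determines the logarithm of the
  probability to first order, but not the factor in front of the exponential. This is why
  \<open>L\<close> is needed at complex \<open>z\<close>, with a relative error that is small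
  uniformly in \<open>Im z\<close>. The transform itself is \<open>u(1)\<close> to the power
  \<open>-k/2\<close>, for odd \<open>k\<close> a root of a complex function; squaring removes the
  choice of a branch and leaves a holomorphic identity.

  The number \<open>u(1)\<close> is a ratio of determinants: the covariance
  \<open>min s t - s t\<close> is the Dirichlet Green function of
  \<open>- d\<^sup>2/dt\<^sup>2\<close>, and the weight \<open>exp (- zQ)\<close> adds the potential
  \<open>2z\<psi>\<close>.

  The saddle equation \<open>x = c / (2\<surd>z)\<close> is solved by \<open>z = \<sigma>^4\<close>.
  The second derivative of the exponent there is \<open>c / (4\<sigma>^6)\<close>, so the natural
  scale along the line is \<open>t = \<sigma>^3 \<tau>\<close>, and the limit of the integrand is
  \<open>exp (- c \<tau>\<^sup>2 / 8)\<close>. Far from the saddle \<open>L\<close> decays like the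
  exponential of a negative multiple of \<open>\<surd>|t|\<close>; this makes the inversion integral
  converge absolutely and provides the majorant.\<close>

lemma iterated_integral_has_vector_derivative:
  fixes k :: "real \<Rightarrow> 'a::banach"
  assumes k: "continuous_on {0..1} k" and t: "t \<in> {0..1}"
  shows "((\<lambda>t. integral {0..t} (\<lambda>r. (t - r) *\<^sub>R k r)) has_vector_derivative integral {0..t} k) (at t within {0..1})"
proof -
  have k': "continuous_on {0..1} (\<lambda>r. r *\<^sub>R k r)" using k by (intro continuous_intros)
  have sub: "continuous_on {0..s} f" if "continuous_on {0..1} f" "s \<in> {0..1}" for f :: "real \<Rightarrow> 'a" and s
    using that by (auto intro: continuous_on_subset)
  have eq: "integral {0..s} (\<lambda>r. (s - r) *\<^sub>R k r) = s *\<^sub>R integral {0..s} k - integral {0..s} (\<lambda>r. r *\<^sub>R k r)"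
    if "s \<in> {0..1}" for s
    unfolding scaleR_diff_left
    using integrable_continuous_real[OF sub[OF k that]] integrable_continuous_real[OF sub[OF k' that]]
    by (subst Henstock_Kurzweil_Integration.integral_diff) (auto intro: integrable_cmul)
  have "((\<lambda>s. s *\<^sub>R integral {0..s} k - integral {0..s} (\<lambda>r. r *\<^sub>R k r)) has_vector_derivative
      (t *\<^sub>R k t + 1 *\<^sub>R integral {0..t} k) - t *\<^sub>R k t) (at t within {0..1})"
    using integral_has_vector_derivative[OF k t] integral_has_vector_derivative[OF k' t]
    by (intro has_vector_derivative_diff has_vector_derivative_scaleR) (auto intro: derivative_eq_intros)
  hence "((\<lambda>s. s *\<^sub>R integral {0..s} k - integral {0..s} (\<lambda>r. r *\<^sub>R k r)) has_vector_derivative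
      integral {0..t} k) (at t within {0..1})" by simp
  thus ?thesis
    by (rule has_vector_derivative_transform[OF t, rotated]) (use eq in auto)
qed

text \<open>Picard iteration for \<open>u'' = z h u\<close>, sorted by powers of \<open>z\<close>.
  The coefficients are real even when \<open>z\<close> is not, so the dependence on \<open>z\<close>
  is that of a power series with real coefficients: holomorphic, and real on the real axis.\<close>

primrec volterra_coeff :: "(real \<Rightarrow> real) \<Rightarrow> nat \<Rightarrow> real \<Rightarrow> real" where
  "volterra_coeff h 0 = (\<lambda>t. t)"
| "volterra_coeff h (Suc n) = (\<lambda>t. integral {0..t} (\<lambda>r. (t - r) *\<^sub>R (h r * volterra_coeff h n r)))"

definition volterra_sol :: "(real \<Rightarrow> real) \<Rightarrow> complex \<Rightarrow> real \<Rightarrow> complex" where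
  "volterra_sol h z t = (\<Sum>n. of_real (volterra_coeff h n t) * z ^ n)"

context
  fixes h :: "real \<Rightarrow> real" and H :: real
  assumes h_cont: "continuous_on {0..1} h" and h_le: "\<And>t. t \<in> {0..1} \<Longrightarrow> \<bar>h t\<bar> \<le> H"
begin

lemma volterra_coeff_continuous: "continuous_on {0..1} (volterra_coeff h n)"
proof (induction n)
  case (Suc n)
  hence k: "continuous_on {0..1} (\<lambda>r. h r * volterra_coeff h n r)"
    using h_cont by (intro continuous_intros)
  show ?case unfolding volterra_coeff.simps
    by (rule continuous_on_vector_derivative[OF iterated_integral_has_vector_derivative[OF k]])
qed auto

text \<open>Each integration of \<open>r ^ n\<close> contributes one factor to the factorial. The
  kernel factor \<open>t - r\<close> is merely bounded by 1; this gives up the second factorial of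
  the double integration and still yields convergence at every \<open>z\<close>.\<close>

lemma volterra_coeff_bound:
  assumes "t \<in> {0..1}"
  shows "\<bar>volterra_coeff h n t\<bar> \<le> (H * t) ^ n / fact n"
  using assms
proof (induction n arbitrary: t)
  case (Suc n)
  have H: "H \<ge> 0" using h_le[of 0] by simp
  have k: "continuous_on {0..t} (\<lambda>r. h r * volterra_coeff h n r)"
    using Suc.prems by (intro continuous_intros continuous_on_subset[OF h_cont] continuous_on_subset[OF volterra_coeff_continuous]) auto
  have "((\<lambda>r. H ^ Suc n * r ^ n / fact n) has_integral
      H ^ Suc n * t ^ Suc n / fact (Suc n) - H ^ Suc n * 0 ^ Suc n / fact (Suc n)) {0..t}"
  proof (intro fundamental_theorem_of_calculus)
    fix x assume "x \<in> {0..t}"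
    have "real (Suc n) / fact (Suc n) = 1 / (fact n :: real)"
      by (simp add: fact_Suc divide_simps del: of_nat_Suc)
    hence "H ^ Suc n * (real (Suc n) * x ^ n) / fact (Suc n) = H ^ Suc n * x ^ n / fact n"
      by (metis (no_types, opaque_lifting) mult.commute mult.left_commute times_divide_eq_left times_divide_eq_right mult_1)
    moreover have "((\<lambda>t. H ^ Suc n * t ^ Suc n / fact (Suc n)) has_real_derivative
       H ^ Suc n * (real (Suc n) * x ^ n) / fact (Suc n)) (at x within {0..t})"
      using DERIV_power[OF DERIV_ident, of "Suc n" x "{0..t}"]
      by (intro DERIV_cdivide DERIV_cmult) (simp add: mult_ac)
    ultimately show "((\<lambda>t. H ^ Suc n * t ^ Suc n / fact (Suc n)) has_vector_derivative H ^ Suc n * x ^ n / fact n) (at x within {0..t})"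
      by (simp only: has_real_derivative_iff_has_vector_derivative)
  qed (use Suc.prems in auto)
  hence I: "((\<lambda>r. H ^ Suc n * r ^ n / fact n) has_integral H ^ Suc n * t ^ Suc n / fact (Suc n)) {0..t}" by simp
  have "norm (integral {0..t} (\<lambda>r. (t - r) *\<^sub>R (h r * volterra_coeff h n r))) \<le> integral {0..t} (\<lambda>r. H ^ Suc n * r ^ n / fact n)"
  proof (rule integral_norm_bound_integral)
    show "(\<lambda>r. (t - r) *\<^sub>R (h r * volterra_coeff h n r)) integrable_on {0..t}"
      using k by (intro integrable_continuous_real continuous_on_scaleR k continuous_intros)
    show "(\<lambda>r. H ^ Suc n * r ^ n / fact n) integrable_on {0..t}" using I by blast
    fix r assume r: "r \<in> {0..t}"
    have "\<bar>t - r\<bar> * (\<bar>h r\<bar> * \<bar>volterra_coeff h n r\<bar>) \<le> 1 * (H * ((H * r) ^ n / fact n))"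
      using r Suc.prems H by (intro mult_mono Suc.IH h_le) auto
    thus "norm ((t - r) *\<^sub>R (h r * volterra_coeff h n r)) \<le> H ^ Suc n * r ^ n / fact n"
      by (simp add: abs_mult power_mult_distrib mult_ac)
  qed
  also have "\<dots> = (H * t) ^ Suc n / fact (Suc n)" using integral_unique[OF I] by (simp add: power_mult_distrib mult_ac)
  finally show ?case by simp
qed simp

lemma volterra_term_bound:
  assumes "t \<in> {0..1}"
  shows "norm (of_real (volterra_coeff h n t) * z ^ n :: complex) \<le> (H * norm z) ^ n / fact n"
proof -
  have H: "H \<ge> 0" using h_le[of 0] by simp
  have "\<bar>volterra_coeff h n t\<bar> \<le> (H * t) ^ n / fact n" by (rule volterra_coeff_bound[OF assms])
  also have "\<dots> \<le> H ^ n / fact n"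
    using assms H by (intro divide_right_mono power_mono) (auto simp: mult_left_le)
  finally have "\<bar>volterra_coeff h n t\<bar> * norm z ^ n \<le> H ^ n / fact n * norm z ^ n"
    by (intro mult_right_mono) auto
  thus ?thesis by (simp add: norm_mult norm_power power_mult_distrib)
qed

lemma exp_terms_summable: "summable (\<lambda>n. x ^ n / fact n :: real)"
  using summable_exp[of x] by (simp add: field_simps)

lemma volterra_summable:
  assumes "t \<in> {0..1}"
  shows "summable (\<lambda>n. of_real (volterra_coeff h n t) * z ^ n :: complex)"
  by (rule summable_comparison_test'[OF exp_terms_summable volterra_term_bound[OF assms]])

lemma volterra_uniform_limit:
  "uniform_limit {0..1} (\<lambda>N t. \<Sum>n<N. of_real (volterra_coeff h n t) * z ^ n) (volterra_sol h z) sequentially"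
  unfolding volterra_sol_def[abs_def]
  by (rule Weierstrass_m_test[OF volterra_term_bound exp_terms_summable])

lemma volterra_sol_continuous: "continuous_on {0..1} (volterra_sol h z)"
  by (rule uniform_limit_theorem[OF _ volterra_uniform_limit])
     (auto intro!: always_eventually continuous_intros volterra_coeff_continuous)

lemma volterra_sol_holomorphic:
  assumes "t \<in> {0..1}"
  shows "(\<lambda>z. volterra_sol h z t) holomorphic_on A"
proof -
  have "(\<lambda>z. volterra_sol h z t) holomorphic_on ball 0 r" for r
    unfolding volterra_sol_def
    by (rule power_series_holomorphic[where a = "\<lambda>n. of_real (volterra_coeff h n t)"])
       (use volterra_summable[OF assms] in \<open>auto intro: summable_sums\<close>)
  hence "(\<lambda>z. volterra_sol h z t) holomorphic_on (\<Union>r. ball 0 r)"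
    by (intro holomorphic_on_UN_open) auto
  thus ?thesis by (rule holomorphic_on_subset) (auto intro: gt_ex)
qed

text \<open>Uniform convergence on the compact interval permits integration term by term. The
  integral of the \<open>n\<close>-th term carries the coefficient of index \<open>n + 1\<close>,
  and the factor \<open>z\<close> in front supplies the missing power.\<close>

lemma volterra_sol_eq:
  assumes t: "t \<in> {0..1}"
  shows "volterra_sol h z t = of_real t + z * integral {0..t} (\<lambda>r. (t - r) *\<^sub>R (of_real (h r) * volterra_sol h z r))"
proof -
  define f where "f N r = (\<Sum>n<N. (t - r) *\<^sub>R (of_real (h r) * (of_real (volterra_coeff h n r) * z ^ n)))" for N r
  have hb: "bounded ((\<lambda>r. (t - r) *\<^sub>R complex_of_real (h r)) ` {0..1})"
    by (intro compact_imp_bounded compact_continuous_image continuous_intros h_cont) auto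
  have vb: "bounded (volterra_sol h z ` {0..1})"
    by (intro compact_imp_bounded compact_continuous_image volterra_sol_continuous) auto
  have "uniform_limit {0..1} (\<lambda>N r. ((t - r) *\<^sub>R complex_of_real (h r)) * (\<Sum>n<N. of_real (volterra_coeff h n r) * z ^ n))
      (\<lambda>r. ((t - r) *\<^sub>R complex_of_real (h r)) * volterra_sol h z r) sequentially"
    by (intro uniform_lim_mult[OF uniform_limit_const volterra_uniform_limit hb vb])
  hence "uniform_limit {0..1} f (\<lambda>r. (t - r) *\<^sub>R (of_real (h r) * volterra_sol h z r)) sequentially"
    by (simp add: f_def[abs_def] sum_distrib_left scaleR_sum_right mult_ac)
  hence ul: "uniform_limit {0..t} f (\<lambda>r. (t - r) *\<^sub>R (of_real (h r) * volterra_sol h z r)) sequentially"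
    by (rule uniform_limit_on_subset) (use t in auto)
  have vc: "continuous_on {0..t} (volterra_coeff h n)" "continuous_on {0..t} h" for n
    using t by (auto intro!: continuous_on_subset[OF h_cont] continuous_on_subset[OF volterra_coeff_continuous])
  have int: "(f N has_integral (\<Sum>n<N. of_real (volterra_coeff h (Suc n) t) * z ^ n)) {0..t}" for N
    unfolding f_def
  proof (intro has_integral_sum)
    fix n
    have "(\<lambda>r. (t - r) *\<^sub>R (h r * volterra_coeff h n r)) integrable_on {0..t}"
      using vc by (intro integrable_continuous_real continuous_intros)
    hence "((\<lambda>r. (t - r) *\<^sub>R (h r * volterra_coeff h n r)) has_integral volterra_coeff h (Suc n) t) {0..t}"
      by (simp add: has_integral_iff)
    from has_integral_mult_left[OF has_integral_of_real[OF this], of "z ^ n"]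
    show "((\<lambda>r. (t - r) *\<^sub>R (of_real (h r) * (of_real (volterra_coeff h n r) * z ^ n))) has_integral
       of_real (volterra_coeff h (Suc n) t) * z ^ n) {0..t}"
      by (simp add: scaleR_conv_of_real mult_ac)
  qed auto
  have "continuous_on {0..t} (f N)" for N
    unfolding f_def using vc by (intro continuous_intros)
  from uniform_limit_integral[OF ul this] obtain I J where
    IJ: "\<And>N. (f N has_integral I N) {0..t}"
      "((\<lambda>r. (t - r) *\<^sub>R (of_real (h r) * volterra_sol h z r)) has_integral J) {0..t}"
      "I \<longlonglongrightarrow> J"
    by auto
  have "I = (\<lambda>N. integral {0..t} (f N))" "J = integral {0..t} (\<lambda>r. (t - r) *\<^sub>R (of_real (h r) * volterra_sol h z r))"
    using integral_unique[OF IJ(1)] integral_unique[OF IJ(2)] by auto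
  with IJ(3) have "(\<lambda>N. integral {0..t} (f N)) \<longlonglongrightarrow> integral {0..t} (\<lambda>r. (t - r) *\<^sub>R (of_real (h r) * volterra_sol h z r))"
    by simp
  hence "(\<lambda>n. of_real (volterra_coeff h (Suc n) t) * z ^ n) sums integral {0..t} (\<lambda>r. (t - r) *\<^sub>R (of_real (h r) * volterra_sol h z r))"
    using integral_unique[OF int] by (simp add: sums_def)
  hence "(\<lambda>n. z * (of_real (volterra_coeff h (Suc n) t) * z ^ n)) sums (z * integral {0..t} (\<lambda>r. (t - r) *\<^sub>R (of_real (h r) * volterra_sol h z r)))"
    by (rule sums_mult)
  hence "(\<lambda>n. of_real (volterra_coeff h (Suc n) t) * z ^ Suc n) sums (z * integral {0..t} (\<lambda>r. (t - r) *\<^sub>R (of_real (h r) * volterra_sol h z r)))"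
    by (simp add: mult_ac)
  \<comment> \<open>Index 0, whose coefficient is \<open>t\<close>, is put back in front of the
    shifted series.\<close>
  hence "(\<lambda>n. of_real (volterra_coeff h n t) * z ^ n) sums (z * integral {0..t} (\<lambda>r. (t - r) *\<^sub>R (of_real (h r) * volterra_sol h z r)) + of_real t)"
    by (subst (asm) sums_Suc_iff) simp
  thus ?thesis unfolding volterra_sol_def by (simp add: sums_iff)
qed

lemma volterra_sol_ode:
  fixes z defines "u' \<equiv> (\<lambda>t. 1 + z * integral {0..t} (\<lambda>r. of_real (h r) * volterra_sol h z r))"
  assumes t: "t \<in> {0..1}"
  shows "(volterra_sol h z has_vector_derivative u' t) (at t within {0..1})"
    and "(u' has_vector_derivative z * of_real (h t) * volterra_sol h z t) (at t within {0..1})"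
proof -
  have k: "continuous_on {0..1} (\<lambda>r. of_real (h r) * volterra_sol h z r)"
    by (intro continuous_intros h_cont volterra_sol_continuous)
  have "((\<lambda>t. of_real t + z * integral {0..t} (\<lambda>r. (t - r) *\<^sub>R (of_real (h r) * volterra_sol h z r))) has_vector_derivative
      of_real 1 + z * integral {0..t} (\<lambda>r. of_real (h r) * volterra_sol h z r)) (at t within {0..1})"
    by (intro has_vector_derivative_add has_vector_derivative_mult_right has_vector_derivative_of_real
        iterated_integral_has_vector_derivative[OF k t]) (auto intro: derivative_eq_intros)
  from has_vector_derivative_transform[OF t volterra_sol_eq this]
  show "(volterra_sol h z has_vector_derivative u' t) (at t within {0..1})"
    unfolding u'_def by simp
  have "((\<lambda>t. 1 + z * integral {0..t} (\<lambda>r. of_real (h r) * volterra_sol h z r)) has_vector_derivative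
     0 + z * (of_real (h t) * volterra_sol h z t)) (at t within {0..1})"
    by (intro has_vector_derivative_add has_vector_derivative_mult_right has_vector_derivative_const
        integral_has_vector_derivative[OF k t])
  thus "(u' has_vector_derivative z * of_real (h t) * volterra_sol h z t) (at t within {0..1})"
    unfolding u'_def by (simp add: mult_ac)
qed

lemma volterra_sol_0: "volterra_sol h z 0 = 0"
  using volterra_sol_eq[of 0 z] by simp

end

section \<open>Liouville--Green asymptotics\<close>

text \<open>Only the real part of \<open>\<omega>\<close> enters the bound, which makes the error
  estimates below uniform in \<open>Im \<omega>\<close>.\<close>

lemma norm_sinh_le:
  assumes "x \<ge> 0" "Re \<omega> \<ge> 0"
  shows "norm (sinh (\<omega> * of_real x)) \<le> exp (Re \<omega> * x)"
proof -
  have "norm (sinh (\<omega> * of_real x)) = norm (exp (\<omega> * of_real x) - exp (- (\<omega> * of_real x))) / 2"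
    by (simp add: sinh_def norm_divide)
  also have "\<dots> \<le> (exp (Re \<omega> * x) + exp (- (Re \<omega> * x))) / 2"
    using norm_triangle_ineq4[of "exp (\<omega> * of_real x)" "exp (- (\<omega> * of_real x))"] by (simp add: norm_exp_eq_Re)
  also have "\<dots> \<le> exp (Re \<omega> * x)"
    using mult_nonneg_nonneg[OF assms(2,1)] by simp
  finally show ?thesis .
qed

lemma has_real_derivative_powr_comp:
  assumes "(f has_real_derivative f') (at t within A)" "f t > 0"
  shows "((\<lambda>t. f t powr r) has_real_derivative r * f t powr (r - 1) * f') (at t within A)"
  using DERIV_chain2[OF has_real_derivative_powr[OF assms(2), of r] assms(1)] .

text \<open>
  The Liouville--Green approximation: \<open>K r = g(t) g(r) sinh (\<omega>(S(t) - S(r))) / \<omega>\<close>, with \<open>g = \<psi>\<^bsup>-1/4\<^esup>\<close> and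
  \<open>S' = \<surd>\<psi>\<close>, is the Green function of \<open>w'' = (\<omega>\<^sup>2\<psi> + g''/g) w\<close>, so that an exact solution \<open>u\<close>
  satisfies a Volterra equation whose kernel is smaller than \<open>u\<close> by a factor \<open>1/\<omega>\<close>.
\<close>

lemma liouville_green_identity:
  fixes u u' :: "real \<Rightarrow> complex" and \<psi> \<psi>' \<psi>'' S :: "real \<Rightarrow> real"
  defines "g \<equiv> \<lambda>t. \<psi> t powr (-1/4)"
  defines "g'' \<equiv> \<lambda>t. (5/16) * \<psi> t powr (-9/4) * (\<psi>' t)\<^sup>2 - (1/4) * \<psi> t powr (-5/4) * \<psi>'' t"
  assumes pos: "\<And>t. t \<in> {0..1} \<Longrightarrow> \<psi> t > 0"
    and d1: "\<And>t. t \<in> {0..1} \<Longrightarrow> (\<psi> has_real_derivative \<psi>' t) (at t within {0..1})"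
    and d2: "\<And>t. t \<in> {0..1} \<Longrightarrow> (\<psi>' has_real_derivative \<psi>'' t) (at t within {0..1})"
    and S: "\<And>t. t \<in> {0..1} \<Longrightarrow> (S has_real_derivative \<psi> t powr (1/2)) (at t within {0..1})"
    and u: "\<And>t. t \<in> {0..1} \<Longrightarrow> (u has_vector_derivative u' t) (at t within {0..1})"
      "\<And>t. t \<in> {0..1} \<Longrightarrow> (u' has_vector_derivative \<omega>\<^sup>2 * of_real (\<psi> t) * u t) (at t within {0..1})"
      "u 0 = 0" "u' 0 = 1"
    and \<omega>: "\<omega> \<noteq> 0" and t: "t \<in> {0..1}"
  shows "((\<lambda>r. of_real (g t * g'' r) / \<omega> * sinh (\<omega> * of_real (S t - S r)) * u r) has_integral
    of_real (g t * g 0) / \<omega> * sinh (\<omega> * of_real (S t - S 0)) - u t) {0..t}"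
proof -
  \<comment> \<open>The function \<open>b\<close> equals both \<open>1 / g\<close> and
    \<open>g \<surd>\<psi>\<close>. Because \<open>b' = - g' \<surd>\<psi>\<close>, the terms with
    \<open>c\<close> cancel in the second derivative of \<open>g s\<close>.\<close>
  define b where "b r = \<psi> r powr (1/4)" for r
  define g' where "g' r = -1/4 * \<psi> r powr (-5/4) * \<psi>' r" for r
  define s c where "s r = sinh (\<omega> * of_real (S t - S r))" and "c r = cosh (\<omega> * of_real (S t - S r))" for r
  have T: "{0..t} \<subseteq> {0..1}" using t by auto
  have gd: "(g has_real_derivative g' r) (at r within {0..1})" if "r \<in> {0..1}" for r
    using has_real_derivative_powr_comp[OF d1 pos, of r "-1/4"] that by (simp add: g_def g'_def)
  have g'd: "(g' has_real_derivative g'' r) (at r within {0..1})" if "r \<in> {0..1}" for r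
    using DERIV_cmult[OF DERIV_mult[OF has_real_derivative_powr_comp[OF d1 pos, of r "-5/4"] d2], of "-1/4"] that
    unfolding g'_def[abs_def] g''_def by (simp add: algebra_simps power2_eq_square)
  have bd: "(b has_real_derivative - (g' r * \<psi> r powr (1/2))) (at r within {0..1})" if "r \<in> {0..1}" for r
    using has_real_derivative_powr_comp[OF d1 pos, of r "1/4"] that
    by (simp add: b_def[abs_def] g'_def powr_add[symmetric] mult_ac flip: mult.assoc)
  have rel: "b r * \<psi> r powr (1/2) = g r * \<psi> r" "g r * \<psi> r powr (1/2) = b r" "g r * b r = 1" if "r \<in> {0..1}" for r
    using pos[OF that] powr_one[of "\<psi> r"] powr_add[of "\<psi> r" "-1/4" 1]
    by (simp_all add: b_def g_def powr_add[symmetric])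
  have lift: "((\<lambda>r. complex_of_real (f r)) has_vector_derivative of_real f') (at r within {0..1})"
    if "(f has_real_derivative f') (at r within {0..1})" for f f' r
    using that by (intro has_vector_derivative_of_real) (simp add: has_real_derivative_iff_has_vector_derivative)
  have arg: "((\<lambda>r. \<omega> * of_real (S t - S r)) has_vector_derivative - \<omega> * of_real (\<psi> r powr (1/2))) (at r within {0..1})"
    if "r \<in> {0..1}" for r
    using has_vector_derivative_mult_right[OF lift[OF DERIV_diff[OF DERIV_const[of "S t"] S[OF that]]], of \<omega>]
    by simp
  have sd: "(s has_vector_derivative - \<omega> * of_real (\<psi> r powr (1/2)) * c r) (at r within {0..1})" if "r \<in> {0..1}" for r
    unfolding s_def[abs_def] c_def
    using field_vector_diff_chain_within[OF arg[OF that] has_field_derivative_sinh[OF DERIV_ident, THEN has_field_derivative_at_within]]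
    by (simp add: o_def mult_ac)
  have cd: "(c has_vector_derivative - \<omega> * of_real (\<psi> r powr (1/2)) * s r) (at r within {0..1})" if "r \<in> {0..1}" for r
    unfolding c_def[abs_def] s_def
    using field_vector_diff_chain_within[OF arg[OF that] has_field_derivative_cosh[OF DERIV_ident, THEN has_field_derivative_at_within]]
    by (simp add: o_def mult_ac)
  define G where "G r = of_real (g r) * s r" for r
  define G' where "G' r = of_real (g' r) * s r - \<omega> * (of_real (b r) * c r)" for r
  have Gd: "(G has_vector_derivative G' r) (at r within {0..1})" if r: "r \<in> {0..1}" for r
  proof -
    have "(G has_vector_derivative of_real (g r) * (- \<omega> * of_real (\<psi> r powr (1/2)) * c r) + of_real (g' r) * s r) (at r within {0..1})"
      unfolding G_def[abs_def] by (intro has_vector_derivative_mult lift gd sd r)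
    moreover have "of_real (g r) * (- \<omega> * of_real (\<psi> r powr (1/2)) * c r) + of_real (g' r) * s r = G' r"
      unfolding G'_def rel(2)[OF r, symmetric] by (simp add: algebra_simps)
    ultimately show ?thesis by simp
  qed
  have G'd: "(G' has_vector_derivative of_real (g'' r) * s r + \<omega>\<^sup>2 * of_real (\<psi> r) * G r) (at r within {0..1})"
    if r: "r \<in> {0..1}" for r
  proof -
    have "(G' has_vector_derivative
      (of_real (g' r) * (- \<omega> * of_real (\<psi> r powr (1/2)) * c r) + of_real (g'' r) * s r)
      - \<omega> * (of_real (b r) * (- \<omega> * of_real (\<psi> r powr (1/2)) * s r) + of_real (- (g' r * \<psi> r powr (1/2))) * c r))
      (at r within {0..1})"
      unfolding G'_def[abs_def]
      by (intro has_vector_derivative_diff has_vector_derivative_mult has_vector_derivative_mult_right lift g'd sd cd bd r)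
    moreover have "of_real (b r) * (complex_of_real (\<psi> r powr (1/2)) * s r) = of_real (\<psi> r) * G r"
      unfolding G_def mult.assoc[symmetric] of_real_mult[symmetric] rel(1)[OF r] by (simp add: mult_ac)
    hence "\<omega> * (of_real (b r) * (- \<omega> * of_real (\<psi> r powr (1/2)) * s r)) = - (\<omega>\<^sup>2 * of_real (\<psi> r) * G r)"
      by (simp add: power2_eq_square algebra_simps)
    hence "(of_real (g' r) * (- \<omega> * of_real (\<psi> r powr (1/2)) * c r) + of_real (g'' r) * s r)
      - \<omega> * (of_real (b r) * (- \<omega> * of_real (\<psi> r powr (1/2)) * s r) + of_real (- (g' r * \<psi> r powr (1/2))) * c r)
      = of_real (g'' r) * s r + \<omega>\<^sup>2 * of_real (\<psi> r) * G r"
      by (simp add: distrib_left) (simp add: algebra_simps)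
    ultimately show ?thesis by (simp only:)
  qed
  \<comment> \<open>The Wronskian of \<open>u\<close> and \<open>G\<close>: the terms with
    \<open>\<omega>\<^sup>2 \<psi>\<close> cancel in its derivative, and only the perturbation
    \<open>g''\<close> survives. Since \<open>G t = 0\<close> and \<open>u 0 = 0\<close>, its
    boundary values reduce to \<open>\<omega> b(t) u(t)\<close> and
    \<open>g(0) s(0)\<close>.\<close>
  have "((\<lambda>r. u' r * G r - u r * G' r) has_vector_derivative - (of_real (g'' r) * s r * u r)) (at r within {0..t})"
    if r: "r \<in> {0..t}" for r
  proof -
    have r1: "r \<in> {0..1}" using r T by auto
    have "((\<lambda>r. u' r * G r - u r * G' r) has_vector_derivative
      (u' r * G' r + (\<omega>\<^sup>2 * of_real (\<psi> r) * u r) * G r)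
      - (u r * (of_real (g'' r) * s r + \<omega>\<^sup>2 * of_real (\<psi> r) * G r) + u' r * G' r)) (at r within {0..1})"
      by (intro has_vector_derivative_diff has_vector_derivative_mult u Gd G'd r1)
    moreover have "(u' r * G' r + (\<omega>\<^sup>2 * of_real (\<psi> r) * u r) * G r)
      - (u r * (of_real (g'' r) * s r + \<omega>\<^sup>2 * of_real (\<psi> r) * G r) + u' r * G' r) = - (of_real (g'' r) * s r * u r)"
      by (simp add: algebra_simps)
    ultimately show ?thesis using has_vector_derivative_within_subset[OF _ T] by simp
  qed
  from fundamental_theorem_of_calculus[OF _ this] t
  have "((\<lambda>r. - (of_real (g'' r) * s r * u r)) has_integral (u' t * G t - u t * G' t) - (u' 0 * G 0 - u 0 * G' 0)) {0..t}"
    by auto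
  moreover have "u' t * G t - u t * G' t = \<omega> * of_real (b t) * u t"
    by (simp add: G_def G'_def s_def c_def)
  moreover have "u' 0 * G 0 - u 0 * G' 0 = of_real (g 0) * s 0" using u by (simp add: G_def)
  ultimately have "((\<lambda>r. - (of_real (g'' r) * s r * u r)) has_integral \<omega> * of_real (b t) * u t - of_real (g 0) * s 0) {0..t}"
    by simp
  from has_integral_mult_right[OF this, of "- of_real (g t) / \<omega>"]
  have "((\<lambda>r. of_real (g t * g'' r) / \<omega> * s r * u r) has_integral
     - of_real (g t) / \<omega> * (\<omega> * of_real (b t) * u t - of_real (g 0) * s 0)) {0..t}"
    by (simp add: mult_ac)
  moreover have "- of_real (g t) / \<omega> * (\<omega> * of_real (b t) * u t - of_real (g 0) * s 0)
      = of_real (g t * g 0) / \<omega> * s 0 - of_real (g t * b t) * u t"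
    using \<omega> by (simp add: field_simps)
  ultimately show ?thesis using rel(3)[OF t] by (simp add: s_def)
qed

text \<open>Measured with the weight \<open>exp (- Re \<omega> S)\<close>, the solution has a
  maximum \<open>m\<close>, and the Volterra equation bounds \<open>m\<close> by
  \<open>D / norm \<omega>\<close> times \<open>1 + m\<close>; for large \<open>\<omega>\<close> the
  term with \<open>m\<close> is absorbed. The constant \<open>E\<close> is fixed before
  \<open>\<omega>\<close> and \<open>u\<close>, so the estimate is uniform. The exponential in the
  error is the decaying half of \<open>sinh\<close>, which is small only when
  \<open>Re \<omega>\<close> is large.\<close>

lemma liouville_green_asymptotics:
  fixes \<psi> :: "real \<Rightarrow> real"
  assumes pos: "\<And>t. t \<in> {0..1} \<Longrightarrow> \<psi> t > 0" and C2: "C2_on_interval 0 1 \<psi>"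
  defines "\<theta> \<equiv> integral {0..1} (\<lambda>t. sqrt (\<psi> t))"
  obtains E where "\<And>\<omega> u u'. \<lbrakk>Re \<omega> \<ge> 0; norm \<omega> \<ge> E;
      \<And>t. t \<in> {0..1} \<Longrightarrow> (u has_vector_derivative u' t) (at t within {0..1});
      \<And>t. t \<in> {0..1} \<Longrightarrow> (u' has_vector_derivative \<omega>\<^sup>2 * of_real (\<psi> t) * u t) (at t within {0..1});
      u 0 = 0; u' 0 = 1\<rbrakk> \<Longrightarrow>
      norm (2 * \<omega> * exp (- \<omega> * of_real \<theta>) * of_real (\<psi> 0 powr (1/4) * \<psi> 1 powr (1/4)) * u 1 - 1)
        \<le> E / norm \<omega> + exp (- 2 * Re \<omega> * \<theta>)" "E > 0"
proof -
  obtain \<psi>' \<psi>'' where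
    d1: "\<And>t. t \<in> {0..1} \<Longrightarrow> (\<psi> has_real_derivative \<psi>' t) (at t within {0..1})" and
    d2: "\<And>t. t \<in> {0..1} \<Longrightarrow> (\<psi>' has_real_derivative \<psi>'' t) (at t within {0..1})" and
    c2: "continuous_on {0..1} \<psi>''"
    using C2 unfolding C2_on_interval_def by blast
  have c0: "continuous_on {0..1} \<psi>" by (rule DERIV_continuous_on, rule d1)
  have c1: "continuous_on {0..1} \<psi>'" by (rule DERIV_continuous_on, rule d2)
  have nz: "\<psi> t \<noteq> 0" if "t \<in> {0..1}" for t using pos[OF that] by simp
  define g where "g t = \<psi> t powr (-1/4)" for t
  define g'' where "g'' t = (5/16) * \<psi> t powr (-9/4) * (\<psi>' t)\<^sup>2 - (1/4) * \<psi> t powr (-5/4) * \<psi>'' t" for t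
  define S where "S t = integral {0..t} (\<lambda>r. \<psi> r powr (1/2))" for t
  have powc: "continuous_on {0..1} (\<lambda>t. \<psi> t powr r)" for r
    using nz by (intro continuous_on_powr' c0 continuous_on_const) (use pos in \<open>auto simp: less_imp_le\<close>)
  have gc: "continuous_on {0..1} g" "continuous_on {0..1} g''"
    unfolding g_def[abs_def] g''_def[abs_def] by (intro continuous_intros powc c1 c2)+
  have bdd: "\<exists>C. \<forall>t\<in>{0..1}. \<bar>f t\<bar> \<le> C" if "continuous_on {0..1} f" for f :: "real \<Rightarrow> real"
    using compact_imp_bounded[OF compact_continuous_image[OF that]] by (auto simp: bounded_iff)
  obtain C1 where C1: "\<forall>t\<in>{0..1}. \<bar>g t\<bar> \<le> C1" using bdd[OF gc(1)] by blast
  obtain C2 where C2: "\<forall>t\<in>{0..1}. \<bar>g'' t\<bar> \<le> C2" using bdd[OF gc(2)] by blast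
  define C where "C = max 1 (max C1 C2)"
  have C: "C \<ge> 1" "\<And>t. t \<in> {0..1} \<Longrightarrow> \<bar>g t\<bar> \<le> C" "\<And>t. t \<in> {0..1} \<Longrightarrow> \<bar>g'' t\<bar> \<le> C"
    using C1 C2 by (fastforce simp: C_def)+
  define D where "D = C * C"
  have D: "D \<ge> 1" using mult_mono[OF C(1) C(1)] C(1) by (simp add: D_def)
  have Sd: "(S has_real_derivative \<psi> t powr (1/2)) (at t within {0..1})" if "t \<in> {0..1}" for t
    unfolding S_def[abs_def] using integral_has_real_derivative[OF powc that] .
  have S0: "S 0 = 0" by (simp add: S_def)
  have S1: "S 1 = \<theta>" unfolding S_def \<theta>_def
    by (intro integral_cong) (use pos in \<open>auto simp: powr_half_sqrt less_imp_le\<close>)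
  have Sc: "continuous_on {0..1} S" by (rule DERIV_continuous_on, rule Sd)
  have Smono: "S r \<le> S t" if "0 \<le> r" "r \<le> t" "t \<le> 1" for r t
  proof -
    have sub: "(\<lambda>r. \<psi> r powr (1/2)) integrable_on {a..b}" if "0 \<le> a" "b \<le> 1" for a b
      by (rule integrable_continuous_real, rule continuous_on_subset[OF powc]) (use that in auto)
    show ?thesis unfolding S_def
      by (rule integral_subset_le) (use that sub in auto)
  qed
  define k where "k = \<psi> 0 powr (1/4) * \<psi> 1 powr (1/4)"
  have kpos: "k > 0" using pos[of 0] pos[of 1] by (simp add: k_def)
  have kg: "k * (g 1 * g 0) = 1"
    using pos[of 0] pos[of 1] by (simp add: k_def g_def powr_minus field_simps)
  \<comment> \<open>The summand \<open>2 * D\<close> ensures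
    \<open>D / norm \<omega> \<le> 1/2\<close>, which absorbs \<open>m\<close>. The other summand is
    what the final bound \<open>2 * k * D * m\<close> becomes with
    \<open>m \<le> 2 * D / norm \<omega>\<close>.\<close>
  define E where "E = 4 * k * D\<^sup>2 + 2 * D"
  have Epos: "E > 0" "E \<ge> 2 * D" using kpos D by (auto simp: E_def intro!: add_nonneg_pos mult_nonneg_nonneg)
  show thesis
  proof (rule that[OF _ Epos(1)])
    fix \<omega> :: complex and u u' :: "real \<Rightarrow> complex"
    assume re: "Re \<omega> \<ge> 0" and large: "norm \<omega> \<ge> E"
      and u: "\<And>t. t \<in> {0..1} \<Longrightarrow> (u has_vector_derivative u' t) (at t within {0..1})"
      "\<And>t. t \<in> {0..1} \<Longrightarrow> (u' has_vector_derivative \<omega>\<^sup>2 * of_real (\<psi> t) * u t) (at t within {0..1})"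
      "u 0 = 0" "u' 0 = 1"
    have \<omega>: "norm \<omega> \<ge> 2 * D" "norm \<omega> > 0" "\<omega> \<noteq> 0" using large Epos by auto
    define w where "w t = of_real (g t * g 0) / \<omega> * sinh (\<omega> * of_real (S t))" for t
    have id: "((\<lambda>r. of_real (g t * g'' r) / \<omega> * sinh (\<omega> * of_real (S t - S r)) * u r) has_integral w t - u t) {0..t}"
      if "t \<in> {0..1}" for t
      using liouville_green_identity[OF pos d1 d2 Sd u \<omega>(3) that] by (simp add: w_def g_def g''_def S0)
    have w_le: "norm (w t) \<le> D / norm \<omega> * exp (Re \<omega> * S t)" if t: "t \<in> {0..1}" for t
    proof -
      have "\<bar>g t * g 0\<bar> \<le> D" unfolding D_def abs_mult using C t by (intro mult_mono) auto
      moreover have "norm (sinh (\<omega> * of_real (S t))) \<le> exp (Re \<omega> * S t)"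
        using Smono[of 0 t] t S0 re by (intro norm_sinh_le) auto
      ultimately show ?thesis
        unfolding w_def norm_mult norm_divide norm_of_real
        by (intro mult_mono divide_right_mono) auto
    qed
    have uc: "continuous_on {0..1} u" using u(1) by (rule continuous_on_vector_derivative)
    define e where "e t = norm (u t) * exp (- (Re \<omega> * S t))" for t
    have "continuous_on {0..1} e" unfolding e_def[abs_def] by (intro continuous_intros uc Sc)
    then obtain tm where tm: "tm \<in> {0..1}" "\<And>t. t \<in> {0..1} \<Longrightarrow> e t \<le> e tm"
      using continuous_attains_sup[of "{0..1::real}" e] by auto
    define m where "m = e tm"
    have m0: "m \<ge> 0" by (simp add: m_def e_def)
    have diff: "norm (u t - w t) \<le> D / norm \<omega> * m * exp (Re \<omega> * S t)" if t: "t \<in> {0..1}" for t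
    proof -
      have "norm (w t - u t) \<le> (D / norm \<omega> * m * exp (Re \<omega> * S t)) * measure lborel (cbox 0 t)"
      proof (rule has_integral_bound)
        show "0 \<le> D / norm \<omega> * m * exp (Re \<omega> * S t)" using D m0 by simp
        show "((\<lambda>r. of_real (g t * g'' r) / \<omega> * sinh (\<omega> * of_real (S t - S r)) * u r) has_integral w t - u t) (cbox 0 t)"
          using id[OF t] by simp
        fix r assume "r \<in> cbox 0 t"
        hence r: "r \<in> {0..1}" "r \<le> t" "0 \<le> r" using t by auto
        have 1: "\<bar>g t * g'' r\<bar> \<le> D" unfolding D_def abs_mult using C t r by (intro mult_mono) auto
        have 2: "norm (sinh (\<omega> * of_real (S t - S r))) \<le> exp (Re \<omega> * (S t - S r))"
          using Smono[of r t] r t re by (intro norm_sinh_le) auto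
        have 3: "norm (u r) \<le> m * exp (Re \<omega> * S r)"
        proof -
          have "norm (u r) = e r * exp (Re \<omega> * S r)" by (simp add: e_def mult.assoc exp_add[symmetric])
          also have "\<dots> \<le> m * exp (Re \<omega> * S r)" using tm(2)[OF r(1)] by (simp add: m_def)
          finally show ?thesis .
        qed
        have "norm (of_real (g t * g'' r) / \<omega> * sinh (\<omega> * of_real (S t - S r)) * u r)
            \<le> (D / norm \<omega> * exp (Re \<omega> * (S t - S r))) * (m * exp (Re \<omega> * S r))"
          unfolding norm_mult norm_divide norm_of_real using D
          by (intro mult_mono divide_right_mono 1 2 3) auto
        \<comment> \<open>The growth of \<open>u\<close> up to \<open>r\<close> and that of the
          kernel from \<open>r\<close> to \<open>t\<close> multiply to a quantity free of
          \<open>r\<close>; this is the reason for the weight in \<open>e\<close>.\<close>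
        also have "\<dots> = D / norm \<omega> * m * exp (Re \<omega> * S t)"
          by (simp add: algebra_simps exp_diff)
        finally show "norm (of_real (g t * g'' r) / \<omega> * sinh (\<omega> * of_real (S t - S r)) * u r) \<le> D / norm \<omega> * m * exp (Re \<omega> * S t)" .
      qed
      also have "\<dots> \<le> (D / norm \<omega> * m * exp (Re \<omega> * S t)) * 1"
        using t D m0 by (intro mult_left_mono) auto
      finally show ?thesis by (simp add: norm_minus_commute)
    qed
    have "norm (u tm) \<le> norm (w tm) + norm (u tm - w tm)"
      using norm_triangle_ineq[of "w tm" "u tm - w tm"] by simp
    also have "\<dots> \<le> (D / norm \<omega> * (1 + m)) * exp (Re \<omega> * S tm)"
      using w_le[OF tm(1)] diff[OF tm(1)] by (simp add: algebra_simps add_divide_distrib)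
    finally have "norm (u tm) * exp (- (Re \<omega> * S tm)) \<le> (D / norm \<omega> * (1 + m)) * exp (Re \<omega> * S tm) * exp (- (Re \<omega> * S tm))"
      by (rule mult_right_mono) auto
    hence "m \<le> D / norm \<omega> * (1 + m)" by (simp add: m_def e_def mult.assoc exp_add[symmetric])
    moreover have "D / norm \<omega> \<le> 1 / 2" using \<omega> D by (simp add: field_simps)
    hence "D / norm \<omega> * m \<le> 1 / 2 * m" using m0 by (intro mult_right_mono)
    moreover have "m \<le> 2 * x" if "m \<le> x * (1 + m)" "x * m \<le> 1 / 2 * m" for x
      using that by (simp add: distrib_left)
    ultimately have m: "m \<le> 2 * D / norm \<omega>" by fastforce
    define F where "F = 2 * \<omega> * exp (- \<omega> * of_real \<theta>) * of_real k"
    have "norm (F * (u 1 - w 1)) \<le> (2 * norm \<omega> * exp (- (Re \<omega> * \<theta>)) * k) * (D / norm \<omega> * m * exp (Re \<omega> * \<theta>))"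
      unfolding F_def norm_mult using diff[of 1] kpos S1 by (intro mult_mono) (auto simp: norm_exp_eq_Re)
    also have "\<dots> = 2 * k * D * m" using \<omega> by (simp add: exp_minus field_simps)
    also have "\<dots> \<le> 2 * k * D * (2 * D / norm \<omega>)" using m kpos D by (intro mult_left_mono) auto
    also have "\<dots> \<le> E / norm \<omega>" using D \<omega> by (simp add: E_def power2_eq_square divide_right_mono field_simps)
    finally have 1: "norm (F * (u 1 - w 1)) \<le> E / norm \<omega>" .
    have "F * w 1 = 2 * exp (- \<omega> * of_real \<theta>) * sinh (\<omega> * of_real \<theta>) * of_real (k * (g 1 * g 0))"
      using \<omega> by (simp add: F_def w_def S1)
    also have "\<dots> = exp (- \<omega> * of_real \<theta>) * (exp (\<omega> * of_real \<theta>) - exp (- (\<omega> * of_real \<theta>)))"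
      by (simp add: kg sinh_def scaleR_conv_of_real)
    also have "\<dots> = 1 - exp (- \<omega> * of_real \<theta> - \<omega> * of_real \<theta>)"
      by (simp add: right_diff_distrib exp_add[symmetric])
    finally have "norm (F * w 1 - 1) = exp (- 2 * Re \<omega> * \<theta>)" by (simp add: norm_exp_eq_Re)
    moreover have "norm (F * u 1 - 1) \<le> norm (F * (u 1 - w 1)) + norm (F * w 1 - 1)"
      using norm_triangle_ineq[of "F * (u 1 - w 1)" "F * w 1 - 1"] by (simp add: algebra_simps)
    ultimately show "norm (2 * \<omega> * exp (- \<omega> * of_real \<theta>) * of_real (\<psi> 0 powr (1/4) * \<psi> 1 powr (1/4)) * u 1 - 1)
        \<le> E / norm \<omega> + exp (- 2 * Re \<omega> * \<theta>)"
      using 1 unfolding F_def k_def by simp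
  qed
qed

section \<open>Brownian bridges killed at finitely many points\<close>

text \<open>Completing the square: up to the constant \<open>?C\<close> the integrand is the normal
  density with mean \<open>- b / (1 + A)\<close> and variance \<open>1 / (1 + A)\<close>.\<close>

lemma std_normal_quadratic_exp:
  fixes b A :: real
  assumes "A \<ge> 0"
  shows "(LINT g|std_normal_distribution. exp (- (2 * b * g + A * g\<^sup>2) / 2))
    = exp (b\<^sup>2 / (2 * (1 + A))) / sqrt (1 + A)"
proof -
  let ?\<sigma> = "1 / sqrt (1 + A)" and ?\<mu> = "- b / (1 + A)"
  let ?C = "exp (b\<^sup>2 / (2 * (1 + A))) / sqrt (1 + A)"
  have pos: "1 + A > 0" using assms by simp
  have sq: "?\<sigma>\<^sup>2 = 1 / (1 + A)" using pos by (simp add: power_divide)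
  have eq: "std_normal_density g * exp (- (2 * b * g + A * g\<^sup>2) / 2) = ?C * normal_density ?\<mu> ?\<sigma> g" for g
  proof -
    have "b\<^sup>2 / (2 * D) + - (g - - b / D)\<^sup>2 / (2 * (1 / D)) = - g\<^sup>2 * D / 2 - b * g" if "D > 0" for D
      using that by (simp add: field_simps power2_eq_square)
    from this[OF pos] have e: "b\<^sup>2 / (2 * (1 + A)) + - (g - ?\<mu>)\<^sup>2 / (2 * (1 / (1 + A)))
        = - g\<^sup>2 / 2 + - (2 * b * g + A * g\<^sup>2) / 2"
      by (simp add: field_simps)
    have s: "sqrt (2 * pi * (1 / (1 + A))) = sqrt (2 * pi) / sqrt (1 + A)"
      by (simp add: real_sqrt_divide real_sqrt_mult)
    have "?C * normal_density ?\<mu> ?\<sigma> g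
       = 1 / sqrt (2 * pi) * exp (b\<^sup>2 / (2 * (1 + A)) + - (g - ?\<mu>)\<^sup>2 / (2 * (1 / (1 + A))))"
      unfolding normal_density_def sq s exp_add using pos by (simp add: field_simps)
    also have "\<dots> = std_normal_density g * exp (- (2 * b * g + A * g\<^sup>2) / 2)"
      unfolding e exp_add normal_density_def by simp
    finally show ?thesis by simp
  qed
  have "(LINT g|std_normal_distribution. exp (- (2 * b * g + A * g\<^sup>2) / 2))
      = (LINT g|lborel. std_normal_density g * exp (- (2 * b * g + A * g\<^sup>2) / 2))"
    by (subst integral_density) (auto simp: normal_density_nonneg)
  also have "\<dots> = (LINT g|lborel. ?C * normal_density ?\<mu> ?\<sigma> g)"
    unfolding eq ..
  also have "\<dots> = ?C"
    using pos by (simp add: integral_normal_density)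
  finally show ?thesis .
qed

text \<open>The degenerate case is variance 0 in the same formula for the characteristic function.
  Square integrability needs its own proof, because a Bochner integral with a prescribed value does
  not by itself show that the integrand is integrable.\<close>

lemma (in prob_space) centered_gaussian_rv:
  assumes G: "gaussian_rv M X" and zero: "expectation X = 0"
  shows centered_gaussian_rv_measurable: "X \<in> borel_measurable M"
    and centered_gaussian_rv_square_integrable: "integrable M (\<lambda>\<omega>. (X \<omega>)\<^sup>2)"
    and centered_gaussian_rv_char:
      "(CLINT \<omega>|M. iexp (X \<omega>)) = of_real (exp (- expectation (\<lambda>\<omega>. (X \<omega>)\<^sup>2) / 2))"
proof -
  have "X \<in> borel_measurable M \<and> integrable M (\<lambda>\<omega>. (X \<omega>)\<^sup>2) \<and>
      (CLINT \<omega>|M. iexp (X \<omega>)) = of_real (exp (- expectation (\<lambda>\<omega>. (X \<omega>)\<^sup>2) / 2))"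
    using G unfolding gaussian_rv_def
  proof (elim disjE exE conjE)
    fix \<mu> assume m [measurable]: "X \<in> borel_measurable M" and ae: "AE \<omega> in M. X \<omega> = \<mu>"
    have "expectation X = expectation (\<lambda>_. \<mu>)"
      using ae by (intro integral_cong_AE) auto
    hence "\<mu> = 0" using zero by (simp add: prob_space)
    with ae have ae: "AE \<omega> in M. X \<omega> = 0" by simp
    have i: "integrable M (\<lambda>\<omega>. (X \<omega>)\<^sup>2)"
      using ae by (subst integrable_cong_AE[where g = "\<lambda>_. 0"]) auto
    have "expectation (\<lambda>\<omega>. (X \<omega>)\<^sup>2) = expectation (\<lambda>_. 0)"
      using ae by (intro integral_cong_AE) auto
    hence 1: "expectation (\<lambda>\<omega>. (X \<omega>)\<^sup>2) = 0" by simp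
    have "(CLINT \<omega>|M. iexp (X \<omega>)) = (CLINT \<omega>|M. 1)"
      using ae by (intro integral_cong_AE) auto
    hence "(CLINT \<omega>|M. iexp (X \<omega>)) = 1" by (simp add: prob_space)
    with 1 i m show ?thesis by simp
  next
    fix \<mu> \<sigma> :: real assume s: "0 < \<sigma>" and D: "distributed M lborel X (\<lambda>x. ennreal (normal_density \<mu> \<sigma> x))"
    have m [measurable]: "X \<in> borel_measurable M"
      using distributed_measurable[OF D] by simp
    have "\<mu> = 0" using normal_distributed_expectation[OF s D] zero by simp
    note D = D[unfolded \<open>\<mu> = 0\<close>]
    have v: "expectation (\<lambda>\<omega>. (X \<omega>)\<^sup>2) = \<sigma>\<^sup>2"
      using normal_distributed_variance[OF s D] zero by simp
    \<comment> \<open>A non-integrable square would have integral 0 by convention, whereas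
      \<open>\<sigma>\<^sup>2\<close> is positive.\<close>
    have i: "integrable M (\<lambda>\<omega>. (X \<omega>)\<^sup>2)"
      using v s not_integrable_integral_eq[of M "\<lambda>\<omega>. (X \<omega>)\<^sup>2"] by fastforce
    have Z: "distributed M lborel (\<lambda>x. (X x - 0) / \<sigma>) std_normal_density"
      using D normal_standard_normal_convert[OF s, of X 0] by simp
    have "(CLINT \<omega>|M. iexp (X \<omega>)) = (CLINT \<omega>|M. iexp (\<sigma> * ((X \<omega> - 0) / \<sigma>)))"
      using s by simp
    also have "\<dots> = (CLINT z|distr M lborel (\<lambda>x. (X x - 0) / \<sigma>). iexp (\<sigma> * z))"
      by (subst integral_distr) auto
    also have "\<dots> = char std_normal_distribution \<sigma>"
      unfolding distributed_distr_eq_density[OF Z] char_def ..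
    also have "\<dots> = of_real (exp (- \<sigma>\<^sup>2 / 2))"
      by (simp add: char_std_normal_distribution)
    finally show ?thesis using v i m by simp
  qed
  thus "X \<in> borel_measurable M" "integrable M (\<lambda>\<omega>. (X \<omega>)\<^sup>2)"
    "(CLINT \<omega>|M. iexp (X \<omega>)) = of_real (exp (- expectation (\<lambda>\<omega>. (X \<omega>)\<^sup>2) / 2))" by auto
qed

text \<open>A linear combination is a centred Gaussian variable, and its variance is the quadratic
  form of the covariance. Expanding that variance requires integrable products, for which
  \<open>2 * \<bar>x * y\<bar> \<le> x\<^sup>2 + y\<^sup>2\<close> is used.\<close>

lemma brownian_bridge_char:
  assumes B: "brownian_bridge M B" and S: "finite S" "S \<subseteq> {0..1}"
  shows "(CLINT \<omega>|M. iexp (\<Sum>t\<in>S. c t * B t \<omega>))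
    = of_real (exp (- (\<Sum>s\<in>S. \<Sum>t\<in>S. c s * c t * (min s t - s * t)) / 2))"
    and "t \<in> {0..1} \<Longrightarrow> B t \<in> borel_measurable M"
proof -
  interpret prob_space M using B by (simp add: brownian_bridge_def)
  have lin: "gaussian_rv M (\<lambda>\<omega>. \<Sum>t\<in>T. d t * B t \<omega>)" if "finite T" "T \<subseteq> {0..1}" for T d
    using B that by (auto simp: brownian_bridge_def gaussian_process_def)
  have mean: "expectation (B t) = 0" if "t \<in> {0..1}" for t
    using B that by (auto simp: brownian_bridge_def)
  have cov: "expectation (\<lambda>\<omega>. B s \<omega> * B t \<omega>) = min s t - s * t" if "s \<in> {0..1}" "t \<in> {0..1}" for s t
    using B that by (auto simp: brownian_bridge_def)
  have g: "gaussian_rv M (B t)" if "t \<in> {0..1}" for t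
    using lin[of "{t}" "\<lambda>_. 1"] that by simp
  show meas: "B t \<in> borel_measurable M" if "t \<in> {0..1}" for t
    using centered_gaussian_rv_measurable[OF g mean] that by auto
  have sq: "integrable M (\<lambda>\<omega>. (B t \<omega>)\<^sup>2)" if "t \<in> {0..1}" for t
    using centered_gaussian_rv_square_integrable[OF g mean] that by auto
  have int: "integrable M (B t)" if "t \<in> {0..1}" for t
    using square_integrable_imp_integrable[OF meas[OF that] sq[OF that]] .
  have prod: "integrable M (\<lambda>\<omega>. B s \<omega> * B t \<omega>)" if "s \<in> {0..1}" "t \<in> {0..1}" for s t
  proof (rule Bochner_Integration.integrable_bound)
    show "integrable M (\<lambda>\<omega>. (B s \<omega>)\<^sup>2 + (B t \<omega>)\<^sup>2)" using sq that by auto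
    show "(\<lambda>\<omega>. B s \<omega> * B t \<omega>) \<in> borel_measurable M" using meas that by auto
    show "AE \<omega> in M. norm (B s \<omega> * B t \<omega>) \<le> norm ((B s \<omega>)\<^sup>2 + (B t \<omega>)\<^sup>2)"
    proof (rule AE_I2)
      fix \<omega>
      have "0 \<le> (\<bar>B s \<omega>\<bar> - \<bar>B t \<omega>\<bar>)\<^sup>2" by simp
      hence "2 * (\<bar>B s \<omega>\<bar> * \<bar>B t \<omega>\<bar>) \<le> (B s \<omega>)\<^sup>2 + (B t \<omega>)\<^sup>2"
        by (simp add: power2_diff algebra_simps)
      moreover have "0 \<le> \<bar>B s \<omega>\<bar> * \<bar>B t \<omega>\<bar>" by simp
      ultimately show "norm (B s \<omega> * B t \<omega>) \<le> norm ((B s \<omega>)\<^sup>2 + (B t \<omega>)\<^sup>2)"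
        unfolding real_norm_def abs_mult by linarith
    qed
  qed
  have zero: "expectation (\<lambda>\<omega>. \<Sum>t\<in>S. c t * B t \<omega>) = 0"
    using S int mean by (subst Bochner_Integration.integral_sum) (auto simp: subset_eq)
  have "(\<Sum>t\<in>S. c t * B t \<omega>)\<^sup>2 = (\<Sum>s\<in>S. \<Sum>t\<in>S. c s * c t * (B s \<omega> * B t \<omega>))" for \<omega>
    by (simp add: power2_eq_square sum_product algebra_simps)
  hence "expectation (\<lambda>\<omega>. (\<Sum>t\<in>S. c t * B t \<omega>)\<^sup>2)
      = expectation (\<lambda>\<omega>. \<Sum>s\<in>S. \<Sum>t\<in>S. c s * c t * (B s \<omega> * B t \<omega>))" by simp
  also have "\<dots> = (\<Sum>s\<in>S. \<Sum>t\<in>S. c s * c t * (min s t - s * t))"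
  proof -
    have i: "integrable M (\<lambda>\<omega>. c s * c t * (B s \<omega> * B t \<omega>))" if "s \<in> S" "t \<in> S" for s t
      using S that by (intro integrable_mult_right prod) auto
    have "expectation (\<lambda>\<omega>. \<Sum>s\<in>S. \<Sum>t\<in>S. c s * c t * (B s \<omega> * B t \<omega>))
        = (\<Sum>s\<in>S. \<Sum>t\<in>S. expectation (\<lambda>\<omega>. c s * c t * (B s \<omega> * B t \<omega>)))"
      using i by (simp add: Bochner_Integration.integral_sum Bochner_Integration.integrable_sum)
    also have "\<dots> = (\<Sum>s\<in>S. \<Sum>t\<in>S. c s * c t * (min s t - s * t))"
      using S(2) cov by (intro sum.cong refl) (simp add: subset_eq)
    finally show ?thesis .
  qed
  finally show "(CLINT \<omega>|M. iexp (\<Sum>t\<in>S. c t * B t \<omega>))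
    = of_real (exp (- (\<Sum>s\<in>S. \<Sum>t\<in>S. c s * c t * (min s t - s * t)) / 2))"
    using centered_gaussian_rv_char[OF lin[OF S, of c] zero] by simp
qed

section \<open>The equation with point masses and its Green function\<close>

text \<open>
  \<open>jump_sol a p m\<close> solves \<open>y'' = \<mu> y\<close>, \<open>y 0 = 0\<close>, \<open>y' 0 = 1\<close> for the measure \<open>\<mu>\<close> with masses \<open>a j\<close>
  at the points \<open>p j\<close>, \<open>j < m\<close>, provided that \<open>t\<close> lies to the right of these points.
\<close>

fun jump_sol :: "(nat \<Rightarrow> real) \<Rightarrow> (nat \<Rightarrow> real) \<Rightarrow> nat \<Rightarrow> real \<Rightarrow> real" where
  "jump_sol a p 0 t = t"
| "jump_sol a p (Suc m) t = jump_sol a p m t + a m * jump_sol a p m (p m) * (t - p m)"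

text \<open>A non-negative mass can only increase the slope, so the solution stays above the one
  without masses. This keeps the value at 1, a denominator throughout, away from 0.\<close>

lemma jump_sol_ge:
  assumes "\<And>j. j < m \<Longrightarrow> a j \<ge> 0" "\<And>j. j < m \<Longrightarrow> 0 \<le> p j"
    "\<And>i j. i \<le> j \<Longrightarrow> j < m \<Longrightarrow> p i \<le> p j" "\<And>j. j < m \<Longrightarrow> p j \<le> t" "0 \<le> t"
  shows "jump_sol a p m t \<ge> t"
  using assms
proof (induction m arbitrary: t)
  case (Suc m)
  have "jump_sol a p m (p m) \<ge> p m"
    using Suc.prems by (intro Suc.IH) auto
  hence "0 \<le> jump_sol a p m (p m)" using Suc.prems(2)[of m] by simp
  moreover have "jump_sol a p m t \<ge> t"
    using Suc.prems by (intro Suc.IH) auto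
  moreover have "0 \<le> a m * jump_sol a p m (p m) * (t - p m)"
    using calculation(1) Suc.prems(1)[of m] Suc.prems(4)[of m] by (intro mult_nonneg_nonneg) auto
  ultimately show ?case by simp
qed simp

text \<open>For a fixed number of jumps the formula is affine in \<open>t\<close>, and this is
  linear interpolation between the nodes \<open>q\<close> and 1 with the denominator multiplied
  out.\<close>

lemma jump_sol_affine:
  "jump_sol a p m t * (1 - q) = jump_sol a p m q * (1 - t) + jump_sol a p m 1 * (t - q)"
proof -
  have "\<exists>\<alpha> \<beta>. \<forall>t. jump_sol a p m t = \<alpha> + \<beta> * t"
  proof (induction m)
    case 0 show ?case by (rule exI[of _ 0], rule exI[of _ 1]) simp
  next
    case (Suc m)
    then obtain \<alpha> \<beta> where "\<forall>t. jump_sol a p m t = \<alpha> + \<beta> * t" by blast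
    thus ?case
      by (intro exI[of _ "\<alpha> - a m * jump_sol a p m (p m) * p m"] exI[of _ "\<beta> + a m * jump_sol a p m (p m)"])
         (auto simp: algebra_simps)
  qed
  then obtain \<alpha> \<beta> where "\<forall>t. jump_sol a p m t = \<alpha> + \<beta> * t" by blast
  thus ?thesis by (simp add: algebra_simps)
qed

text \<open>The Dirichlet Green function of \<open>- y'' + \<mu> y\<close>, at points to the right
  of all masses: there the solution vanishing at 1 is \<open>1 - t\<close>, and its Wronskian with
  \<open>jump_sol\<close> is the value of \<open>jump_sol\<close> at 1. In probabilistic terms it is
  the covariance of the bridge after weighting by the masses.\<close>

definition killed_cov :: "(nat \<Rightarrow> real) \<Rightarrow> (nat \<Rightarrow> real) \<Rightarrow> nat \<Rightarrow> real \<Rightarrow> real \<Rightarrow> real" where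
  "killed_cov a p m s t = jump_sol a p m (min s t) * (1 - max s t) / jump_sol a p m 1"

lemma killed_cov_commute: "killed_cov a p m s t = killed_cov a p m t s"
  by (simp add: killed_cov_def min.commute max.commute)

text \<open>A rank-one update of Sherman-Morrison type, as it arises when a Gaussian law is weighted
  by \<open>exp (- a x\<^sup>2 / 2)\<close> in the single coordinate at \<open>p m\<close>. It rests
  on the affine form of the solution to the right of the earlier masses.\<close>

lemma killed_cov_Suc:
  assumes "jump_sol a p m 1 > 0" "jump_sol a p (Suc m) 1 > 0" "p m \<le> s" "p m \<le> t" "p m < 1"
  shows "killed_cov a p (Suc m) s t = killed_cov a p m s t
    - a m * killed_cov a p m s (p m) * killed_cov a p m (p m) t / (1 + a m * killed_cov a p m (p m) (p m))"
  using assms(3,4)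
proof (induction s t rule: linorder_wlog)
  case (sym s t)
  thus ?case by (simp add: killed_cov_commute mult_ac)
next
  case (le s t)
  define q y Y where "q = p m" and "y = jump_sol a p m (p m)" and "Y = jump_sol a p m 1"
  define Y' where "Y' = jump_sol a p (Suc m) 1"
  have Y': "Y' = Y + a m * y * (1 - q)" by (simp add: Y'_def Y_def y_def q_def)
  have pos: "Y > 0" "Y' > 0" using assms by (simp_all add: Y_def Y'_def)
  \<comment> \<open>The denominator of the update is the ratio of two consecutive values at 1; hence
    the normalising constants telescope in the induction below.\<close>
  have d: "1 + a m * (y * (1 - q) / Y) = Y' / Y" using pos Y' by (simp add: field_simps)
  define z where "z = jump_sol a p m s"
  have aff: "z * (1 - q) = y * (1 - s) + Y * (s - q)"
    unfolding z_def y_def Y_def q_def by (rule jump_sol_affine)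
  have "(z + a m * y * (s - q)) * Y = z * Y' - a m * y * (y * (1 - s))"
  proof -
    have "z * Y' = z * Y + a m * y * (z * (1 - q))" unfolding Y' by (simp add: algebra_simps)
    thus ?thesis unfolding aff by (simp add: algebra_simps)
  qed
  moreover have "(z + a m * y * (s - q)) / Y' = (z + a m * y * (s - q)) * Y / (Y * Y')"
    using pos by simp
  ultimately have "(z + a m * y * (s - q)) / Y' = z / Y - a m * y * (y * (1 - s)) / (Y * Y')"
    using pos by (simp add: diff_divide_distrib)
  hence "(z + a m * y * (s - q)) / Y' * (1 - t) = (z / Y - a m * y * (y * (1 - s)) / (Y * Y')) * (1 - t)" by simp
  also have "\<dots> = z * (1 - t) / Y - a m * (y * (1 - s) / Y) * (y * (1 - t) / Y) / (Y' / Y)"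
    using pos by (simp add: field_simps)
  finally have *: "(z + a m * y * (s - q)) * (1 - t) / Y'
     = z * (1 - t) / Y - a m * (y * (1 - s) / Y) * (y * (1 - t) / Y) / (Y' / Y)" by simp
  have K: "killed_cov a p (Suc m) s t = (z + a m * y * (s - q)) * (1 - t) / Y'"
    "killed_cov a p m s t = z * (1 - t) / Y" "killed_cov a p m s (p m) = y * (1 - s) / Y"
    "killed_cov a p m (p m) t = y * (1 - t) / Y" "killed_cov a p m (p m) (p m) = y * (1 - q) / Y"
    using le by (simp_all add: killed_cov_def z_def y_def Y_def q_def Y'_def min_absorb1 min_absorb2 max_absorb1 max_absorb2)
  show ?case unfolding K d using * by simp
qed

text \<open>The point \<open>q\<close> may or may not lie in \<open>S\<close>, so the new
  coefficient is added to one that is possibly already there.\<close>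

lemma sum_add_point:
  fixes f :: "real \<Rightarrow> real"
  assumes "finite S"
  shows "(\<Sum>t\<in>insert q S. ((if t \<in> S then c t else 0) + (if t = q then b else 0)) * f t)
    = (\<Sum>t\<in>S. c t * f t) + b * f q"
proof -
  have "(\<Sum>t\<in>insert q S. ((if t \<in> S then c t else 0) + (if t = q then b else 0)) * f t)
    = (\<Sum>t\<in>insert q S. if t \<in> S then c t * f t else 0) + (\<Sum>t\<in>insert q S. if t = q then b * f t else 0)"
    by (subst sum.distrib[symmetric]) (auto intro!: sum.cong simp: algebra_simps)
  also have "(\<Sum>t\<in>insert q S. if t \<in> S then c t * f t else 0) = (\<Sum>t\<in>S. c t * f t)"
    using assms by (intro sum.mono_neutral_cong_right) auto
  also have "(\<Sum>t\<in>insert q S. if t = q then b * f t else 0) = b * f q"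
    using assms by simp
  finally show ?thesis .
qed

text \<open>
  Writing \<open>exp (- a x\<^sup>2 / 2)\<close> as \<open>E exp (i \<surd>a g x)\<close> with an auxiliary standard normal \<open>g\<close> keeps the
  exponent linear in the bridge, so only the one-dimensional laws of its linear combinations are needed.
\<close>

theorem brownian_bridge_killed_char:
  assumes B: "brownian_bridge M B"
    and a: "\<And>j. j < m \<Longrightarrow> a j \<ge> 0" and p: "\<And>j. j < m \<Longrightarrow> 0 \<le> p j" "\<And>j. j < m \<Longrightarrow> p j < 1"
    and mono: "\<And>i j. i \<le> j \<Longrightarrow> j < m \<Longrightarrow> p i \<le> p j"
    and S: "finite S" "S \<subseteq> {0..1}" "\<And>t j. t \<in> S \<Longrightarrow> j < m \<Longrightarrow> p j \<le> t"
  shows "(CLINT \<omega>|M. of_real (exp (- (\<Sum>j<m. a j * (B (p j) \<omega>)\<^sup>2) / 2)) * iexp (\<Sum>t\<in>S. c t * B t \<omega>))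
    = of_real (exp (- (\<Sum>s\<in>S. c s * (\<Sum>t\<in>S. c t * killed_cov a p m s t)) / 2) / sqrt (jump_sol a p m 1))"
  using a p mono S
proof (induction m arbitrary: S c)
  case 0
  have "(\<Sum>s\<in>S. \<Sum>t\<in>S. c s * c t * (min s t - s * t)) = (\<Sum>s\<in>S. c s * (\<Sum>t\<in>S. c t * killed_cov a p 0 s t))"
    unfolding sum_distrib_left
    by (intro sum.cong refl) (auto simp: killed_cov_def min_def max_def algebra_simps)
  thus ?case using brownian_bridge_char(1)[OF B 0(5,6), of c] by simp
next
  case (Suc m)
  interpret prob_space M using B by (simp add: brownian_bridge_def)
  interpret N: real_distribution std_normal_distribution by (rule real_dist_normal_dist)
  interpret P: pair_sigma_finite M std_normal_distribution ..
  interpret PP: pair_prob_space M std_normal_distribution ..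
  define q \<alpha> where "q = p m" and "\<alpha> = sqrt (a m)"
  have q: "0 \<le> q" "q < 1" "q \<in> {0..1}" using Suc.prems(2)[of m] Suc.prems(3)[of m] by (auto simp: q_def)
  have am: "a m \<ge> 0" using Suc.prems(1) by simp
  have \<alpha>2: "\<alpha>\<^sup>2 = a m" using am by (simp add: \<alpha>_def)
  define W where "W \<omega> = exp (- (\<Sum>j<m. a j * (B (p j) \<omega>)\<^sup>2) / 2)" for \<omega>
  define X where "X \<omega> = (\<Sum>t\<in>S. c t * B t \<omega>)" for \<omega>
  define c' where "c' g t = (if t \<in> S then c t else 0) + (if t = q then \<alpha> * g else 0)" for g t
  define Q where "Q = (\<Sum>s\<in>S. c s * (\<Sum>t\<in>S. c t * killed_cov a p m s t))"
  define l where "l = (\<Sum>s\<in>S. c s * killed_cov a p m s q)"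
  define A where "A = a m * killed_cov a p m q q"
  define Y where "Y = jump_sol a p m 1"
  define Y' where "Y' = jump_sol a p (Suc m) 1"
  have Bm [measurable]: "B t \<in> borel_measurable M" if "t \<in> {0..1}" for t
    using brownian_bridge_char(2)[OF B, where S = "{}"] that by simp
  have Wm [measurable]: "W \<in> borel_measurable M"
  proof -
    have "p j \<in> {0..1}" if "j < m" for j
      using that Suc.prems(2)[of j] Suc.prems(3)[of j] by auto
    hence [measurable]: "(\<lambda>\<omega>. \<Sum>j<m. a j * (B (p j) \<omega>)\<^sup>2) \<in> borel_measurable M"
      by (auto intro!: borel_measurable_sum borel_measurable_times borel_measurable_power Bm)
    show ?thesis unfolding W_def by measurable
  qed
  have Xm [measurable]: "X \<in> borel_measurable M"
    unfolding X_def using Suc.prems(6) by (auto intro!: borel_measurable_sum borel_measurable_times Bm)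
  have Bq [measurable]: "B q \<in> borel_measurable M" using q by auto
  have W_le: "W \<omega> \<le> 1" "W \<omega> > 0" for \<omega>
    unfolding W_def using Suc.prems(1) by (auto intro!: sum_nonneg)
  have Y: "Y \<ge> 1" unfolding Y_def using Suc.prems less_imp_le
    by (intro jump_sol_ge) (auto intro: less_imp_le)
  have Y': "Y' \<ge> 1" unfolding Y'_def using Suc.prems
    by (intro jump_sol_ge) (auto intro: less_imp_le)
  have yq: "jump_sol a p m q \<ge> q" unfolding q_def using Suc.prems
    by (intro jump_sol_ge) (auto intro: less_imp_le)
  have A: "A \<ge> 0" unfolding A_def killed_cov_def using am q yq Y
    by (auto intro!: mult_nonneg_nonneg divide_nonneg_nonneg simp: Y_def)
  have Y'_eq: "Y' = Y * (1 + A)"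
    using Y by (simp add: Y'_def A_def killed_cov_def q_def Y_def field_simps)
  have lin: "(\<Sum>t\<in>insert q S. c' g t * f t) = (\<Sum>t\<in>S. c t * f t) + \<alpha> * g * f q" for g f
    unfolding c'_def by (rule sum_add_point) fact
  \<comment> \<open>As a polynomial in \<open>g\<close>, the quadratic form has exactly the shape
    that \<open>std_normal_quadratic_exp\<close> integrates; the constant part \<open>Q\<close>
    belongs to the old exponent.\<close>
  have quad: "(\<Sum>s\<in>insert q S. c' g s * (\<Sum>t\<in>insert q S. c' g t * killed_cov a p m s t))
      = Q + (2 * (\<alpha> * l) * g + A * g\<^sup>2)" for g
  proof -
    have "(\<Sum>s\<in>S. c s * (\<Sum>t\<in>insert q S. c' g t * killed_cov a p m s t)) = Q + \<alpha> * g * l"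
      unfolding lin by (simp add: Q_def l_def distrib_left sum.distrib sum_distrib_left mult_ac)
    moreover have "(\<Sum>t\<in>insert q S. c' g t * killed_cov a p m q t) = l + \<alpha> * g * killed_cov a p m q q"
      unfolding lin l_def by (simp add: killed_cov_commute)
    ultimately show ?thesis unfolding lin[of g "\<lambda>s. \<Sum>t\<in>insert q S. c' g t * killed_cov a p m s t"]
      by (simp add: A_def \<alpha>2[symmetric] algebra_simps power2_eq_square)
  qed
  have IH: "(CLINT \<omega>|M. of_real (W \<omega>) * iexp (X \<omega> + \<alpha> * g * B q \<omega>))
      = of_real (exp (- Q / 2) / sqrt Y * exp (- (2 * (\<alpha> * l) * g + A * g\<^sup>2) / 2))" for g
  proof -
    have "(CLINT \<omega>|M. of_real (W \<omega>) * iexp (\<Sum>t\<in>insert q S. c' g t * B t \<omega>))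
      = of_real (exp (- (\<Sum>s\<in>insert q S. c' g s * (\<Sum>t\<in>insert q S. c' g t * killed_cov a p m s t)) / 2) / sqrt Y)"
      unfolding W_def Y_def
    proof (rule Suc.IH)
      show "finite (insert q S)" "insert q S \<subseteq> {0..1}" using Suc.prems q by auto
      show "p j \<le> t" if "t \<in> insert q S" "j < m" for t j
        using that Suc.prems(7)[of t j] Suc.prems(4)[of j m] by (auto simp: q_def)
    qed (use Suc.prems in auto)
    moreover have "exp (- (Q + (2 * (\<alpha> * l) * g + A * g\<^sup>2)) / 2) = exp (- Q / 2) * exp (- (2 * (\<alpha> * l) * g + A * g\<^sup>2) / 2)"
      by (simp add: exp_add[symmetric] field_simps)
    moreover have "(\<Sum>t\<in>insert q S. c' g t * B t \<omega>) = X \<omega> + \<alpha> * g * B q \<omega>" for \<omega>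
      unfolding X_def by (rule lin)
    ultimately show ?thesis unfolding quad by (simp only: times_divide_eq_left)
  qed
  have gauss: "of_real (exp (- (a m * (B q \<omega>)\<^sup>2) / 2)) = (CLINT g|std_normal_distribution. iexp (\<alpha> * g * B q \<omega>))" for \<omega>
  proof -
    have "(CLINT g|std_normal_distribution. iexp (\<alpha> * g * B q \<omega>)) = char std_normal_distribution (\<alpha> * B q \<omega>)"
      unfolding char_def by (simp add: mult_ac)
    also have "\<dots> = of_real (exp (- (\<alpha> * B q \<omega>)\<^sup>2 / 2))" by (simp add: char_std_normal_distribution)
    finally show ?thesis by (simp add: power_mult_distrib \<alpha>2)
  qed
  have "(CLINT \<omega>|M. of_real (exp (- (\<Sum>j<Suc m. a j * (B (p j) \<omega>)\<^sup>2) / 2)) * iexp (X \<omega>))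
     = (CLINT \<omega>|M. (CLINT g|std_normal_distribution. of_real (W \<omega>) * iexp (X \<omega> + \<alpha> * g * B q \<omega>)))"
  proof (rule Bochner_Integration.integral_cong[OF refl])
    fix \<omega>
    have "exp (- (\<Sum>j<Suc m. a j * (B (p j) \<omega>)\<^sup>2) / 2) = W \<omega> * exp (- (a m * (B q \<omega>)\<^sup>2) / 2)"
      by (simp add: W_def q_def exp_add[symmetric] field_simps)
    hence "of_real (exp (- (\<Sum>j<Suc m. a j * (B (p j) \<omega>)\<^sup>2) / 2)) * iexp (X \<omega>)
      = (of_real (W \<omega>) * iexp (X \<omega>)) * of_real (exp (- (a m * (B q \<omega>)\<^sup>2) / 2))" by simp
    also have "\<dots> = (CLINT g|std_normal_distribution. (of_real (W \<omega>) * iexp (X \<omega>)) * iexp (\<alpha> * g * B q \<omega>))"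
      unfolding gauss by simp
    also have "\<dots> = (CLINT g|std_normal_distribution. of_real (W \<omega>) * iexp (X \<omega> + \<alpha> * g * B q \<omega>))"
      by (simp add: exp_add[symmetric] algebra_simps)
    finally show "of_real (exp (- (\<Sum>j<Suc m. a j * (B (p j) \<omega>)\<^sup>2) / 2)) * iexp (X \<omega>) = \<dots>" .
  qed
  \<comment> \<open>The integrand is bounded by 1 on a probability space, so the order may be
    exchanged. The inner integral is then the induction hypothesis at a fixed \<open>g\<close>, with
    coefficient \<open>\<alpha> * g\<close> added at \<open>q\<close>.\<close>
  also have "\<dots> = (CLINT g|std_normal_distribution. (CLINT \<omega>|M. of_real (W \<omega>) * iexp (X \<omega> + \<alpha> * g * B q \<omega>)))"
  proof (rule P.Fubini_integral[symmetric], rule PP.P.integrable_const_bound[where B = 1])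
    show "AE x in M \<Otimes>\<^sub>M std_normal_distribution.
       cmod (case x of (\<omega>, g) \<Rightarrow> of_real (W \<omega>) * iexp (X \<omega> + \<alpha> * g * B q \<omega>)) \<le> 1"
      using W_le by (intro AE_I2) (auto simp: norm_mult less_imp_le abs_of_pos)
  qed measurable
  also have "\<dots> = of_real (exp (- Q / 2) / sqrt Y * (LINT g|std_normal_distribution. exp (- (2 * (\<alpha> * l) * g + A * g\<^sup>2) / 2)))"
    unfolding IH by simp
  also have "\<dots> = of_real (exp (- Q / 2) / sqrt Y * (exp ((\<alpha> * l)\<^sup>2 / (2 * (1 + A))) / sqrt (1 + A)))"
    unfolding std_normal_quadratic_exp[OF A] ..
  also have "exp (- Q / 2) / sqrt Y * (exp ((\<alpha> * l)\<^sup>2 / (2 * (1 + A))) / sqrt (1 + A))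
      = exp (- (Q - a m * l\<^sup>2 / (1 + A)) / 2) / sqrt Y'"
  proof -
    have "- (Q - a m * l\<^sup>2 / (1 + A)) / 2 = - Q / 2 + (\<alpha> * l)\<^sup>2 / (2 * (1 + A))"
      by (simp add: power_mult_distrib \<alpha>2 diff_divide_distrib)
    thus ?thesis unfolding Y'_eq by (simp only: exp_add real_sqrt_mult) simp
  qed
  \<comment> \<open>The square subtracted here is the rank-one term of
    \<open>killed_cov_Suc\<close>, summed twice against \<open>c\<close>.\<close>
  also have "Q - a m * l\<^sup>2 / (1 + A) = (\<Sum>s\<in>S. c s * (\<Sum>t\<in>S. c t * killed_cov a p (Suc m) s t))"
  proof -
    have "(\<Sum>s\<in>S. c s * (\<Sum>t\<in>S. c t * killed_cov a p (Suc m) s t))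
       = (\<Sum>s\<in>S. c s * (\<Sum>t\<in>S. c t * (killed_cov a p m s t
           - a m * killed_cov a p m s q * killed_cov a p m q t / (1 + A))))"
      using Suc.prems(7) Y Y' q unfolding A_def q_def Y_def Y'_def
      by (intro sum.cong refl arg_cong2[where f = "(*)"] killed_cov_Suc) auto
    also have "\<dots> = Q - (\<Sum>s\<in>S. \<Sum>t\<in>S. (a m / (1 + A)) * ((c s * killed_cov a p m s q) * (c t * killed_cov a p m t q)))"
      unfolding Q_def by (simp add: right_diff_distrib sum_subtractf sum_distrib_left mult_ac killed_cov_commute[of a p m q])
    also have "(\<Sum>s\<in>S. \<Sum>t\<in>S. (a m / (1 + A)) * ((c s * killed_cov a p m s q) * (c t * killed_cov a p m t q)))
       = (a m / (1 + A)) * (l * l)"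
      unfolding l_def sum_product by (simp add: sum_distrib_left)
    finally show ?thesis by (simp add: power2_eq_square)
  qed
  finally show ?case unfolding X_def Y'_def .
qed

corollary brownian_bridge_killed_mass:
  assumes B: "brownian_bridge M B"
    and a: "\<And>j. j < m \<Longrightarrow> a j \<ge> 0" and p: "\<And>j. j < m \<Longrightarrow> 0 \<le> p j" "\<And>j. j < m \<Longrightarrow> p j < 1"
    and mono: "\<And>i j. i \<le> j \<Longrightarrow> j < m \<Longrightarrow> p i \<le> p j"
  shows "(LINT \<omega>|M. exp (- (\<Sum>j<m. a j * (B (p j) \<omega>)\<^sup>2) / 2)) = 1 / sqrt (jump_sol a p m 1)"
proof -
  have "complex_of_real (LINT \<omega>|M. exp (- (\<Sum>j<m. a j * (B (p j) \<omega>)\<^sup>2) / 2))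
      = complex_of_real (1 / sqrt (jump_sol a p m 1))"
    using brownian_bridge_killed_char[of M B m a p "{}"] B a p mono by simp
  thus ?thesis by (simp only: of_real_eq_iff)
qed

section \<open>From point masses to a density\<close>

text \<open>The estimate covers every partial interval from 0 to \<open>i / n\<close>, because the
  comparison with the integral equation is made at each grid point and not only at 1.\<close>

lemma riemann_sum_error:
  fixes f :: "real \<Rightarrow> real" and n i :: nat
  assumes f: "continuous_on {0..1} f" and n: "n > 0" and "i \<le> n"
    and osc: "\<And>j r. j < i \<Longrightarrow> real j / n \<le> r \<Longrightarrow> r \<le> real (Suc j) / n \<Longrightarrow> \<bar>f r - f (j / n)\<bar> \<le> e"
  shows "\<bar>integral {0..real i / n} f - (\<Sum>j<i. f (j / n)) / n\<bar> \<le> e * (i / n)"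
  using assms(3,4)
proof (induction i)
  case (Suc i)
  let ?a = "real i / n" and ?b = "real (Suc i) / n"
  have ab: "0 \<le> ?a" "?a \<le> ?b" "?b \<le> 1" using Suc.prems n by (auto simp: divide_simps)
  have int: "f integrable_on {c..d}" if "0 \<le> c" "d \<le> 1" for c d
    by (rule integrable_continuous_real, rule continuous_on_subset[OF f]) (use that in auto)
  have split: "integral {0..?b} f = integral {0..?a} f + integral {?a..?b} f"
    by (rule Henstock_Kurzweil_Integration.integral_combine[symmetric]) (use ab int in auto)
  have ba: "?b - ?a = 1 / n" using n by (simp add: field_simps)
  have e: "e \<ge> 0" using Suc.prems(2)[of i ?a] ab by fastforce
  have c: "((\<lambda>r. f (i / n)) has_integral f (i / n) * (1 / n)) (cbox ?a ?b)"
    using has_integral_const_real[of "f (i / n)" ?a ?b] ab ba by (simp add: mult.commute)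
  have fi: "(f has_integral integral {?a..?b} f) (cbox ?a ?b)"
    using integrable_integral[OF int[of ?a ?b]] ab by simp
  have "((\<lambda>r. f r - f (i / n)) has_integral (integral {?a..?b} f - f (i / n) * (1 / n))) (cbox ?a ?b)"
    by (rule has_integral_diff[OF fi c])
  from has_integral_bound[OF e this] have "\<bar>integral {?a..?b} f - f (i / n) * (1 / n)\<bar> \<le> e * (1 / n)"
    using Suc.prems(2)[of i] ab ba by simp
  moreover have "\<bar>integral {0..?a} f - (\<Sum>j<i. f (j / n)) / n\<bar> \<le> e * (i / n)"
    using Suc by auto
  ultimately show ?case unfolding split by (simp add: add_divide_distrib distrib_left)
qed simp

lemma continuous_interval_modulus:
  fixes f :: "real \<Rightarrow> real"
  assumes "continuous_on {0..1} f" "e > 0"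
  shows "\<exists>N>0. \<forall>n\<ge>N. \<forall>j<n. \<forall>r. real j / real n \<le> r \<longrightarrow> r \<le> real (Suc j) / real n \<longrightarrow> \<bar>f r - f (real j / real n)\<bar> \<le> e"
proof -
  have "uniformly_continuous_on {0..1} f"
    using assms(1) by (rule compact_uniformly_continuous) simp
  then obtain d where d: "d > 0" "\<And>x y. x \<in> {0..1} \<Longrightarrow> y \<in> {0..1} \<Longrightarrow> dist y x < d \<Longrightarrow> dist (f y) (f x) < e"
    using assms(2) unfolding uniformly_continuous_on_def by metis
  obtain N where N: "N > 0" "1 / real N < d"
    using reals_Archimedean[OF d(1)] by (metis inverse_eq_divide zero_less_Suc)
  show ?thesis
  proof (intro exI[of _ N] conjI N(1) allI impI)
    fix n j :: nat and r assume *: "n \<ge> N" "j < n" "real j / n \<le> r" "r \<le> real (Suc j) / n"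
    have n: "n > 0" using * by simp
    have "real (Suc j) / n \<le> 1" "real j / n \<le> 1" "0 \<le> real j / n" using * n by (auto simp: divide_simps)
    moreover have "real (Suc j) / n = real j / n + 1 / n" by (simp add: add_divide_distrib)
    moreover have "1 / real n \<le> 1 / real N" using * N n by (intro divide_left_mono) auto
    ultimately have "r \<in> {0..1}" "real j / n \<in> {0..1}" "dist r (real j / n) < d"
      using * N(2) unfolding dist_real_def atLeastAtMost_iff by linarith+
    thus "\<bar>f r - f (j / n)\<bar> \<le> e"
      using d(2)[of "real j / n" r] by (simp add: dist_real_def)
  qed
qed

lemma riemann_sum_tendsto:
  fixes f :: "real \<Rightarrow> real"
  assumes f: "continuous_on {0..1} f"
  shows "(\<lambda>n. (\<Sum>j<n. f (real j / real n)) / real n) \<longlonglongrightarrow> integral {0..1} f"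
proof (rule LIMSEQ_I)
  fix e :: real assume "e > 0"
  then obtain N where N: "N > 0"
    "\<forall>n\<ge>N. \<forall>j<n. \<forall>r. real j / real n \<le> r \<longrightarrow> r \<le> real (Suc j) / real n \<longrightarrow> \<bar>f r - f (real j / real n)\<bar> \<le> e / 2"
    using continuous_interval_modulus[OF f half_gt_zero[OF \<open>e > 0\<close>]] by blast
  have "\<bar>(\<Sum>j<n. f (real j / real n)) / real n - integral {0..1} f\<bar> < e" if "n \<ge> N" for n
  proof -
    have "n > 0" using N(1) that by simp
    thus ?thesis
      using riemann_sum_error[OF f \<open>n > 0\<close> order_refl, of "e / 2"] N(2)[rule_format, OF that] \<open>e > 0\<close>
      by (simp add: abs_minus_commute)
  qed
  thus "\<exists>N. \<forall>n\<ge>N. norm ((\<Sum>j<n. f (real j / real n)) / real n - integral {0..1} f) < e" by auto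
qed

section \<open>Stability: from the jump recursion to the Volterra equation\<close>

lemma discrete_gronwall:
  fixes d :: "nat \<Rightarrow> real"
  assumes "c \<ge> 0" and le: "\<And>i. i \<le> n \<Longrightarrow> d i \<le> e + c * (\<Sum>j<i. d j)" and "i \<le> n"
  shows "d i \<le> e * (1 + c) ^ i"
proof -
  have "e + c * (\<Sum>j<i. d j) \<le> e * (1 + c) ^ i"
    using assms(3)
  proof (induction i)
    case (Suc i)
    have "c * d i \<le> c * (e + c * (\<Sum>j<i. d j))" using le[of i] Suc.prems assms(1) by (intro mult_left_mono) auto
    moreover have "(e + c * (\<Sum>j<i. d j)) * (1 + c) \<le> e * (1 + c) ^ i * (1 + c)"
      using Suc assms(1) by (intro mult_right_mono) auto
    ultimately show ?case by (simp add: algebra_simps)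
  qed simp
  thus ?thesis using le[OF assms(3)] by simp
qed

lemma jump_sol_sum: "jump_sol a p m t = t + (\<Sum>j<m. a j * jump_sol a p j (p j) * (t - p j))"
  by (induction m) auto

text \<open>By \<open>jump_sol_sum\<close>, the values at the grid points satisfy the Volterra
  equation with its integral replaced by a left Riemann sum. The exact solution satisfies the
  discrete equation up to a defect of at most \<open>e\<close>, and the discrete Gronwall inequality
  multiplies this defect by at most \<open>(1 + H / n) ^ n\<close>, which is bounded by
  \<open>exp H\<close>.\<close>

lemma jump_sol_tendsto:
  fixes h u :: "real \<Rightarrow> real"
  assumes h: "continuous_on {0..1} h" and u: "continuous_on {0..1} u"
    and eq: "\<And>t. t \<in> {0..1} \<Longrightarrow> u t = t + integral {0..t} (\<lambda>r. (t - r) * (h r * u r))"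
  shows "(\<lambda>n. jump_sol (\<lambda>j. h (real j / real n) / real n) (\<lambda>j. real j / real n) n 1) \<longlonglongrightarrow> u 1"
proof -
  have bdd: "\<exists>C>0. \<forall>t\<in>{0..1}. \<bar>f t\<bar> \<le> C" if "continuous_on {0..1} f" for f :: "real \<Rightarrow> real"
    using compact_imp_bounded[OF compact_continuous_image[OF that]] by (auto simp: bounded_pos)
  obtain H where H: "H > 0" "\<And>t. t \<in> {0..1} \<Longrightarrow> \<bar>h t\<bar> \<le> H" using bdd[OF h] by blast
  define k where "k r = h r * u r" for r
  have k: "continuous_on {0..1} k" unfolding k_def[abs_def] by (intro continuous_intros h u)
  obtain K where K: "K > 0" "\<And>t. t \<in> {0..1} \<Longrightarrow> \<bar>k t\<bar> \<le> K" using bdd[OF k] by blast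
  have main: "\<exists>N. \<forall>n\<ge>N. \<bar>jump_sol (\<lambda>j. h (real j / real n) / real n) (\<lambda>j. real j / real n) n 1 - u 1\<bar> \<le> e * exp H"
    if e: "e > 0" for e
  proof -
    obtain N1 where N1: "N1 > 0"
      "\<forall>n\<ge>N1. \<forall>j<n. \<forall>r. real j / real n \<le> r \<longrightarrow> r \<le> real (Suc j) / real n \<longrightarrow> \<bar>k r - k (real j / real n)\<bar> \<le> e / 2"
      using continuous_interval_modulus[OF k half_gt_zero[OF e]] by blast
    obtain N2 :: nat where N2: "2 * K / e < N2" using reals_Archimedean2 by blast
    show ?thesis
    proof (intro exI allI impI)
      fix n assume n: "n \<ge> max N1 N2"
      hence n0: "n > 0" using N1(1) by auto
      define p where "p j = real j / real n" for j
      define a where "a j = h (p j) / real n" for j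
      have p01: "p i \<in> {0..1}" if "i \<le> n" for i using that n0 by (auto simp: p_def divide_simps)
      have Kn: "K / n \<le> e / 2"
      proof -
        have "2 * K / e < n" using N2 n by linarith
        thus ?thesis using e n0 by (simp add: field_simps)
      qed
      have riem: "\<bar>integral {0..p i} (\<lambda>r. (p i - r) * k r) - (\<Sum>j<i. (p i - p j) * k (p j)) / n\<bar> \<le> e"
        if i: "i \<le> n" for i
      proof -
        have "\<bar>integral {0..real i / n} (\<lambda>r. (p i - r) * k r) - (\<Sum>j<i. (p i - real j / n) * k (real j / n)) / n\<bar> \<le> e * (real i / n)"
        proof (rule riemann_sum_error[OF _ n0 i])
          show "continuous_on {0..1} (\<lambda>r. (p i - r) * k r)" by (intro continuous_intros k)
          fix j r assume j: "j < i" "real j / n \<le> r" "r \<le> real (Suc j) / n"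
          have jn: "j < n" using j i by simp
          have r1: "r \<in> {0..1}" "r - real j / n \<le> 1 / n"
            using j p01[of "Suc j"] order_trans[of 0 "real j / n" r] jn by (auto simp: p_def add_divide_distrib)
          have "\<bar>p i - p j\<bar> \<le> 1"
            using p01[OF i] p01[OF less_imp_le[OF jn]] unfolding atLeastAtMost_iff by linarith
          hence pij: "\<bar>p i - real j / real n\<bar> \<le> 1" by (simp only: p_def)
          \<comment> \<open>The oscillation over a cell splits into that of \<open>k\<close>, at
            most \<open>e / 2\<close>, and that of the kernel \<open>p i - r\<close>, which
            contributes at most \<open>K / n\<close>.\<close>
          have "(p i - r) * k r - (p i - real j / n) * k (real j / n)
             = (p i - real j / n) * (k r - k (real j / n)) - (r - real j / n) * k r" by (simp add: algebra_simps)
          hence "\<bar>(p i - r) * k r - (p i - real j / n) * k (real j / n)\<bar>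
             \<le> \<bar>p i - real j / n\<bar> * \<bar>k r - k (real j / n)\<bar> + \<bar>r - real j / n\<bar> * \<bar>k r\<bar>"
            by (metis abs_mult abs_triangle_ineq4)
          also have "\<dots> \<le> 1 * (e / 2) + (1 / n) * K"
            using N1(2)[rule_format, of n j r] n j jn K(2)[OF r1(1)] r1 e
            by (intro add_mono mult_mono pij) auto
          also have "1 * (e / 2) + (1 / n) * K \<le> e"
          proof -
            have "(1 / n) * K = K / n" by simp
            thus ?thesis using Kn by linarith
          qed
          finally show "\<bar>(p i - r) * k r - (p i - real j / n) * k (real j / n)\<bar> \<le> e" .
        qed
        also have "\<dots> \<le> e * 1" using p01[OF i] e by (intro mult_left_mono) (auto simp: p_def)
        finally show ?thesis by (simp add: p_def)
      qed
      define Y where "Y i = jump_sol a p i (p i)" for i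
      define d where "d i = \<bar>Y i - u (p i)\<bar>" for i
      have dle: "d i \<le> e + (H / n) * (\<Sum>j<i. d j)" if i: "i \<le> n" for i
      proof -
        define I where "I = integral {0..p i} (\<lambda>r. (p i - r) * k r)"
        have Y: "Y i = p i + (\<Sum>j<i. h (p j) / n * Y j * (p i - p j))"
          unfolding Y_def jump_sol_sum[of a p i] by (simp add: a_def)
        have U: "u (p i) = p i + I" using eq[OF p01[OF i]] by (simp add: I_def k_def)
        have "(\<Sum>j<i. h (p j) / n * (Y j - u (p j)) * (p i - p j))
            = (\<Sum>j<i. h (p j) / n * Y j * (p i - p j)) - (\<Sum>j<i. (p i - p j) * k (p j)) / n"
          unfolding sum_divide_distrib sum_subtractf[symmetric] k_def
          by (intro sum.cong refl) (simp add: algebra_simps diff_divide_distrib add_divide_distrib)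
        hence "Y i - u (p i) = (\<Sum>j<i. h (p j) / n * (Y j - u (p j)) * (p i - p j))
            - (I - (\<Sum>j<i. (p i - p j) * k (p j)) / n)" unfolding Y U by simp
        hence "d i \<le> \<bar>\<Sum>j<i. h (p j) / n * (Y j - u (p j)) * (p i - p j)\<bar> + e"
          using riem[OF i] unfolding d_def I_def by linarith
        also have "\<bar>\<Sum>j<i. h (p j) / n * (Y j - u (p j)) * (p i - p j)\<bar> \<le> (\<Sum>j<i. H / n * d j)"
        proof (rule order_trans[OF sum_abs sum_mono])
          fix j assume "j \<in> {..<i}"
          hence j: "j \<le> n" using i by auto
          have "\<bar>h (p j) / n * (Y j - u (p j)) * (p i - p j)\<bar> = \<bar>h (p j)\<bar> / n * d j * \<bar>p i - p j\<bar>"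
            by (simp add: abs_mult d_def)
          also have "\<dots> \<le> H / n * d j * 1"
            using H(2)[OF p01[OF j]] H(1) p01[OF j] p01[OF i] by (intro mult_mono divide_right_mono) (auto simp: d_def)
          finally show "\<bar>h (p j) / n * (Y j - u (p j)) * (p i - p j)\<bar> \<le> H / n * d j" by simp
        qed
        finally show ?thesis by (simp add: sum_distrib_left)
      qed
      have "d n \<le> e * (1 + H / n) ^ n"
        by (rule discrete_gronwall[OF _ dle]) (use H in auto)
      also have "\<dots> \<le> e * exp (H / n) ^ n"
        using e H n0 exp_ge_add_one_self[of "H / n"] by (intro mult_left_mono power_mono) auto
      also have "exp (H / n) ^ n = exp H" using n0 by (simp flip: exp_of_nat_mult)
      finally show "\<bar>jump_sol (\<lambda>j. h (real j / real n) / real n) (\<lambda>j. real j / real n) n 1 - u 1\<bar> \<le> e * exp H"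
        using n0 by (simp add: d_def Y_def a_def[abs_def] p_def[abs_def])
    qed
  qed
  show ?thesis
  proof (rule LIMSEQ_I)
    fix e :: real assume e: "e > 0"
    from main[of "e / 2 / exp H"] obtain N where
      "\<forall>n\<ge>N. \<bar>jump_sol (\<lambda>j. h (real j / real n) / real n) (\<lambda>j. real j / real n) n 1 - u 1\<bar> \<le> e / 2"
      using e by auto
    thus "\<exists>N. \<forall>n\<ge>N. norm (jump_sol (\<lambda>j. h (real j / real n) / real n) (\<lambda>j. real j / real n) n 1 - u 1) < e"
      using e by (intro exI[of _ N]) force
  qed
qed

lemma volterra_sol_of_real:
  assumes "continuous_on {0..1} h" "\<And>t. t \<in> {0..1} \<Longrightarrow> \<bar>h t\<bar> \<le> H" "t \<in> {0..1}"
  shows "volterra_sol h (of_real s) t = of_real (Re (volterra_sol h (of_real s) t))"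
proof -
  have *: "(\<lambda>n. complex_of_real (volterra_coeff h n t * s ^ n)) sums volterra_sol h (of_real s) t"
    unfolding volterra_sol_def using summable_sums[OF volterra_summable[OF assms, of "of_real s"]] by simp
  have "(\<lambda>n. Im (complex_of_real (volterra_coeff h n t * s ^ n))) sums Im (volterra_sol h (of_real s) t)"
    by (rule sums_Im[OF *])
  hence "Im (volterra_sol h (of_real s) t) = 0" by (simp add: sums_0 sums_unique2[OF _ sums_0])
  thus ?thesis by (simp add: complex_eq_iff)
qed

lemma jump_sol_tendsto_volterra_sol:
  fixes h :: "real \<Rightarrow> real"
  assumes h: "continuous_on {0..1} h"
  shows "(\<lambda>n. jump_sol (\<lambda>j. s * h (real j / real n) / real n) (\<lambda>j. real j / real n) n 1)
     \<longlonglongrightarrow> Re (volterra_sol h (of_real s) 1)"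
proof -
  obtain H where H: "\<And>t. t \<in> {0..1} \<Longrightarrow> \<bar>h t\<bar> \<le> H"
    using compact_imp_bounded[OF compact_continuous_image[OF h]] unfolding bounded_iff by fastforce
  define u where "u t = Re (volterra_sol h (of_real s) t)" for t
  have uc: "continuous_on {0..1} u" unfolding u_def[abs_def]
    by (intro continuous_intros volterra_sol_continuous[OF h H])
  have eq: "u t = t + integral {0..t} (\<lambda>r. (t - r) * ((s * h r) * u r))" if t: "t \<in> {0..1}" for t
  proof -
    have "continuous_on {0..t} (\<lambda>r. (t - r) *\<^sub>R (complex_of_real (h r) * volterra_sol h (of_real s) r))"
      using t by (intro continuous_intros continuous_on_subset[OF h] continuous_on_subset[OF volterra_sol_continuous[OF h H]]) auto
    from integral_linear[OF integrable_continuous_real[OF this] bounded_linear_Re]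
    have "Re (integral {0..t} (\<lambda>r. (t - r) *\<^sub>R (complex_of_real (h r) * volterra_sol h (of_real s) r)))
      = integral {0..t} (\<lambda>r. (t - r) * (h r * u r))" by (simp add: o_def u_def)
    hence "u t = t + s * integral {0..t} (\<lambda>r. (t - r) * (h r * u r))"
      using arg_cong[OF volterra_sol_eq[OF h H t, of "of_real s"], of Re] by (simp add: u_def)
    also have "s * integral {0..t} (\<lambda>r. (t - r) * (h r * u r)) = integral {0..t} (\<lambda>r. (t - r) * ((s * h r) * u r))"
      by (subst integral_mult_right[symmetric]) (simp add: mult_ac)
    finally show ?thesis .
  qed
  have "continuous_on {0..1} (\<lambda>r. s * h r)" using h by (intro continuous_intros)
  from jump_sol_tendsto[OF this uc eq] show ?thesis by (simp add: u_def)
qed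

section \<open>The Laplace transform of the squared norm\<close>

text \<open>The Riemann sums \<open>Qn\<close> involve finitely many values of each bridge, so
  \<open>brownian_bridge_killed_mass\<close> applies to every component, and independence multiplies
  \<open>k\<close> equal factors. Pathwise convergence then yields the measurability of
  \<open>Q\<close> and, since all exponentials are at most 1, the limit of the transforms.\<close>

lemma bessel_bridge_laplace_real:
  fixes \<psi> :: "real \<Rightarrow> real"
  assumes M: "prob_space M" and R: "bessel_bridge M k R"
    and \<psi>: "continuous_on {0..1} \<psi>" and pos0: "\<forall>t\<in>{0..1}. \<psi> t > 0"
  defines "Q \<equiv> \<lambda>\<omega>. integral {0..1} (\<lambda>t. (R t \<omega>)\<^sup>2 * \<psi> t)"
  shows "Q \<in> borel_measurable M"
    and "\<And>\<omega>. \<omega> \<in> space M \<Longrightarrow> continuous_on {0..1} (\<lambda>t. (R t \<omega>)\<^sup>2 * \<psi> t)"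
    and "s \<ge> 0 \<Longrightarrow> (LINT \<omega>|M. exp (- s * Q \<omega>)) = (1 / sqrt (Re (volterra_sol \<psi> (of_real (2 * s)) 1))) ^ k"
    and "s \<ge> 0 \<Longrightarrow> Re (volterra_sol \<psi> (of_real (2 * s)) 1) \<ge> 1"
proof -
  interpret prob_space M by (rule M)
  note pos = bspec[OF pos0]
  obtain B where B: "\<And>i. i \<in> {1..k} \<Longrightarrow> brownian_bridge M (B i)"
    and ind: "indep_vars (\<lambda>_. \<Pi>\<^sub>M t\<in>{0..1}. borel) (\<lambda>i \<omega>. \<lambda>t\<in>{0..1}. B i t \<omega>) {1..k}"
    and R: "\<And>t \<omega>. t \<in> {0..1} \<Longrightarrow> \<omega> \<in> space M \<Longrightarrow> R t \<omega> = sqrt (\<Sum>i=1..k. (B i t \<omega>)\<^sup>2)"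
    using R unfolding bessel_bridge_def by blast
  define q where "q n f = (\<Sum>j<n. (f (real j / real n))\<^sup>2 * \<psi> (real j / real n)) / real n" for n :: nat and f :: "real \<Rightarrow> real"
  define Qn where "Qn n \<omega> = (\<Sum>i=1..k. q n (\<lambda>t. B i t \<omega>))" for n \<omega>
  have Rsq: "(R t \<omega>)\<^sup>2 * \<psi> t = (\<Sum>i=1..k. (B i t \<omega>)\<^sup>2 * \<psi> t)" if "t \<in> {0..1}" "\<omega> \<in> space M" for t \<omega>
    using R[OF that] by (simp add: sum_nonneg sum_distrib_right)
  have Bc: "continuous_on {0..1} (\<lambda>t. (B i t \<omega>)\<^sup>2 * \<psi> t)" if "i \<in> {1..k}" "\<omega> \<in> space M" for i \<omega>
    using B[OF that(1)] that(2) unfolding brownian_bridge_def by (intro continuous_intros \<psi>) auto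
  have "continuous_on {0..1} (\<lambda>t. \<Sum>i=1..k. (B i t \<omega>)\<^sup>2 * \<psi> t)" if "\<omega> \<in> space M" for \<omega>
    using Bc that by (intro continuous_on_sum) auto
  thus "\<And>\<omega>. \<omega> \<in> space M \<Longrightarrow> continuous_on {0..1} (\<lambda>t. (R t \<omega>)\<^sup>2 * \<psi> t)"
    using Rsq by (subst continuous_on_cong[OF refl]) auto
  have Q_eq: "Q \<omega> = (\<Sum>i=1..k. integral {0..1} (\<lambda>t. (B i t \<omega>)\<^sup>2 * \<psi> t))" if "\<omega> \<in> space M" for \<omega>
  proof -
    have "Q \<omega> = integral {0..1} (\<lambda>t. \<Sum>i=1..k. (B i t \<omega>)\<^sup>2 * \<psi> t)"
      unfolding Q_def using Rsq[OF _ that] by (intro integral_cong) auto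
    also have "\<dots> = (\<Sum>i=1..k. integral {0..1} (\<lambda>t. (B i t \<omega>)\<^sup>2 * \<psi> t))"
      using Bc[OF _ that] by (intro integral_sum integrable_continuous_real) auto
    finally show ?thesis .
  qed
  have lim: "(\<lambda>n. Qn n \<omega>) \<longlonglongrightarrow> Q \<omega>" if "\<omega> \<in> space M" for \<omega>
    unfolding Qn_def q_def Q_eq[OF that] by (intro tendsto_sum riemann_sum_tendsto Bc that)
  have grid: "real j / real n \<in> {0..1}" if "j < n" for j n using that by (auto simp: divide_simps)
  have Bm: "B i t \<in> borel_measurable M" if "i \<in> {1..k}" "t \<in> {0..1}" for i t
    using brownian_bridge_char(2)[OF B[OF that(1)], where S = "{}"] that by simp
  have Qnm [measurable]: "Qn n \<in> borel_measurable M" for n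
    unfolding Qn_def q_def
    by (intro borel_measurable_sum borel_measurable_divide borel_measurable_times borel_measurable_power Bm grid
        borel_measurable_const) auto
  show Qm [measurable]: "Q \<in> borel_measurable M"
    by (rule borel_measurable_LIMSEQ_real[OF lim Qnm])
  have Qn_nonneg: "Qn n \<omega> \<ge> 0" for n \<omega>
    unfolding Qn_def q_def using pos[OF grid]
    by (intro sum_nonneg divide_nonneg_nonneg mult_nonneg_nonneg) (auto intro: less_imp_le)
  {
    assume s: "s \<ge> 0"
    \<comment> \<open>The factor 2 compensates the \<open>1/2\<close> in the exponent of
      \<open>brownian_bridge_killed_mass\<close>; it is the origin of \<open>2 * s\<close> as the
      parameter of the Cauchy problem.\<close>
    define J where "J n = jump_sol (\<lambda>j. 2 * s * \<psi> (real j / real n) / real n) (\<lambda>j. real j / real n) n 1" for n :: nat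
    have J1: "J n \<ge> 1" for n
      unfolding J_def using pos[OF grid] s
      by (intro jump_sol_ge divide_nonneg_nonneg mult_nonneg_nonneg) (auto simp: divide_simps intro: less_imp_le)
    have Jlim: "J \<longlonglongrightarrow> Re (volterra_sol \<psi> (of_real (2 * s)) 1)"
      unfolding J_def by (rule jump_sol_tendsto_volterra_sol[OF \<psi>])
    show U1: "Re (volterra_sol \<psi> (of_real (2 * s)) 1) \<ge> 1"
      by (rule LIMSEQ_le_const[OF Jlim]) (use J1 in auto)
    have single: "(LINT \<omega>|M. exp (- s * q n (\<lambda>t. B i t \<omega>))) = 1 / sqrt (J n)" if i: "i \<in> {1..k}" for i n
    proof -
      have "exp (- s * q n (\<lambda>t. B i t \<omega>))
        = exp (- (\<Sum>j<n. (2 * s * \<psi> (real j / real n) / real n) * (B i (real j / real n) \<omega>)\<^sup>2) / 2)" for \<omega>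
        by (simp add: q_def sum_distrib_left sum_divide_distrib sum_negf[symmetric] field_simps)
      moreover have "(LINT \<omega>|M. exp (- (\<Sum>j<n. (2 * s * \<psi> (real j / real n) / real n) * (B i (real j / real n) \<omega>)\<^sup>2) / 2))
        = 1 / sqrt (J n)"
        unfolding J_def
        by (rule brownian_bridge_killed_mass[OF B[OF i]])
           (use pos[OF grid] s in \<open>auto simp: divide_simps intro!: divide_nonneg_nonneg mult_nonneg_nonneg intro: less_imp_le\<close>)
      ultimately show ?thesis by (simp only:)
    qed
    have "(LINT \<omega>|M. exp (- s * Qn n \<omega>)) = (1 / sqrt (J n)) ^ k" for n
    proof -
      define F where "F f = exp (- s * q n f)" for f
      have "(\<lambda>f. f (real j / real n)) \<in> borel_measurable (\<Pi>\<^sub>M t\<in>{0..1}. borel)" if "j < n" for j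
        by (rule measurable_component_singleton[OF grid[OF that]])
      hence [measurable]: "q n \<in> borel_measurable (\<Pi>\<^sub>M t\<in>{0..1}. borel)"
        unfolding q_def[abs_def]
        by (intro borel_measurable_sum borel_measurable_divide borel_measurable_times borel_measurable_power
            borel_measurable_const) auto
      have Fm: "F \<in> borel_measurable (\<Pi>\<^sub>M t\<in>{0..1}. borel)" unfolding F_def[abs_def] by measurable
      \<comment> \<open>Independence is given for paths restricted to the unit interval. All grid
        points lie there, so the restriction does not change \<open>F\<close>.\<close>
      have F_restrict: "F (\<lambda>t\<in>{0..1}. f t) = F f" for f :: "real \<Rightarrow> real"
        unfolding F_def q_def using grid by (intro arg_cong[where f = exp]) (auto intro!: sum.cong)
      have ind2: "indep_vars (\<lambda>_. borel) (\<lambda>i \<omega>. F (\<lambda>t\<in>{0..1}. B i t \<omega>)) {1..k}"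
        by (rule indep_vars_compose2[OF ind Fm])
      have "integrable M (\<lambda>\<omega>. F (\<lambda>t\<in>{0..1}. B i t \<omega>))" if "i \<in> {1..k}" for i
      proof (rule integrable_const_bound[where B = 1])
        show "(\<lambda>\<omega>. F (\<lambda>t\<in>{0..1}. B i t \<omega>)) \<in> borel_measurable M"
          using ind2 that unfolding indep_vars_def by auto
        have "q n f \<ge> 0" for f unfolding q_def using pos[OF grid]
          by (intro sum_nonneg divide_nonneg_nonneg mult_nonneg_nonneg) (auto intro: less_imp_le)
        thus "AE \<omega> in M. norm (F (\<lambda>t\<in>{0..1}. B i t \<omega>)) \<le> 1" using s by (simp add: F_def)
      qed
      from indep_vars_lebesgue_integral[OF _ ind2 this]
      have "(LINT \<omega>|M. (\<Prod>i\<in>{1..k}. F (\<lambda>t. B i t \<omega>))) = (\<Prod>i\<in>{1..k}. LINT \<omega>|M. F (\<lambda>t. B i t \<omega>))"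
        unfolding F_restrict by simp
      also have "\<dots> = (\<Prod>i\<in>{1..k}. 1 / sqrt (J n))"
        unfolding F_def by (intro prod.cong refl single)
      also have "(\<lambda>\<omega>. \<Prod>i\<in>{1..k}. F (\<lambda>t. B i t \<omega>)) = (\<lambda>\<omega>. exp (- s * Qn n \<omega>))"
        unfolding F_def Qn_def by (subst exp_sum[symmetric]) (simp_all add: sum_distrib_left sum_negf)
      finally show ?thesis by simp
    qed
    moreover have "(\<lambda>n. LINT \<omega>|M. exp (- s * Qn n \<omega>)) \<longlonglongrightarrow> (LINT \<omega>|M. exp (- s * Q \<omega>))"
    proof (rule integral_dominated_convergence[where w = "\<lambda>_. 1"])
      show "AE \<omega> in M. (\<lambda>n. exp (- s * Qn n \<omega>)) \<longlonglongrightarrow> exp (- s * Q \<omega>)"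
        using lim by (intro AE_I2 tendsto_intros)
      show "AE \<omega> in M. norm (exp (- s * Qn n \<omega>)) \<le> 1" for n using Qn_nonneg s by simp
    qed auto
    moreover have "(\<lambda>n. (1 / sqrt (J n)) ^ k) \<longlonglongrightarrow> (1 / sqrt (Re (volterra_sol \<psi> (of_real (2 * s)) 1))) ^ k"
      using U1 by (intro tendsto_intros Jlim) auto
    ultimately show "(LINT \<omega>|M. exp (- s * Q \<omega>)) = (1 / sqrt (Re (volterra_sol \<psi> (of_real (2 * s)) 1))) ^ k"
      using LIMSEQ_unique by simp
  }
qed

section \<open>Analytic continuation to the right half-plane\<close>

lemma (in prob_space) laplace_integrable:
  assumes [measurable]: "Q \<in> borel_measurable M" and nonneg: "\<And>\<omega>. \<omega> \<in> space M \<Longrightarrow> Q \<omega> \<ge> 0" and "Re z \<ge> 0"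
  shows "integrable M (\<lambda>\<omega>. exp (- z * complex_of_real (Q \<omega>)))"
  by (rule integrable_const_bound[where B = 1]) (use assms in \<open>auto simp: norm_exp_eq_Re intro!: AE_I2\<close>)

text \<open>Differentiation under the integral. On the ball of radius \<open>x = Re z / 2\<close>
  the real part stays above \<open>x\<close>, so the mean value inequality bounds the difference
  quotients by \<open>exp (- x * Q) * Q\<close>, and this is at most the constant
  \<open>1 / x\<close>.\<close>

lemma (in prob_space) laplace_holomorphic:
  assumes [measurable]: "Q \<in> borel_measurable M" and nonneg: "\<And>\<omega>. \<omega> \<in> space M \<Longrightarrow> Q \<omega> \<ge> 0"
  shows "(\<lambda>z. CLINT \<omega>|M. exp (- z * complex_of_real (Q \<omega>))) holomorphic_on {z. Re z > 0}"
proof (rule holomorphic_onI)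
  fix z assume "z \<in> {z. Re z > 0}"
  define x where "x = Re z / 2"
  have x: "x > 0" "Re z = 2 * x" using \<open>z \<in> _\<close> by (auto simp: x_def)
  let ?f = "\<lambda>z \<omega>. exp (- z * complex_of_real (Q \<omega>))"
  have re: "Re w \<ge> x" if "w \<in> ball z x" for w
    using abs_Re_le_cmod[of "z - w"] that x by (simp add: dist_norm)
  have "((\<lambda>w. CLINT \<omega>|M. ?f w \<omega>) has_field_derivative (CLINT \<omega>|M. - of_real (Q \<omega>) * ?f z \<omega>)) (at z within ball z x)"
    unfolding has_field_derivative_iff tendsto_at_iff_sequentially
  proof (intro allI impI)
    fix X assume X: "\<forall>i. X i \<in> ball z x - {z}" "X \<longlonglongrightarrow> z"
    have "(\<lambda>i. CLINT \<omega>|M. (?f (X i) \<omega> - ?f z \<omega>) / (X i - z)) \<longlonglongrightarrow> (CLINT \<omega>|M. - of_real (Q \<omega>) * ?f z \<omega>)"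
    proof (rule integral_dominated_convergence[where w = "\<lambda>_. 1 / x"])
      show "AE \<omega> in M. (\<lambda>i. (?f (X i) \<omega> - ?f z \<omega>) / (X i - z)) \<longlonglongrightarrow> - of_real (Q \<omega>) * ?f z \<omega>"
      proof (rule AE_I2)
        fix \<omega>
        have "((\<lambda>w. ?f w \<omega>) has_field_derivative - of_real (Q \<omega>) * ?f z \<omega>) (at z within ball z x)"
          by (auto intro!: derivative_eq_intros)
        thus "(\<lambda>i. (?f (X i) \<omega> - ?f z \<omega>) / (X i - z)) \<longlonglongrightarrow> - of_real (Q \<omega>) * ?f z \<omega>"
          unfolding has_field_derivative_iff tendsto_at_iff_sequentially using X by (auto simp: o_def)
      qed
      show "AE \<omega> in M. norm ((?f (X i) \<omega> - ?f z \<omega>) / (X i - z)) \<le> 1 / x" for i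
      proof (rule AE_I2)
        fix \<omega> assume \<omega>: "\<omega> \<in> space M"
        have Xi: "X i \<in> ball z x" "X i \<noteq> z" using X by auto
        have "norm (?f (X i) \<omega> - ?f z \<omega>) \<le> exp (- x * Q \<omega>) * norm (- X i * of_real (Q \<omega>) - - z * of_real (Q \<omega>))"
        proof (rule field_differentiable_bound[where S = "{w. Re w \<le> - x * Q \<omega>}" and f' = exp])
          show "- X i * of_real (Q \<omega>) \<in> {w. Re w \<le> - x * Q \<omega>}" "- z * of_real (Q \<omega>) \<in> {w. Re w \<le> - x * Q \<omega>}"
            using re[OF Xi(1)] nonneg[OF \<omega>] x by (auto intro!: mult_right_mono)
        qed (auto simp: convex_halfspace_Re_le norm_exp_eq_Re intro: DERIV_exp has_field_derivative_at_within)
        also have "- X i * of_real (Q \<omega>) - - z * of_real (Q \<omega>) = - (X i - z) * of_real (Q \<omega>)" by (simp add: algebra_simps)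
        also have "norm \<dots> = norm (X i - z) * Q \<omega>" using nonneg[OF \<omega>] by (simp add: norm_mult norm_minus_commute)
        finally have "norm (?f (X i) \<omega> - ?f z \<omega>) \<le> (exp (- x * Q \<omega>) * Q \<omega>) * norm (X i - z)"
          by (simp only: mult_ac)
        hence "norm ((?f (X i) \<omega> - ?f z \<omega>) / (X i - z)) \<le> exp (- x * Q \<omega>) * Q \<omega>"
          unfolding norm_divide using Xi by (subst pos_divide_le_eq) auto
        also have "\<dots> \<le> 1 / x"
        proof -
          have "x * Q \<omega> \<le> exp (x * Q \<omega>)" using exp_ge_add_one_self[of "x * Q \<omega>"] by linarith
          thus ?thesis using x by (simp add: exp_minus field_simps)
        qed
        finally show "norm ((?f (X i) \<omega> - ?f z \<omega>) / (X i - z)) \<le> 1 / x" .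
      qed
    qed auto
    moreover have "(CLINT \<omega>|M. (?f (X i) \<omega> - ?f z \<omega>) / (X i - z)) = ((CLINT \<omega>|M. ?f (X i) \<omega>) - (CLINT \<omega>|M. ?f z \<omega>)) / (X i - z)" for i
    proof -
      have "Re (X i) \<ge> 0" "Re z \<ge> 0" using re[of "X i"] X x by force+
      thus ?thesis using laplace_integrable[OF assms] by (simp add: Bochner_Integration.integral_diff)
    qed
    ultimately show "((\<lambda>w. ((CLINT \<omega>|M. ?f w \<omega>) - (CLINT \<omega>|M. ?f z \<omega>)) / (w - z)) \<circ> X) \<longlonglongrightarrow> (CLINT \<omega>|M. - of_real (Q \<omega>) * ?f z \<omega>)"
      by (simp only: o_def)
  qed
  hence "(\<lambda>w. CLINT \<omega>|M. ?f w \<omega>) field_differentiable (at z)"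
    using x at_within_open[of z "ball z x"] by (auto simp: field_differentiable_def)
  thus "(\<lambda>w. CLINT \<omega>|M. ?f w \<omega>) field_differentiable (at z within {z. Re z > 0})"
    by (rule field_differentiable_at_within)
qed

lemma bessel_bridge_laplace:
  fixes \<psi> :: "real \<Rightarrow> real"
  assumes M: "prob_space M" and R: "bessel_bridge M k R"
    and \<psi>: "continuous_on {0..1} \<psi>" and pos0: "\<forall>t\<in>{0..1}. \<psi> t > 0"
    and z: "Re z > 0"
  shows "(CLINT \<omega>|M. exp (- z * of_real (integral {0..1} (\<lambda>t. (R t \<omega>)\<^sup>2 * \<psi> t))))\<^sup>2 * volterra_sol \<psi> (2 * z) 1 ^ k = 1"
proof -
  interpret prob_space M by (rule M)
  note pos = bspec[OF pos0]
  define Q where "Q \<omega> = integral {0..1} (\<lambda>t. (R t \<omega>)\<^sup>2 * \<psi> t)" for \<omega>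
  note L = bessel_bridge_laplace_real[OF M R \<psi> pos0, folded Q_def]
  have Qm [measurable]: "Q \<in> borel_measurable M" using L(1) by (simp add: Q_def[abs_def])
  have Q0: "Q \<omega> \<ge> 0" if "\<omega> \<in> space M" for \<omega>
    unfolding Q_def using pos L(2)[OF that]
    by (intro integral_nonneg integrable_continuous_real) (auto simp: less_imp_le)
  obtain H where H: "\<And>t. t \<in> {0..1} \<Longrightarrow> \<bar>\<psi> t\<bar> \<le> H"
    using compact_imp_bounded[OF compact_continuous_image[OF \<psi>]] unfolding bounded_iff by fastforce
  define f where "f z = (CLINT \<omega>|M. exp (- z * of_real (Q \<omega>)))\<^sup>2 * volterra_sol \<psi> (2 * z) 1 ^ k - 1" for z
  have "(\<lambda>w. volterra_sol \<psi> w 1) holomorphic_on UNIV"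
    using volterra_sol_holomorphic[OF \<psi> H] by simp
  hence "(\<lambda>z. volterra_sol \<psi> (2 * z) 1) holomorphic_on {z. Re z > 0}"
    using holomorphic_on_compose[of "\<lambda>z. 2 * z" "{z. Re z > 0}" "\<lambda>w. volterra_sol \<psi> w 1"]
    by (auto simp: o_def intro: holomorphic_intros holomorphic_on_subset)
  hence hol: "f holomorphic_on {z. Re z > 0}"
    unfolding f_def by (intro holomorphic_intros laplace_holomorphic Qm Q0)
  have "f z = 0"
  proof (rule analytic_continuation[OF hol])
    show "open {z. Re z > 0}" by (rule open_halfspace_Re_gt)
    show "connected {z. Re z > 0}" by (intro convex_connected convex_halfspace_Re_gt)
    show "of_real ` {0<..} \<subseteq> {z. Re z > 0}" by auto
    show "1 \<in> {z. Re z > 0}" by simp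
    show "(1 :: complex) islimpt of_real ` {0<..}"
      unfolding islimpt_approachable
    proof (intro allI impI)
      fix e :: real assume "e > 0"
      thus "\<exists>x'\<in>complex_of_real ` {0<..}. x' \<noteq> 1 \<and> dist x' 1 < e"
        by (intro bexI[of _ "of_real (1 + e / 2)"] imageI) (auto simp: dist_norm)
    qed
    show "z \<in> {z. Re z > 0}" using z by simp
    fix w :: complex assume "w \<in> of_real ` {0<..}"
    then obtain s where s: "w = of_real s" "s > 0" by auto
    have "(CLINT \<omega>|M. exp (- w * of_real (Q \<omega>))) = of_real (LINT \<omega>|M. exp (- s * Q \<omega>))"
      unfolding s by (simp flip: integral_complex_of_real exp_of_real)
    also have "\<dots> = of_real ((1 / sqrt (Re (volterra_sol \<psi> (of_real (2 * s)) 1))) ^ k)"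
      using L(3)[of s] s by simp
    finally have "f w = of_real (((1 / sqrt (Re (volterra_sol \<psi> (of_real (2 * s)) 1))) ^ k)\<^sup>2 * Re (volterra_sol \<psi> (of_real (2 * s)) 1) ^ k - 1)"
      using volterra_sol_of_real[OF \<psi> H, of 1 "2 * s"] s by (simp add: f_def)
    also have "((1 / sqrt (Re (volterra_sol \<psi> (of_real (2 * s)) 1))) ^ k)\<^sup>2 * Re (volterra_sol \<psi> (of_real (2 * s)) 1) ^ k = 1"
      using L(4)[of s] s by (simp add: power_mult_distrib[symmetric] power_divide power_mult[symmetric] mult.commute[of k 2] power_mult)
    finally show "f w = 0" by simp
  qed
  thus ?thesis by (simp add: f_def Q_def)
qed

section \<open>Laplace inversion\<close>

text \<open>The transform of the unit step at \<open>q\<close>, that is, of the distribution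
  function of a point mass. The absolute integral is kept as well because Fubini needs it.\<close>

lemma exp_tail_integral:
  fixes z :: complex
  assumes z: "Re z > 0"
  shows "integrable lborel (\<lambda>x. indicator {q..} x *\<^sub>R exp (- z * of_real x))"
    and "(CLINT x|lborel. indicator {q..} x *\<^sub>R exp (- z * of_real x)) = exp (- z * of_real q) / z"
    and "(LINT x|lborel. norm (indicator {q..} x *\<^sub>R exp (- z * of_real x))) = exp (- Re z * q) / Re z"
proof -
  let ?f = "\<lambda>x. indicator {q..} x *\<^sub>R exp (- z * complex_of_real x)"
  define s where "s = Re z"
  have s: "s > 0" and z0: "z \<noteq> 0" using z by (auto simp: s_def)
  have nf: "norm (?f x) = exp (- s * x) * indicator {q..} x" for x
    by (auto simp: s_def norm_exp_eq_Re indicator_def)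
  have "(\<integral>\<^sup>+x. ennreal (exp (- s * x)) * indicator {q..} x \<partial>lborel) = ennreal (0 - (- exp (- s * q) / s))"
  proof (rule nn_integral_FTC_atLeast)
    show "DERIV (\<lambda>x. - exp (- s * x) / s) x :> exp (- s * x)" for x
      using s by (auto intro!: derivative_eq_intros)
    have "filterlim (\<lambda>x. - (s * x)) at_bot at_top"
      using s by (auto simp: filterlim_uminus_at_bot intro!: filterlim_tendsto_pos_mult_at_top[OF tendsto_const] filterlim_ident)
    from filterlim_compose[OF exp_at_bot this]
    have "((\<lambda>x. - exp (- (s * x)) / s) \<longlongrightarrow> - 0 / s) at_top"
      using s by (intro tendsto_divide tendsto_minus tendsto_const) auto
    thus "((\<lambda>x. - exp (- s * x) / s) \<longlongrightarrow> 0) at_top" by simp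
  qed auto
  hence nn: "(\<integral>\<^sup>+x. ennreal (norm (?f x)) \<partial>lborel) = ennreal (exp (- s * q) / s)"
    unfolding nf by (simp add: ennreal_mult'' ennreal_indicator)
  show int: "integrable lborel ?f"
    by (rule integrableI_bounded) (use nn in auto)
  show "(LINT x|lborel. norm (?f x)) = exp (- Re z * q) / Re z"
    using integral_eq_nn_integral[of "\<lambda>x. norm (?f x)" lborel] nn s by (simp add: s_def)
  have "((\<lambda>y. CLINT x|lborel. indicator {..y} x *\<^sub>R ?f x) \<longlongrightarrow> (CLINT x|lborel. ?f x)) at_top"
    by (rule tendsto_integral_at_top[OF _ int]) simp
  moreover have "\<forall>\<^sub>F y in at_top. (CLINT x|lborel. indicator {..y} x *\<^sub>R ?f x) = exp (- z * of_real q) / z - exp (- z * of_real y) / z"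
    using eventually_ge_at_top[of q]
  proof eventually_elim
    case (elim y)
    have "(CLINT x|lborel. indicator {..y} x *\<^sub>R ?f x) = (CLINT x|lborel. indicator {q..y} x *\<^sub>R exp (- z * complex_of_real x))"
      by (intro Bochner_Integration.integral_cong) (auto simp: indicator_def)
    also have "\<dots> = (- exp (- z * of_real y) / z) - (- exp (- z * of_real q) / z)"
    proof (rule integral_FTC_Icc[OF elim])
      fix x
      have "((\<lambda>w. - exp (- z * w) / z) has_field_derivative exp (- z * of_real x)) (at (of_real x))"
        using z0 by (auto intro!: derivative_eq_intros)
      thus "((\<lambda>x. - exp (- z * complex_of_real x) / z) has_vector_derivative exp (- z * of_real x)) (at x within {q..y})"
        using has_vector_derivative_real_field has_vector_derivative_at_within by blast
      show "continuous_on {q..y} (\<lambda>x. exp (- z * complex_of_real x))" by (intro continuous_intros)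
    qed
    finally show ?case by simp
  qed
  ultimately have "((\<lambda>y. exp (- z * of_real q) / z - exp (- z * of_real y) / z) \<longlongrightarrow> (CLINT x|lborel. ?f x)) at_top"
    using tendsto_cong by fast
  moreover have "((\<lambda>y. exp (- z * of_real q) / z - exp (- z * of_real y) / z) \<longlongrightarrow> exp (- z * of_real q) / z - 0) at_top"
  proof (intro tendsto_diff tendsto_const)
    have "filterlim (\<lambda>x. - (s * x)) at_bot at_top"
      using s by (auto simp: filterlim_uminus_at_bot intro!: filterlim_tendsto_pos_mult_at_top[OF tendsto_const] filterlim_ident)
    from filterlim_compose[OF exp_at_bot this]
    have "((\<lambda>y. exp (- (s * y)) / norm z) \<longlongrightarrow> 0 / norm z) at_top" using z0 by (intro tendsto_intros) auto
    hence "((\<lambda>y. norm (exp (- z * complex_of_real y) / z)) \<longlongrightarrow> 0) at_top"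
      by (simp add: norm_divide norm_exp_eq_Re s_def)
    thus "((\<lambda>y. exp (- z * complex_of_real y) / z) \<longlongrightarrow> 0) at_top" by (rule tendsto_norm_zero_cancel)
  qed
  ultimately have "(CLINT x|lborel. ?f x) = exp (- z * of_real q) / z - 0"
    by (rule tendsto_unique[OF trivial_limit_at_top_linorder])
  thus "(CLINT x|lborel. ?f x) = exp (- z * of_real q) / z" by simp
qed

text \<open>A distribution function is a mixture of the unit steps at \<open>q\<close>, so Fubini
  reduces the claim to \<open>exp_tail_integral\<close>. The absolute double integral converges
  because the law lives on the non-negative axis.\<close>

lemma (in real_distribution) laplace_cdf:
  assumes nonneg: "AE q in M. q \<ge> 0" and z: "Re z > 0"
  shows "integrable lborel (\<lambda>x. cdf M x *\<^sub>R exp (- z * of_real x))"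
    and "(CLINT x|lborel. cdf M x *\<^sub>R exp (- z * of_real x)) = (CLINT q|M. exp (- z * of_real q)) / z"
proof -
  interpret P: pair_sigma_finite M lborel ..
  let ?g = "\<lambda>q x. indicator {q..} x *\<^sub>R exp (- z * complex_of_real x)"
  have gm: "case_prod ?g \<in> borel_measurable (M \<Otimes>\<^sub>M lborel)"
  proof -
    have "case_prod ?g = (\<lambda>p. if fst p \<le> snd p then exp (- z * complex_of_real (snd p)) else 0)"
      by (auto simp: indicator_def fun_eq_iff)
    also have "\<dots> \<in> borel_measurable (M \<Otimes>\<^sub>M lborel)" by measurable
    finally show ?thesis .
  qed
  have int_exp: "integrable M (\<lambda>q. exp (- Re z * q) / Re z)"
    by (rule integrable_const_bound[where B = "1 / Re z"])
       (use nonneg z in \<open>auto elim!: eventually_mono intro!: divide_right_mono\<close>)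
  have int: "integrable (M \<Otimes>\<^sub>M lborel) (case_prod ?g)"
  proof (intro P.Fubini_integrable gm AE_I2)
    show "integrable M (\<lambda>q. LINT x|lborel. norm (case (q, x) of (q, x) \<Rightarrow> ?g q x))"
      unfolding prod.case exp_tail_integral(3)[OF z] by (rule int_exp)
    show "integrable lborel (\<lambda>x. case (q, x) of (q, x) \<Rightarrow> ?g q x)" for q
      unfolding prod.case by (rule exp_tail_integral(1)[OF z])
  qed
  have inner: "(CLINT q|M. ?g q x) = cdf M x *\<^sub>R exp (- z * of_real x)" for x
  proof -
    have "(CLINT q|M. ?g q x) = (CLINT q|M. indicator {..x} q *\<^sub>R exp (- z * complex_of_real x))"
      by (intro Bochner_Integration.integral_cong) (auto simp: indicator_def)
    also have "\<dots> = (LINT q|M. indicator {..x} q) *\<^sub>R exp (- z * complex_of_real x)"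
      by (rule integral_scaleR_left) (rule integrable_const_bound[where B = 1], auto)
    finally show ?thesis by (simp add: cdf_def)
  qed
  show "integrable lborel (\<lambda>x. cdf M x *\<^sub>R exp (- z * of_real x))"
    using P.integrable_snd[OF int] unfolding inner .
  have "(CLINT x|lborel. CLINT q|M. ?g q x) = (CLINT q|M. CLINT x|lborel. ?g q x)"
    by (rule P.Fubini_integral[OF int])
  thus "(CLINT x|lborel. cdf M x *\<^sub>R exp (- z * of_real x)) = (CLINT q|M. exp (- z * of_real q)) / z"
    unfolding inner exp_tail_integral(2)[OF z] by simp
qed

text \<open>The kernel is bounded by \<open>b - a\<close>. An integrable characteristic function
  therefore turns the limit over growing symmetric intervals into an absolutely convergent
  integral.\<close>

lemma (in real_distribution) levy_inversion_integrable:
  assumes ab: "a < b" and atoms: "\<And>x. measure M {x} = 0" and int: "integrable lborel (char M)"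
  shows "complex_of_real (measure M {a<..b})
    = 1 / (2 * pi) * (CLINT t|lborel. (iexp (- (t * a)) - iexp (- (t * b))) / (\<i> * t) * char M t)"
    and "norm ((iexp (- (t * a)) - iexp (- (t * b))) / (\<i> * t)) \<le> b - a"
proof -
  show bound: "norm ((iexp (- (t * a)) - iexp (- (t * b))) / (\<i> * t)) \<le> b - a" for t
    using Levy_Inversion_aux2[of "- b" "- a" t] ab by (cases "t = 0") simp_all
  let ?g = "\<lambda>t. (iexp (- (t * a)) - iexp (- (t * b))) / (\<i> * t) * char M t"
  have gm [measurable]: "?g \<in> borel_measurable borel" by measurable
  have bd: "norm (?g t) \<le> (b - a) * norm (char M t)" for t
    unfolding norm_mult by (intro mult_right_mono bound) auto
  have "(\<lambda>T::nat. CLINT t|lborel. indicator {- real T<..<real T} t *\<^sub>R ?g t) \<longlonglongrightarrow> (CLINT t|lborel. ?g t)"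
  proof (rule integral_dominated_convergence[where w = "\<lambda>t. (b - a) * norm (char M t)"])
    show "integrable lborel (\<lambda>t. (b - a) * norm (char M t))" using int by auto
    show "AE t in lborel. (\<lambda>T::nat. indicator {- real T<..<real T} t *\<^sub>R ?g t) \<longlonglongrightarrow> ?g t"
    proof (rule AE_I2)
      fix t :: real
      have "\<forall>\<^sub>F T in sequentially. t \<in> {- real T<..<real T}"
        using eventually_gt_at_top[of "nat \<lceil>\<bar>t\<bar>\<rceil>"] by eventually_elim (auto, linarith+)
      hence "\<forall>\<^sub>F T in sequentially. indicator {- real T<..<real T} t *\<^sub>R ?g t = ?g t"
        by eventually_elim simp
      thus "(\<lambda>T::nat. indicator {- real T<..<real T} t *\<^sub>R ?g t) \<longlonglongrightarrow> ?g t"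
        by (rule tendsto_eventually)
    qed
    show "AE t in lborel. norm (indicator {- real T<..<real T} t *\<^sub>R ?g t) \<le> (b - a) * norm (char M t)" for T :: nat
      using bd by (intro AE_I2) (auto simp: indicator_def intro: order_trans[OF _ bd] )
  qed auto
  moreover have "(CLBINT t=- real T..real T. ?g t) = (CLINT t|lborel. indicator {- real T<..<real T} t *\<^sub>R ?g t)" for T :: nat
    by (subst interval_lebesgue_integral_le_eq) (auto simp: set_lebesgue_integral_def)
  ultimately have "(\<lambda>T::nat. 1 / (2 * pi) * (CLBINT t=- real T..real T. ?g t)) \<longlonglongrightarrow> 1 / (2 * pi) * (CLINT t|lborel. ?g t)"
    by (intro tendsto_intros) simp
  moreover have "(\<lambda>T::nat. 1 / (2 * pi) * (CLBINT t=- real T..real T. ?g t)) \<longlonglongrightarrow> complex_of_real (measure M {a<..b})"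
    using Levy_Inversion[OF less_imp_le[OF ab] atoms atoms] by simp
  ultimately show "complex_of_real (measure M {a<..b}) = 1 / (2 * pi) * (CLINT t|lborel. ?g t)"
    using LIMSEQ_unique by blast
qed

text \<open>Multiplied by \<open>exp (- s * x)\<close> and divided by its total integral
  \<open>K\<close>, the distribution function becomes a probability density, to which Fourier
  inversion applies; its characteristic function is the transform of the distribution function along
  the vertical line. Averages of this density over short intervals to the right of \<open>x\<close>
  converge by right-continuity, so the formula holds at every \<open>x\<close> and not just almost
  everywhere.\<close>

theorem (in real_distribution) laplace_inversion:
  assumes nonneg: "AE q in M. q \<ge> 0" and s: "s > 0"
  defines "Lt \<equiv> \<lambda>z. CLINT q|M. exp (- z * complex_of_real q)"
  assumes int: "integrable lborel (\<lambda>t. Lt (of_real s - \<i> * of_real t) / (of_real s - \<i> * of_real t))"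
  shows "complex_of_real (cdf M x) = 1 / (2 * pi) * (CLINT t|lborel. exp ((of_real s - \<i> * of_real t) * of_real x)
     * (Lt (of_real s - \<i> * of_real t) / (of_real s - \<i> * of_real t)))"
proof -
  define z where "z t = complex_of_real s - \<i> * of_real t" for t :: real
  have rez: "Re (z t) = s" for t by (simp add: z_def)
  define f where "f x = cdf M x * exp (- s * x)" for x
  have f0: "f x \<ge> 0" for x by (simp add: f_def cdf_nonneg)
  have fz: "f x *\<^sub>R iexp (t * x) = cdf M x *\<^sub>R exp (- z t * of_real x)" for t x
    by (simp add: f_def z_def scaleR_conv_of_real exp_of_real[symmetric] mult_exp_exp algebra_simps)
  have fint: "integrable lborel f"
    using integrable_Re[OF laplace_cdf(1)[OF nonneg, of "of_real s"]] s
    by (simp add: f_def[abs_def] Re_exp)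
  have fm [measurable]: "f \<in> borel_measurable borel" using borel_measurable_integrable[OF fint] by simp
  define K where "K = (LINT x|lborel. f x)"
  have K: "K > 0"
  proof -
    have "((cdf M) \<longlongrightarrow> 1) at_top" by (rule cdf_lim_at_top_prob)
    hence "\<forall>\<^sub>F x in at_top. cdf M x > 0" by (rule order_tendstoD) simp
    then obtain b where b: "cdf M b > 0" by (auto simp: eventually_at_top_linorder)
    have "0 < (LINT x|lborel. indicator {b..b + 1} x * (cdf M b * exp (- s * (b + 1))))"
      using b by simp
    also have "\<dots> \<le> K" unfolding K_def
    proof (rule integral_mono[OF _ fint])
      show "integrable lborel (\<lambda>x. indicator {b..b + 1} x * (cdf M b * exp (- s * (b + 1))))" by simp
      fix x
      have "cdf M b * exp (- s * (b + 1)) \<le> cdf M x * exp (- s * x)" if "b \<le> x" "x \<le> b + 1"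
        using that s by (intro mult_mono cdf_nondecreasing) (auto simp: cdf_nonneg)
      thus "indicator {b..b + 1} x * (cdf M b * exp (- s * (b + 1))) \<le> f x"
        using f0[of x] by (auto simp: indicator_def f_def)
    qed
    finally show ?thesis .
  qed
  define N where "N = density lborel (\<lambda>x. ennreal (f x / K))"
  have fK [measurable]: "(\<lambda>x. f x / K) \<in> borel_measurable borel" by measurable
  have "emeasure N (space N) = (\<integral>\<^sup>+x. ennreal (f x / K) \<partial>lborel)"
    unfolding N_def by (subst emeasure_density) auto
  also have "\<dots> = ennreal (LINT x|lborel. f x / K)"
    using fint f0 K by (intro nn_integral_eq_integral) auto
  also have "(LINT x|lborel. f x / K) = 1" using K by (simp add: K_def[symmetric])
  finally have "prob_space N" by (intro prob_spaceI) simp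
  then interpret N: real_distribution N
    by (auto simp: real_distribution_def real_distribution_axioms_def N_def)
  have charN: "char N t = Lt (z t) / z t / K" for t
  proof -
    have "char N t = (CLINT x|lborel. (f x / K) *\<^sub>R iexp (t * x))"
      unfolding char_def N_def using f0 K by (subst integral_density) auto
    also have "\<dots> = (CLINT x|lborel. (f x *\<^sub>R iexp (t * x)) / K)"
      by (simp add: scaleR_conv_of_real)
    also have "\<dots> = (CLINT x|lborel. cdf M x *\<^sub>R exp (- z t * of_real x)) / K"
      unfolding fz by simp
    also have "\<dots> = Lt (z t) / z t / K"
      using laplace_cdf(2)[OF nonneg, of "z t"] s rez by (simp add: Lt_def)
    finally show ?thesis .
  qed
  have cint: "integrable lborel (char N)"
  proof -
    have "char N = (\<lambda>t. Lt (z t) / z t / K)" by (rule ext) (rule charN)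
    thus ?thesis using integrable_divide_zero[of "of_real K" lborel "\<lambda>t. Lt (z t) / z t"] int by (simp only: z_def)
  qed
  have atoms: "measure N {x} = 0" for x
  proof -
    have "emeasure N {x} = 0" unfolding N_def
      by (subst emeasure_density) (auto simp: nn_integral_0_iff_AE AE_lborel_singleton intro: AE_mp[OF AE_lborel_singleton[of x]] AE_I2)
    thus ?thesis by (simp add: measure_def)
  qed
  define h where "h n = 1 / real (Suc n)" for n
  have h: "h n > 0" "h \<longlonglongrightarrow> 0" for n
    unfolding h_def[abs_def] using LIMSEQ_Suc[OF lim_1_over_n] by auto
  have hn0: "h n \<noteq> 0" for n using h(1)[of n] by simp
  define I where "I n = measure N {x<..x + h n} / h n" for n
  have meas: "measure N {x<..x + e} = (LINT y|lborel. indicator {x<..x + e} y * (f y / K))" for e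
  proof -
    have "measure N {x<..x + e} = (LINT y|N. indicator {x<..x + e} y)" by simp
    also have "\<dots> = (LINT y|lborel. (f y / K) *\<^sub>R indicator {x<..x + e} y)"
      unfolding N_def using f0 K by (subst integral_density) auto
    finally show ?thesis by (simp add: mult.commute)
  qed
  \<comment> \<open>On the short interval the distribution function increases and the exponential
    decreases. Taking each factor at the appropriate end point squeezes the average
    \<open>I n\<close>.\<close>
  have lower: "cdf M x * exp (- s * (x + h n)) / K \<le> I n" and upper: "I n \<le> cdf M (x + h n) * exp (- s * x) / K" for n
  proof -
    have "integrable lborel (\<lambda>y. (f y / K) * indicator {x<..x + h n} y)"
      using fint by (intro integrable_real_mult_indicator) auto
    hence ii: "integrable lborel (\<lambda>y. indicator {x<..x + h n} y * (f y / K))"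
      by (simp only: mult.commute)
    have ic: "integrable lborel (\<lambda>y. indicator {x<..x + h n} y * c)" for c :: real
      by (intro integrable_mult_left integrable_real_indicator) (use h(1)[of n] in auto)
    have len: "(LINT y|lborel. indicator {x<..x + h n} y * c) = c * h n" for c
      using h(1)[of n] by (simp add: mult.commute)
    have "(LINT y|lborel. indicator {x<..x + h n} y * (cdf M x * exp (- s * (x + h n)) / K)) \<le> measure N {x<..x + h n}"
      unfolding meas
    proof (rule integral_mono[OF _ ii])
      fix y
      have "cdf M x * exp (- s * (x + h n)) \<le> cdf M y * exp (- s * y)" if "x < y" "y \<le> x + h n"
        using that s by (intro mult_mono cdf_nondecreasing) (auto simp: cdf_nonneg)
      thus "indicator {x<..x + h n} y * (cdf M x * exp (- s * (x + h n)) / K) \<le> indicator {x<..x + h n} y * (f y / K)"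
        using K by (auto simp: indicator_def f_def divide_right_mono)
    qed (rule ic)
    thus "cdf M x * exp (- s * (x + h n)) / K \<le> I n"
      unfolding len I_def using h(1)[of n] by (simp add: field_simps)
    have "measure N {x<..x + h n} \<le> (LINT y|lborel. indicator {x<..x + h n} y * (cdf M (x + h n) * exp (- s * x) / K))"
      unfolding meas
    proof (rule integral_mono[OF ii])
      fix y
      have "cdf M y * exp (- s * y) \<le> cdf M (x + h n) * exp (- s * x)" if "x < y" "y \<le> x + h n"
        using that s by (intro mult_mono cdf_nondecreasing) (auto simp: cdf_nonneg)
      thus "indicator {x<..x + h n} y * (f y / K) \<le> indicator {x<..x + h n} y * (cdf M (x + h n) * exp (- s * x) / K)"
        using K by (auto simp: indicator_def f_def divide_right_mono)
    qed (rule ic)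
    thus "I n \<le> cdf M (x + h n) * exp (- s * x) / K"
      unfolding len I_def using h(1)[of n] by (simp add: field_simps)
  qed
  have I_lim: "I \<longlonglongrightarrow> f x / K"
  proof (rule tendsto_sandwich[OF always_eventually always_eventually])
    show "\<forall>n. cdf M x * exp (- s * (x + h n)) / K \<le> I n" "\<forall>n. I n \<le> cdf M (x + h n) * exp (- s * x) / K"
      using lower upper by auto
    have "(\<lambda>n. cdf M x * exp (- s * (x + h n)) / K) \<longlonglongrightarrow> cdf M x * exp (- s * (x + 0)) / K"
      using K by (intro tendsto_intros h) auto
    thus "(\<lambda>n. cdf M x * exp (- s * (x + h n)) / K) \<longlonglongrightarrow> f x / K" by (simp add: f_def)
    have "(\<lambda>n. x + h n) \<longlonglongrightarrow> x + 0" by (intro tendsto_intros h)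
    hence "filterlim (\<lambda>n. x + h n) (at_right x) sequentially"
      using h(1) hn0 by (simp add: filterlim_at)
    moreover have "(cdf M \<longlongrightarrow> cdf M x) (at_right x)"
      using cdf_is_right_cont by (simp add: continuous_within)
    ultimately have "(\<lambda>n. cdf M (x + h n)) \<longlonglongrightarrow> cdf M x"
      by (rule filterlim_compose[rotated])
    thus "(\<lambda>n. cdf M (x + h n) * exp (- s * x) / K) \<longlonglongrightarrow> f x / K"
      unfolding f_def using K by (intro tendsto_intros) auto
  qed
  define g where "g n t = (iexp (- (t * x)) - iexp (- (t * (x + h n)))) / (\<i> * t) / h n" for n t
  have I_eq: "complex_of_real (I n) = 1 / (2 * pi) * (CLINT t|lborel. g n t * char N t)" for n
  proof -
    have "complex_of_real (I n) = complex_of_real (measure N {x<..x + h n}) / h n" by (simp add: I_def)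
    also have "\<dots> = 1 / (2 * pi) * ((CLINT t|lborel. (iexp (- (t * x)) - iexp (- (t * (x + h n)))) / (\<i> * t) * char N t) / h n)"
      using h(1)[of n] by (subst N.levy_inversion_integrable(1)[OF _ atoms cint]) auto
    also have "(CLINT t|lborel. (iexp (- (t * x)) - iexp (- (t * (x + h n)))) / (\<i> * t) * char N t) / h n = (CLINT t|lborel. g n t * char N t)"
      unfolding integral_divide_zero[symmetric] g_def by (simp add: mult_ac)
    finally show ?thesis .
  qed
  have "(\<lambda>n. CLINT t|lborel. g n t * char N t) \<longlonglongrightarrow> (CLINT t|lborel. iexp (- (t * x)) * char N t)"
  proof (rule integral_dominated_convergence[where w = "\<lambda>t. norm (char N t)"])
    show "integrable lborel (\<lambda>t. norm (char N t))" using cint by simp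
    show "(\<lambda>t. g n t * char N t) \<in> borel_measurable lborel" for n unfolding g_def by measurable
    show "(\<lambda>t. iexp (- (t * x)) * char N t) \<in> borel_measurable lborel" by measurable
    have "norm (g n t) \<le> 1" for n t
    proof -
      have "norm (g n t) = norm ((iexp (- (t * x)) - iexp (- (t * (x + h n)))) / (\<i> * t)) / h n"
        unfolding g_def norm_divide[of _ "complex_of_real (h n)"] using h(1)[of n] by simp
      also have "\<dots> \<le> (x + h n - x) / h n"
        using h(1)[of n] by (intro divide_right_mono N.levy_inversion_integrable(2)[OF _ atoms cint]) auto
      finally show ?thesis using hn0 by simp
    qed
    thus "AE t in lborel. norm (g n t * char N t) \<le> norm (char N t)" for n
      unfolding norm_mult by (intro AE_I2 mult_left_le_one_le) auto
    show "AE t in lborel. (\<lambda>n. g n t * char N t) \<longlonglongrightarrow> iexp (- (t * x)) * char N t"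
      using AE_lborel_singleton[of "0 :: real"]
    proof eventually_elim
      case (elim t)
      \<comment> \<open>The kernel divided by \<open>h n\<close> is a difference quotient of
        \<open>E\<close> at 0, divided once more by \<open>\<i> * t\<close>; hence the exclusion of
        \<open>t = 0\<close>.\<close>
      define E where "E w = - exp (- \<i> * of_real t * (of_real x + w))" for w
      have "(E has_field_derivative (\<i> * t) * iexp (- (t * x))) (at 0)"
        unfolding E_def by (auto intro!: derivative_eq_intros simp: algebra_simps)
      hence "((\<lambda>w. (E (0 + w) - E 0) / w) \<longlongrightarrow> (\<i> * t) * iexp (- (t * x))) (at 0)"
        by (simp add: DERIV_def)
      moreover have "(\<lambda>n. complex_of_real (h n)) \<longlonglongrightarrow> of_real 0" by (intro tendsto_intros h)
      hence "filterlim (\<lambda>n. complex_of_real (h n)) (at 0) sequentially"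
        using hn0 by (simp add: filterlim_at)
      ultimately have "(\<lambda>n. (E (0 + of_real (h n)) - E 0) / of_real (h n)) \<longlonglongrightarrow> (\<i> * t) * iexp (- (t * x))"
        by (rule filterlim_compose)
      hence lim: "(\<lambda>n. (E (0 + of_real (h n)) - E 0) / of_real (h n) / (\<i> * t) * char N t)
          \<longlonglongrightarrow> (\<i> * t) * iexp (- (t * x)) / (\<i> * t) * char N t"
        using elim by (intro tendsto_intros) auto
      have eq: "(E (0 + of_real (h n)) - E 0) / of_real (h n) / (\<i> * t) = g n t" for n
        unfolding E_def g_def by (simp add: algebra_simps)
      show ?case using lim elim unfolding eq by simp
    qed
  qed
  hence "(\<lambda>n. complex_of_real (I n)) \<longlonglongrightarrow> 1 / (2 * pi) * (CLINT t|lborel. iexp (- (t * x)) * char N t)"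
    unfolding I_eq by (intro tendsto_intros)
  moreover have "(\<lambda>n. complex_of_real (I n)) \<longlonglongrightarrow> of_real (f x / K)" by (intro tendsto_intros I_lim)
  ultimately have "of_real (f x / K) = 1 / (2 * pi) * (CLINT t|lborel. iexp (- (t * x)) * char N t)"
    using LIMSEQ_unique by blast
  hence "of_real (exp (s * x) * K) * complex_of_real (f x / K)
    = 1 / (2 * pi) * (of_real (exp (s * x) * K) * (CLINT t|lborel. iexp (- (t * x)) * char N t))" by simp
  also have "of_real (exp (s * x) * K) * complex_of_real (f x / K) = complex_of_real (cdf M x)"
  proof -
    have "exp (s * x) * K * (f x / K) = cdf M x" using K by (simp add: f_def mult.assoc[symmetric] mult_exp_exp)
    thus ?thesis by (metis of_real_mult)
  qed
  also have "of_real (exp (s * x) * K) * (CLINT t|lborel. iexp (- (t * x)) * char N t)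
    = (CLINT t|lborel. of_real (exp (s * x) * K) * (iexp (- (t * x)) * char N t))" by simp
  also have "\<dots> = (CLINT t|lborel. exp (z t * of_real x) * (Lt (z t) / z t))"
  proof (rule Bochner_Integration.integral_cong[OF refl])
    fix t
    have "exp (z t * of_real x) = of_real (exp (s * x)) * iexp (- (t * x))"
      by (simp add: z_def exp_of_real[symmetric] mult_exp_exp algebra_simps)
    thus "of_real (exp (s * x) * K) * (iexp (- (t * x)) * char N t) = exp (z t * of_real x) * (Lt (z t) / z t)"
      unfolding charN using K by simp
  qed
  finally show ?thesis unfolding z_def .
qed

section \<open>Estimates along the saddle line\<close>

lemma power_le_fact_exp:
  fixes x :: real
  assumes "x \<ge> 0"
  shows "x ^ n \<le> fact n * exp x"
proof -
  have "(\<Sum>i\<in>{n}. x ^ i /\<^sub>R fact i) \<le> exp x"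
    unfolding exp_def using assms summable_exp_generic[of x] by (intro sum_le_suminf) auto
  thus ?thesis by (simp add: field_simps)
qed

lemma integrable_inverse_1_plus_square_lborel: "integrable lborel (\<lambda>x::real. 1 / (1 + x\<^sup>2))"
  using integrable_inverse_1_plus_square by (simp add: set_integrable_def einterval_def inverse_eq_divide)

lemma integrable_power_exp_sqrt:
  fixes a :: real
  assumes a: "a > 0"
  shows "integrable lborel (\<lambda>t. (1 + \<bar>t\<bar>) ^ k * exp (- a * sqrt \<bar>t\<bar>))"
proof (rule Bochner_Integration.integrable_bound)
  \<comment> \<open>With \<open>y = sqrt \<bar>t\<bar>\<close>, the product
    \<open>(1 + y\<^sup>2) ^ k * (1 + y ^ 4)\<close> is at most \<open>(1 + y) ^ m\<close>; the four
    extra powers make room for the integrable factor \<open>1 / (1 + t\<^sup>2)\<close>.\<close>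
  define m where "m = 2 * k + 4"
  define C where "C = fact m * exp a / a ^ m"
  show "integrable lborel (\<lambda>x::real. C * (1 / (1 + x\<^sup>2)))"
    using integrable_inverse_1_plus_square_lborel by (rule integrable_mult_right)
  show "AE t in lborel. norm ((1 + \<bar>t\<bar>) ^ k * exp (- a * sqrt \<bar>t\<bar>)) \<le> norm (C * (1 / (1 + t\<^sup>2)))"
  proof (rule AE_I2)
    fix t :: real
    define y where "y = sqrt \<bar>t\<bar>"
    have y: "y \<ge> 0" "\<bar>t\<bar> = y\<^sup>2" by (simp_all add: y_def)
    have C: "C \<ge> 0" using a by (simp add: C_def)
    have t2: "t\<^sup>2 = y ^ 4"
    proof -
      have "t\<^sup>2 = \<bar>t\<bar>\<^sup>2" by simp
      also have "\<dots> = y ^ 4" unfolding y(2) by (simp flip: power_mult)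
      finally show ?thesis .
    qed
    have "1 + y\<^sup>2 \<le> (1 + y)\<^sup>2" using y by (simp add: power2_eq_square algebra_simps)
    moreover have "1 + y ^ 4 \<le> (1 + y) ^ 4"
    proof -
      have "(1 + y) ^ 4 = 1 + y ^ 4 + (4 * y + 6 * y\<^sup>2 + 4 * y ^ 3)"
        by (simp add: power2_eq_square power3_eq_cube power4_eq_xxxx algebra_simps)
      thus ?thesis using y by simp
    qed
    ultimately have "(1 + y\<^sup>2) ^ k * (1 + y ^ 4) \<le> ((1 + y)\<^sup>2) ^ k * (1 + y) ^ 4"
      using y by (intro mult_mono power_mono) auto
    also have "\<dots> = (1 + y) ^ m" by (simp add: m_def power_add power_mult)
    finally have "(1 + y\<^sup>2) ^ k * (1 + y ^ 4) * exp (- a * y) \<le> (1 + y) ^ m * exp (- a * y)"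
      by (intro mult_right_mono) auto
    also have "\<dots> \<le> C"
    proof -
      have "(a * (1 + y)) ^ m \<le> fact m * exp (a * (1 + y))" using a y by (intro power_le_fact_exp) auto
      hence "a ^ m * ((1 + y) ^ m * exp (- a * y)) \<le> fact m * exp (a * (1 + y)) * exp (- a * y)"
        by (simp add: power_mult_distrib)
      also have "\<dots> = fact m * exp a" by (simp add: mult.assoc mult_exp_exp algebra_simps)
      finally show ?thesis using a by (simp add: C_def field_simps)
    qed
    finally have "(1 + y\<^sup>2) ^ k * exp (- a * y) * (1 + y ^ 4) \<le> C" by (simp add: mult_ac)
    moreover have "1 + y ^ 4 > 0" using y by (simp add: add_pos_nonneg)
    ultimately have "(1 + y\<^sup>2) ^ k * exp (- a * y) \<le> C / (1 + y ^ 4)" by (simp add: pos_le_divide_eq)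
    hence "(1 + \<bar>t\<bar>) ^ k * exp (- a * sqrt \<bar>t\<bar>) \<le> C / (1 + t\<^sup>2)" unfolding t2 y(2)[symmetric] y_def by simp
    thus "norm ((1 + \<bar>t\<bar>) ^ k * exp (- a * sqrt \<bar>t\<bar>)) \<le> norm (C * (1 / (1 + t\<^sup>2)))"
      using C by simp
  qed
qed auto

lemma integral_gaussian_kernel:
  fixes c :: real
  assumes c: "c > 0"
  shows "(LINT t|lborel. exp (- c * t\<^sup>2 / 8)) = sqrt (8 * pi / c)"
proof -
  have s: "2 / sqrt c > 0" using c by simp
  have eq: "exp (- c * t\<^sup>2 / 8) = sqrt (8 * pi / c) * normal_density 0 (2 / sqrt c) t" for t
  proof -
    have "2 * pi * (2 / sqrt c)\<^sup>2 = 8 * pi / c" using c by (simp add: power_divide)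
    moreover have "- (t - 0)\<^sup>2 / (2 * (2 / sqrt c)\<^sup>2) = - c * t\<^sup>2 / 8" using c by (simp add: power_divide)
    moreover have "sqrt (8 * pi / c) \<noteq> 0" using c by simp
    ultimately show ?thesis unfolding normal_density_def by simp
  qed
  show "(LINT t|lborel. exp (- c * t\<^sup>2 / 8)) = sqrt (8 * pi / c)"
    unfolding eq using integral_normal_density[OF s] by simp
qed

text \<open>For \<open>w = a + \<i> b\<close> the real and imaginary parts of
  \<open>w\<^sup>2\<close> give \<open>a\<^sup>2 - b\<^sup>2 = 1\<close> and
  \<open>2ab = - \<delta>\<close>; eliminating \<open>b\<close> leaves
  \<open>\<delta>\<^sup>2 = 4a\<^sup>2(a + 1)(a - 1)\<close>. So \<open>a - 1\<close> grows
  quadratically for small \<open>\<delta>\<close> and like a square root for large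
  \<open>\<delta>\<close>.\<close>

lemma csqrt_one_minus:
  fixes \<delta> :: real
  defines "w \<equiv> csqrt (1 - \<i> * of_real \<delta>)"
  shows "w\<^sup>2 = 1 - \<i> * of_real \<delta>" and "Re w \<ge> 1" and "Re ((w - 1)\<^sup>2) = 2 - 2 * Re w"
    and "\<bar>\<delta>\<bar> \<le> 1 \<Longrightarrow> \<delta>\<^sup>2 / 12 \<le> Re w - 1" and "\<bar>\<delta>\<bar> \<ge> 1 \<Longrightarrow> sqrt \<bar>\<delta>\<bar> / 12 \<le> Re w - 1"
proof -
  show w2: "w\<^sup>2 = 1 - \<i> * of_real \<delta>" by (simp add: w_def)
  define a b where "a = Re w" and "b = Im w"
  have ab: "a\<^sup>2 - b\<^sup>2 = 1" "2 * (a * b) = - \<delta>"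
    using arg_cong[OF w2, of Re] arg_cong[OF w2, of Im] by (simp_all add: a_def b_def power2_eq_square mult_ac)
  have a0: "a \<ge> 0" unfolding a_def w_def by simp
  have "1\<^sup>2 \<le> a\<^sup>2" using ab(1) zero_le_power2[of b] unfolding one_power2 by linarith
  hence a1: "a \<ge> 1" using a0 by (rule power2_le_imp_le)
  thus "Re w \<ge> 1" by (simp add: a_def)
  have "Re ((w - 1)\<^sup>2) = (a - 1)\<^sup>2 - b\<^sup>2" by (simp add: a_def b_def power2_eq_square)
  also have "\<dots> = 2 - 2 * a" using ab(1) by (simp add: power2_eq_square algebra_simps)
  finally show "Re ((w - 1)\<^sup>2) = 2 - 2 * Re w" by (simp add: a_def)
  have "4 * a\<^sup>2 * (a\<^sup>2 - 1) = (2 * (a * b))\<^sup>2"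
    using ab(1) by (simp add: power_mult_distrib)
  hence key: "\<delta>\<^sup>2 = 4 * (a\<^sup>2 * (a + 1)) * (a - 1)" unfolding ab(2)
    by (simp add: power2_eq_square algebra_simps)
  \<comment> \<open>Prepared for a contradiction: \<open>a - 1 < m / 12\<close> with
    \<open>m \<ge> 1\<close> bounds \<open>a\<close> by \<open>13/12 * m\<close> and
    \<open>a + 1\<close> by \<open>25/12 * m\<close>, and the resulting constant 10 is below 12.
    Small \<open>\<delta>\<close> uses \<open>m = 1\<close>, large \<open>\<delta>\<close> uses
    \<open>m = sqrt \<bar>\<delta>\<bar>\<close>.\<close>
  have upper: "\<delta>\<^sup>2 \<le> 10 * m ^ 3 * (a - 1)" if "a \<le> 13 / 12 * m" "1 \<le> m" for m
  proof -
    have "a\<^sup>2 * (a + 1) \<le> (13 / 12 * m)\<^sup>2 * (25 / 12 * m)"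
      using that a1 by (intro mult_mono power_mono) auto
    also have "\<dots> = 4225 / 1728 * m ^ 3" by (simp add: power2_eq_square power3_eq_cube)
    also have "\<dots> \<le> 5 / 2 * m ^ 3" using that by (intro mult_right_mono) auto
    finally show ?thesis unfolding key using a1 mult_right_mono[of "a\<^sup>2 * (a + 1)" "5 / 2 * m ^ 3" "4 * (a - 1)"]
      by (simp add: algebra_simps)
  qed
  show "\<delta>\<^sup>2 / 12 \<le> Re w - 1" if "\<bar>\<delta>\<bar> \<le> 1"
  proof (rule ccontr)
    assume "\<not> \<delta>\<^sup>2 / 12 \<le> Re w - 1"
    hence less: "a - 1 < \<delta>\<^sup>2 / 12" by (simp add: a_def)
    moreover have "\<delta>\<^sup>2 \<le> 1" using that by (simp add: abs_square_le_1)
    ultimately have "\<delta>\<^sup>2 \<le> 10 * (a - 1)" using upper[of 1] by simp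
    moreover have False if "d \<le> 10 * (a - 1)" "a - 1 < d / 12" for d
      using that a1 by (simp add: field_simps)
    ultimately show False using less by blast
  qed
  show "sqrt \<bar>\<delta>\<bar> / 12 \<le> Re w - 1" if "\<bar>\<delta>\<bar> \<ge> 1"
  proof (rule ccontr)
    assume "\<not> sqrt \<bar>\<delta>\<bar> / 12 \<le> Re w - 1"
    define m where "m = sqrt \<bar>\<delta>\<bar>"
    have less: "a - 1 < m / 12" using \<open>\<not> _\<close> by (simp add: a_def m_def)
    have m: "m \<ge> 1" using that by (simp add: m_def)
    have "\<delta>\<^sup>2 = m ^ 4"
    proof -
      have "m ^ 4 = (m\<^sup>2)\<^sup>2" by (simp flip: power_mult)
      thus ?thesis by (simp add: m_def)
    qed
    hence "m ^ 3 * m \<le> m ^ 3 * (10 * (a - 1))"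
      using upper[of m] less m by (simp add: power_numeral_reduce mult_ac)
    hence "m \<le> 10 * (a - 1)" using m by (subst (asm) mult_le_cancel_left_pos) auto
    moreover have False if "m \<le> 10 * d" "d < m / 12" for d
      using that m by (simp add: field_simps)
    ultimately show False using less by blast
  qed
qed

text \<open>Both regimes of \<open>csqrt_one_minus\<close> are merged into a lower bound free of
  \<open>\<sigma>\<close>, as a common majorant requires. The \<open>- 1\<close> takes care of small
  \<open>\<tau>\<close>, where \<open>\<tau>\<^sup>2\<close> can lie below
  \<open>sqrt \<bar>\<tau>\<bar>\<close>.\<close>

lemma saddle_decay:
  assumes \<sigma>: "\<sigma> \<ge> (1::real)"
  shows "(sqrt \<bar>\<tau>\<bar> - 1) / 12 \<le> \<sigma>\<^sup>2 * (Re (csqrt (1 - \<i> * of_real (\<tau> / \<sigma>))) - 1)"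
proof (cases "\<bar>\<tau> / \<sigma>\<bar> \<le> 1")
  case True
  have "sqrt \<bar>\<tau>\<bar> - 1 \<le> \<tau>\<^sup>2"
  proof (cases "\<bar>\<tau>\<bar> \<le> 1")
    case True
    hence "sqrt \<bar>\<tau>\<bar> \<le> 1" by simp
    thus ?thesis using zero_le_power2[of \<tau>] by linarith
  next
    case False
    hence "sqrt \<bar>\<tau>\<bar> \<le> \<bar>\<tau>\<bar>" using self_le_power[of "\<bar>\<tau>\<bar>" 2] by (intro real_le_lsqrt) auto
    also have "\<dots> \<le> \<bar>\<tau>\<bar>\<^sup>2" using False by (intro self_le_power) auto
    finally show ?thesis by simp
  qed
  hence "(sqrt \<bar>\<tau>\<bar> - 1) / 12 \<le> \<sigma>\<^sup>2 * ((\<tau> / \<sigma>)\<^sup>2 / 12)" using \<sigma> by (simp add: power_divide)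
  also have "\<dots> \<le> \<sigma>\<^sup>2 * (Re (csqrt (1 - \<i> * of_real (\<tau> / \<sigma>))) - 1)"
    using csqrt_one_minus(4)[OF True] by (intro mult_left_mono) auto
  finally show ?thesis .
next
  case False
  have "sqrt \<sigma> \<le> \<sigma>" using \<sigma> by (intro real_le_lsqrt) (auto simp: power2_eq_square)
  also have "\<sigma> \<le> \<sigma>\<^sup>2" using \<sigma> by (simp add: power2_eq_square)
  finally have "sqrt \<bar>\<tau>\<bar> * sqrt \<sigma> \<le> sqrt \<bar>\<tau>\<bar> * \<sigma>\<^sup>2" by (intro mult_left_mono) auto
  hence "sqrt \<bar>\<tau>\<bar> \<le> \<sigma>\<^sup>2 * sqrt \<bar>\<tau> / \<sigma>\<bar>" using \<sigma> by (simp add: real_sqrt_divide abs_divide field_simps)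
  hence "(sqrt \<bar>\<tau>\<bar> - 1) / 12 \<le> \<sigma>\<^sup>2 * (sqrt \<bar>\<tau> / \<sigma>\<bar> / 12)" by simp
  also have "\<dots> \<le> \<sigma>\<^sup>2 * (Re (csqrt (1 - \<i> * of_real (\<tau> / \<sigma>))) - 1)"
    using csqrt_one_minus(5)[of "\<tau> / \<sigma>"] False by (intro mult_left_mono) auto
  finally show ?thesis .
qed

lemma csqrt_of_real_mult:
  assumes "a \<ge> 0"
  shows "csqrt (of_real a * z) = of_real (sqrt a) * csqrt z"
proof (rule csqrt_unique)
  show "(of_real (sqrt a) * csqrt z)\<^sup>2 = of_real a * z"
    using assms by (simp add: power_mult_distrib flip: of_real_power)
  show "0 < Re (of_real (sqrt a) * csqrt z) \<or> Re (of_real (sqrt a) * csqrt z) = 0 \<and> 0 \<le> Im (of_real (sqrt a) * csqrt z)"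
    using csqrt_principal[of z] assms by (cases "a = 0") auto
qed

text \<open>
  With \<open>\<beta> = 2\<surd>2 (\<psi> 0 \<psi> 1)\<^bsup>1/4\<^esup>\<close> and \<open>c = k \<theta> / \<surd>2\<close> this is
  the leading term of the Laplace transform of the squared norm.
\<close>

definition laplace_model :: "nat \<Rightarrow> real \<Rightarrow> real \<Rightarrow> complex \<Rightarrow> complex" where
  "laplace_model k \<beta> c z = csqrt (of_real \<beta> * csqrt z) ^ k * exp (- of_real c * csqrt z)"

lemma Re_csqrt_pos:
  assumes "Re z > 0"
  shows "Re (csqrt z) > 0"
proof -
  have "Re (csqrt z) \<noteq> 0"
  proof
    assume "Re (csqrt z) = 0"
    hence "Re ((csqrt z)\<^sup>2) \<le> 0" unfolding power2_eq_square by simp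
    thus False using assms by simp
  qed
  thus ?thesis using Re_csqrt[of z] by linarith
qed

text \<open>The vertical line through the saddle point \<open>\<sigma>\<^sup>4\<close> of \<open>z x - c \<surd>z\<close>, where \<open>x = c / (2 \<sigma>\<^sup>2)\<close>.\<close>

definition saddle_line :: "real \<Rightarrow> real \<Rightarrow> complex" where
  "saddle_line \<sigma> \<tau> = of_real (\<sigma> ^ 4) * (1 - \<i> * of_real (\<tau> / \<sigma>))"

text \<open>The value of \<open>exp (z * x) * laplace_model k \<beta> c z / z\<close> at the saddle
  point: there the exponent is \<open>c \<sigma>\<^sup>2 / 2 - c \<sigma>\<^sup>2\<close>. Division
  by it makes the model integrand equal to 1 at \<open>\<tau> = 0\<close>.\<close>

definition saddle_factor :: "nat \<Rightarrow> real \<Rightarrow> real \<Rightarrow> real \<Rightarrow> real" where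
  "saddle_factor k \<beta> c \<sigma> = (\<sigma> * sqrt \<beta>) ^ k * exp (- c * \<sigma>\<^sup>2 / 2) / \<sigma> ^ 4"

definition saddle_integrand :: "(complex \<Rightarrow> complex) \<Rightarrow> nat \<Rightarrow> real \<Rightarrow> real \<Rightarrow> real \<Rightarrow> real \<Rightarrow> complex" where
  "saddle_integrand L k \<beta> c \<sigma> \<tau> = exp (saddle_line \<sigma> \<tau> * of_real (c / (2 * \<sigma>\<^sup>2)))
     * (L (saddle_line \<sigma> \<tau>) / saddle_line \<sigma> \<tau>) / of_real (saddle_factor k \<beta> c \<sigma>)"

lemma Re_saddle_line: "Re (saddle_line \<sigma> \<tau>) = \<sigma> ^ 4"
  by (simp add: saddle_line_def)

lemma saddle_factor_pos: "\<sigma> > 0 \<Longrightarrow> \<beta> > 0 \<Longrightarrow> saddle_factor k \<beta> c \<sigma> > 0"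
  by (simp add: saddle_factor_def)

section \<open>The normalised integrand on the saddle line\<close>

context
  fixes L :: "complex \<Rightarrow> complex" and k :: nat and \<beta> c :: real
  assumes \<beta>: "\<beta> > 0" and c: "c > 0"
    and L_cont: "continuous_on {z. Re z > 0} L"
    and L_asymp: "\<forall>e>0. \<exists>s0. \<forall>z. Re z > s0 \<longrightarrow> norm (L z / laplace_model k \<beta> c z - 1) < e"
begin

text \<open>On the line the root of \<open>z\<close> is \<open>\<sigma>\<^sup>2 w\<close>, and
  completing the square turns \<open>z x - c \<surd>z\<close> into
  \<open>(c \<sigma>\<^sup>2 / 2) ((w - 1)\<^sup>2 - 1)\<close>. The constant part is cancelled by
  \<open>saddle_factor\<close>.\<close>

lemma saddle_integrand_eq:
  fixes \<sigma> \<tau> :: real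
  assumes \<sigma>: "\<sigma> > 0"
  defines "w \<equiv> csqrt (1 - \<i> * of_real (\<tau> / \<sigma>))"
  shows "saddle_integrand L k \<beta> c \<sigma> \<tau> = exp (of_real (c * \<sigma>\<^sup>2 / 2) * (w - 1)\<^sup>2) * csqrt w ^ k / w\<^sup>2
     * (L (saddle_line \<sigma> \<tau>) / laplace_model k \<beta> c (saddle_line \<sigma> \<tau>))"
proof -
  define z where "z = saddle_line \<sigma> \<tau>"
  have w: "w\<^sup>2 = 1 - \<i> * of_real (\<tau> / \<sigma>)" "Re w \<ge> 1"
    unfolding w_def by (rule csqrt_one_minus)+
  have z: "z = of_real (\<sigma> ^ 4) * w\<^sup>2" by (simp add: z_def saddle_line_def w)
  have s4: "sqrt (\<sigma> ^ 4) = \<sigma>\<^sup>2" using \<sigma> by (intro real_sqrt_unique) (auto simp flip: power_mult)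
  have cz: "csqrt z = of_real (\<sigma>\<^sup>2) * w"
    unfolding z_def saddle_line_def using \<sigma> by (subst csqrt_of_real_mult) (auto simp: s4 w_def)
  have "csqrt (of_real \<beta> * csqrt z) = csqrt (of_real (\<beta> * \<sigma>\<^sup>2) * w)" by (simp add: cz mult_ac)
  also have "\<dots> = of_real (\<sigma> * sqrt \<beta>) * csqrt w"
    using \<sigma> \<beta> by (subst csqrt_of_real_mult) (auto simp: real_sqrt_mult)
  finally have N: "laplace_model k \<beta> c z = of_real ((\<sigma> * sqrt \<beta>) ^ k) * csqrt w ^ k * exp (- of_real (c * \<sigma>\<^sup>2) * w)"
    unfolding laplace_model_def by (simp add: cz power_mult_distrib mult_ac)
  have w0: "w \<noteq> 0" using w(2) by auto
  have N0: "laplace_model k \<beta> c z \<noteq> 0" unfolding N using \<sigma> \<beta> w0 by simp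
  have xz: "z * of_real (c / (2 * \<sigma>\<^sup>2)) = of_real (c * \<sigma>\<^sup>2 / 2) * w\<^sup>2"
    unfolding z using \<sigma> by (simp add: field_simps power_numeral_reduce)
  have "exp (of_real (c * \<sigma>\<^sup>2 / 2) * (w - 1)\<^sup>2) * of_real (exp (- c * \<sigma>\<^sup>2 / 2))
      = exp (of_real (c * \<sigma>\<^sup>2 / 2) * w\<^sup>2) * exp (- of_real (c * \<sigma>\<^sup>2) * w)"
  proof -
    define A where "A = complex_of_real (c * \<sigma>\<^sup>2 / 2)"
    have "complex_of_real (- c * \<sigma>\<^sup>2 / 2) = - A" "complex_of_real (c * \<sigma>\<^sup>2) = 2 * A" by (simp_all add: A_def)
    moreover have "A * (w - 1)\<^sup>2 + - A = A * w\<^sup>2 + - (2 * A) * w" by (simp add: power2_eq_square algebra_simps)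
    ultimately show ?thesis unfolding exp_of_real[symmetric] mult_exp_exp A_def[symmetric] by (simp add: mult_ac)
  qed
  hence e: "exp (z * of_real (c / (2 * \<sigma>\<^sup>2))) * exp (- of_real (c * \<sigma>\<^sup>2) * w) / of_real (exp (- c * \<sigma>\<^sup>2 / 2))
      = exp (of_real (c * \<sigma>\<^sup>2 / 2) * (w - 1)\<^sup>2)"
    unfolding xz by (simp add: divide_simps)
  have "saddle_integrand L k \<beta> c \<sigma> \<tau> = exp (z * of_real (c / (2 * \<sigma>\<^sup>2))) * (laplace_model k \<beta> c z / z) / of_real (saddle_factor k \<beta> c \<sigma>)
      * (L z / laplace_model k \<beta> c z)"
    unfolding saddle_integrand_def z_def[symmetric] using N0 by simp
  also have "exp (z * of_real (c / (2 * \<sigma>\<^sup>2))) * (laplace_model k \<beta> c z / z) / of_real (saddle_factor k \<beta> c \<sigma>)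
      = (exp (z * of_real (c / (2 * \<sigma>\<^sup>2))) * exp (- of_real (c * \<sigma>\<^sup>2) * w) / of_real (exp (- c * \<sigma>\<^sup>2 / 2))) * csqrt w ^ k / w\<^sup>2"
    unfolding N saddle_factor_def unfolding z using \<sigma> \<beta> w0 by (simp add: field_simps)
  finally show ?thesis unfolding e unfolding z_def .
qed

text \<open>As \<open>Re ((w - 1)\<^sup>2) = 2 - 2 * Re w\<close>, the exponential is controlled by
  \<open>saddle_decay\<close>. The ratio to the model is at most 2, and
  \<open>norm w \<ge> 1\<close> disposes of the denominator.\<close>

lemma saddle_integrand_bound:
  assumes "\<sigma> \<ge> 1" and "norm (L (saddle_line \<sigma> \<tau>) / laplace_model k \<beta> c (saddle_line \<sigma> \<tau>) - 1) < 1"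
  shows "norm (saddle_integrand L k \<beta> c \<sigma> \<tau>) \<le> 2 * exp (c / 12) * ((1 + \<bar>\<tau>\<bar>) ^ k * exp (- (c / 12) * sqrt \<bar>\<tau>\<bar>))"
proof -
  define w where "w = csqrt (1 - \<i> * of_real (\<tau> / \<sigma>))"
  define r where "r = L (saddle_line \<sigma> \<tau>) / laplace_model k \<beta> c (saddle_line \<sigma> \<tau>)"
  have w: "w\<^sup>2 = 1 - \<i> * of_real (\<tau> / \<sigma>)" "Re w \<ge> 1" "Re ((w - 1)\<^sup>2) = 2 - 2 * Re w"
    unfolding w_def by (rule csqrt_one_minus)+
  have nw: "norm w \<ge> 1" using w(2) complex_Re_le_cmod[of w] by linarith
  have "norm w \<le> (norm w)\<^sup>2" using nw by (intro self_le_power) auto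
  also have "\<dots> = norm (1 - \<i> * of_real (\<tau> / \<sigma>))" unfolding w(1)[symmetric] norm_power ..
  also have "\<dots> \<le> 1 + \<bar>\<tau> / \<sigma>\<bar>"
    using norm_triangle_ineq4[of 1 "\<i> * of_real (\<tau> / \<sigma>)"] by (simp add: norm_mult norm_divide)
  also have "\<dots> \<le> 1 + \<bar>\<tau>\<bar>" using assms(1) by (simp add: abs_divide divide_le_eq mult_le_cancel_left1)
  finally have nw2: "norm w \<le> 1 + \<bar>\<tau>\<bar>" .
  have ncs: "norm (csqrt w) \<le> 1 + \<bar>\<tau>\<bar>"
  proof -
    have "(norm (csqrt w))\<^sup>2 = norm w" by (simp flip: norm_power)
    also have "\<dots> \<le> (norm w)\<^sup>2" using nw by (intro self_le_power) auto
    finally have "norm (csqrt w) \<le> norm w" by (rule power2_le_imp_le) simp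
    thus ?thesis using nw2 by simp
  qed
  have nr: "norm r \<le> 2" using assms(2) norm_triangle_ineq2[of r 1] unfolding r_def[symmetric] by simp
  have ne: "norm (exp (of_real (c * \<sigma>\<^sup>2 / 2) * (w - 1)\<^sup>2)) \<le> exp (c / 12) * exp (- (c / 12) * sqrt \<bar>\<tau>\<bar>)"
  proof -
    have *: "c * ((sqrt \<bar>\<tau>\<bar> - 1) / 12) \<le> c * (\<sigma>\<^sup>2 * (Re w - 1))"
      unfolding w_def using saddle_decay[OF assms(1)] c by (intro mult_left_mono) auto
    have Rr: "Re (complex_of_real a * z) = a * Re z" for a z by simp
    have "Re (of_real (c * \<sigma>\<^sup>2 / 2) * (w - 1)\<^sup>2) \<le> c / 12 + - (c / 12) * sqrt \<bar>\<tau>\<bar>"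
    proof -
      have "c * \<sigma>\<^sup>2 / 2 * (2 - 2 * Re w) = - (c * (\<sigma>\<^sup>2 * (Re w - 1)))" by (simp add: field_simps)
      moreover have "c * ((sqrt \<bar>\<tau>\<bar> - 1) / 12) = c / 12 * sqrt \<bar>\<tau>\<bar> - c / 12"
        by (simp add: algebra_simps diff_divide_distrib)
      ultimately show ?thesis unfolding Rr w(3) using * by linarith
    qed
    thus ?thesis unfolding norm_exp_eq_Re mult_exp_exp by simp
  qed
  have "norm (saddle_integrand L k \<beta> c \<sigma> \<tau>) = norm (exp (of_real (c * \<sigma>\<^sup>2 / 2) * (w - 1)\<^sup>2)) * norm (csqrt w) ^ k / (norm w)\<^sup>2 * norm r"
    using assms(1) unfolding r_def w_def by (subst saddle_integrand_eq) (simp_all add: norm_mult norm_divide norm_power)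
  also have "\<dots> \<le> (exp (c / 12) * exp (- (c / 12) * sqrt \<bar>\<tau>\<bar>)) * (1 + \<bar>\<tau>\<bar>) ^ k / 1 * 2"
    using nw by (intro mult_mono frac_le power_mono ne ncs nr) auto
  finally show ?thesis by (simp add: mult_ac)
qed

lemma saddle_integrand_measurable:
  assumes "\<sigma> > 0"
  shows "saddle_integrand L k \<beta> c \<sigma> \<in> borel_measurable borel"
proof -
  have "continuous_on UNIV (\<lambda>\<tau>. L (saddle_line \<sigma> \<tau>))"
    by (rule continuous_on_compose2[OF L_cont])
       (use assms in \<open>auto simp: Re_saddle_line saddle_line_def intro!: continuous_intros\<close>)
  moreover have "saddle_line \<sigma> \<tau> \<noteq> 0" for \<tau>
    using Re_saddle_line[of \<sigma> \<tau>] assms by (auto simp del: saddle_line_def)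
  moreover have "continuous_on UNIV (saddle_line \<sigma>)"
    unfolding saddle_line_def[abs_def] using assms by (intro continuous_intros) auto
  moreover have nz: "saddle_factor k \<beta> c \<sigma> \<noteq> 0" using saddle_factor_pos[OF assms \<beta>, of k c] by simp
  ultimately have "continuous_on UNIV (saddle_integrand L k \<beta> c \<sigma>)"
    unfolding saddle_integrand_def[abs_def] using nz by (intro continuous_intros) auto
  thus ?thesis by (rule borel_measurable_continuous_onI)
qed

text \<open>From \<open>(w - 1)(w + 1) = - \<i> \<tau> / \<sigma>\<close> the large factor cancels:
  \<open>\<sigma>\<^sup>2 (w - 1)\<^sup>2 = - \<tau>\<^sup>2 / (w + 1)\<^sup>2\<close>, and
  \<open>w\<close> tends to 1.\<close>

lemma saddle_integrand_limit: "((\<lambda>\<sigma>. saddle_integrand L k \<beta> c \<sigma> \<tau>) \<longlongrightarrow> of_real (exp (- c * \<tau>\<^sup>2 / 8))) at_top"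
proof -
  define w where "w \<sigma> = csqrt (1 - \<i> * of_real (\<tau> / \<sigma>))" for \<sigma>
  define r where "r \<sigma> = L (saddle_line \<sigma> \<tau>) / laplace_model k \<beta> c (saddle_line \<sigma> \<tau>)" for \<sigma>
  have "((\<lambda>\<sigma>. \<tau> / \<sigma>) \<longlongrightarrow> 0) at_top"
    by (intro tendsto_divide_0[OF tendsto_const] filterlim_at_top_imp_at_infinity filterlim_ident)
  hence "((\<lambda>\<sigma>. 1 - \<i> * complex_of_real (\<tau> / \<sigma>)) \<longlongrightarrow> 1 - \<i> * of_real 0) at_top" by (intro tendsto_intros)
  hence "((\<lambda>\<sigma>. 1 - \<i> * complex_of_real (\<tau> / \<sigma>)) \<longlongrightarrow> 1) at_top" by simp
  hence "(w \<longlongrightarrow> csqrt 1) at_top"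
    unfolding w_def[abs_def] by (intro isCont_tendsto_compose[OF continuous_at_csqrt]) auto
  hence w: "(w \<longlongrightarrow> 1) at_top" by simp
  have cw: "((\<lambda>\<sigma>. csqrt (w \<sigma>)) \<longlongrightarrow> csqrt 1) at_top"
    by (intro isCont_tendsto_compose[OF continuous_at_csqrt w]) auto
  have r: "(r \<longlongrightarrow> 1) at_top"
  proof (rule tendstoI)
    fix e :: real assume "e > 0"
    then obtain s0 where s0: "\<forall>z. Re z > s0 \<longrightarrow> norm (L z / laplace_model k \<beta> c z - 1) < e"
      using L_asymp by blast
    have "filterlim (\<lambda>\<sigma>::real. \<sigma> ^ 4) at_top at_top" by (intro filterlim_pow_at_top filterlim_ident) auto
    hence "\<forall>\<^sub>F \<sigma> in at_top. \<sigma> ^ 4 > s0" by (simp add: filterlim_at_top_dense)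
    thus "\<forall>\<^sub>F \<sigma> in at_top. dist (r \<sigma>) 1 < e"
      by eventually_elim (use s0 in \<open>simp add: r_def dist_norm Re_saddle_line\<close>)
  qed
  have q: "((\<lambda>\<sigma>. - (of_real \<tau>)\<^sup>2 / (w \<sigma> + 1)\<^sup>2) \<longlongrightarrow> - (of_real \<tau>)\<^sup>2 / (1 + 1)\<^sup>2) at_top"
    by (intro tendsto_intros w) auto
  have ex: "((\<lambda>\<sigma>. exp (of_real (c / 2) * (- (of_real \<tau>)\<^sup>2 / (w \<sigma> + 1)\<^sup>2))) \<longlongrightarrow> exp (of_real (c / 2) * (- (of_real \<tau>)\<^sup>2 / (1 + 1)\<^sup>2))) at_top"
    by (intro tendsto_exp tendsto_mult_left q)
  have A: "((\<lambda>\<sigma>. exp (of_real (c / 2) * (- (of_real \<tau>)\<^sup>2 / (w \<sigma> + 1)\<^sup>2)) * csqrt (w \<sigma>) ^ k / (w \<sigma>)\<^sup>2 * r \<sigma>)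
     \<longlongrightarrow> exp (of_real (c / 2) * (- (of_real \<tau>)\<^sup>2 / (1 + 1)\<^sup>2)) * csqrt 1 ^ k / 1\<^sup>2 * 1) at_top"
    by (intro tendsto_mult tendsto_divide tendsto_power ex cw w r) auto
  have E: "exp (of_real (c / 2) * (- (of_real \<tau>)\<^sup>2 / (1 + 1)\<^sup>2)) * csqrt 1 ^ k / 1\<^sup>2 * 1 = complex_of_real (exp (- c * \<tau>\<^sup>2 / 8))"
    by (simp add: exp_of_real[symmetric])
  have C: "\<forall>\<^sub>F \<sigma> in at_top. exp (of_real (c / 2) * (- (of_real \<tau>)\<^sup>2 / (w \<sigma> + 1)\<^sup>2)) * csqrt (w \<sigma>) ^ k / (w \<sigma>)\<^sup>2 * r \<sigma> = saddle_integrand L k \<beta> c \<sigma> \<tau>"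
    using eventually_gt_at_top[of 0]
  proof eventually_elim
    case (elim \<sigma>)
    have w2: "(w \<sigma>)\<^sup>2 = 1 - \<i> * of_real (\<tau> / \<sigma>)" and w1: "Re (w \<sigma>) \<ge> 1"
      unfolding w_def by (rule csqrt_one_minus)+
    have ne: "w \<sigma> + 1 \<noteq> 0"
    proof
      assume "w \<sigma> + 1 = 0"
      hence "Re (w \<sigma> + 1) = 0" by simp
      thus False using w1 by simp
    qed
    have "(w \<sigma> - 1) * (w \<sigma> + 1) = - \<i> * of_real (\<tau> / \<sigma>)" using w2 by (simp add: power2_eq_square algebra_simps)
    hence "((w \<sigma> - 1) * (w \<sigma> + 1))\<^sup>2 * of_real (\<sigma>\<^sup>2) = - (of_real \<tau>)\<^sup>2"
      using elim by (simp add: power_mult_distrib power_divide)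
    hence "of_real (\<sigma>\<^sup>2) * (w \<sigma> - 1)\<^sup>2 = - (of_real \<tau>)\<^sup>2 / (w \<sigma> + 1)\<^sup>2"
      by (subst nonzero_eq_divide_eq) (use ne in \<open>auto simp: power_mult_distrib mult_ac\<close>)
    hence "of_real (c / 2) * (- (of_real \<tau>)\<^sup>2 / (w \<sigma> + 1)\<^sup>2) = of_real (c * \<sigma>\<^sup>2 / 2) * (w \<sigma> - 1)\<^sup>2"
      by (metis (no_types, opaque_lifting) mult.assoc of_real_mult times_divide_eq_left)
    thus ?case unfolding saddle_integrand_eq[OF elim] r_def w_def by (simp only:)
  qed
  show ?thesis by (rule Lim_transform_eventually[OF A[unfolded E] C])
qed

lemma saddle_integral:
  shows "((\<lambda>\<sigma>. CLINT \<tau>|lborel. saddle_integrand L k \<beta> c \<sigma> \<tau>) \<longlongrightarrow> of_real (sqrt (8 * pi / c))) at_top"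
    and "\<forall>\<^sub>F \<sigma> in at_top. integrable lborel (saddle_integrand L k \<beta> c \<sigma>)"
proof -
  define W where "W \<tau> = 2 * exp (c / 12) * ((1 + \<bar>\<tau>\<bar>) ^ k * exp (- (c / 12) * sqrt \<bar>\<tau>\<bar>))" for \<tau> :: real
  have W: "integrable lborel W"
    unfolding W_def using c by (intro integrable_mult_right integrable_power_exp_sqrt) auto
  obtain s0 where s0: "\<forall>z. Re z > s0 \<longrightarrow> norm (L z / laplace_model k \<beta> c z - 1) < 1"
    using L_asymp zero_less_one by blast
  have "filterlim (\<lambda>\<sigma>::real. \<sigma> ^ 4) at_top at_top" by (intro filterlim_pow_at_top filterlim_ident) auto
  hence "\<forall>\<^sub>F \<sigma> in at_top. \<sigma> ^ 4 > s0" by (simp add: filterlim_at_top_dense)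
  hence ev: "\<forall>\<^sub>F \<sigma> in at_top. \<sigma> \<ge> 1 \<and> (\<forall>\<tau>. norm (saddle_integrand L k \<beta> c \<sigma> \<tau>) \<le> W \<tau>)"
    using eventually_ge_at_top[of 1]
    by eventually_elim (use s0 Re_saddle_line saddle_integrand_bound in \<open>auto simp: W_def\<close>)
  show "\<forall>\<^sub>F \<sigma> in at_top. integrable lborel (saddle_integrand L k \<beta> c \<sigma>)"
    using ev
  proof eventually_elim
    case (elim \<sigma>)
    show ?case
      by (rule Bochner_Integration.integrable_bound[OF W])
         (use elim saddle_integrand_measurable[of \<sigma>] in \<open>auto intro!: AE_I2 order_trans[OF _ abs_ge_self]\<close>)
  qed
  \<comment> \<open>Dominated convergence asks for measurability at every parameter value;
    \<open>max \<sigma> 1\<close> keeps the parameter positive and agrees with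
    \<open>\<sigma>\<close> eventually.\<close>
  have A: "((\<lambda>\<sigma>. CLINT \<tau>|lborel. saddle_integrand L k \<beta> c (max \<sigma> 1) \<tau>) \<longlongrightarrow> (CLINT \<tau>|lborel. of_real (exp (- c * \<tau>\<^sup>2 / 8)))) at_top"
  proof (rule integral_dominated_convergence_at_top[where w = W])
    show "saddle_integrand L k \<beta> c (max \<sigma> 1) \<in> borel_measurable lborel" for \<sigma>
      using saddle_integrand_measurable[of "max \<sigma> 1"] by simp
    have mx: "filterlim (\<lambda>\<sigma>. max \<sigma> (1::real)) at_top at_top"
      by (rule filterlim_at_top_mono[OF filterlim_ident]) auto
    show "AE \<tau> in lborel. ((\<lambda>\<sigma>. saddle_integrand L k \<beta> c (max \<sigma> 1) \<tau>) \<longlongrightarrow> of_real (exp (- c * \<tau>\<^sup>2 / 8))) at_top"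
      by (intro AE_I2 filterlim_compose[OF saddle_integrand_limit mx])
    show "\<forall>\<^sub>F \<sigma> in at_top. AE \<tau> in lborel. norm (saddle_integrand L k \<beta> c (max \<sigma> 1) \<tau>) \<le> W \<tau>"
      using ev by eventually_elim (auto simp: max_def intro!: AE_I2)
  qed (use W in auto)
  have E: "(CLINT \<tau>|lborel. of_real (exp (- c * \<tau>\<^sup>2 / 8))) = complex_of_real (sqrt (8 * pi / c))"
    unfolding integral_complex_of_real integral_gaussian_kernel[OF c] ..
  have C: "\<forall>\<^sub>F \<sigma> in at_top. (CLINT \<tau>|lborel. saddle_integrand L k \<beta> c (max \<sigma> 1) \<tau>) = (CLINT \<tau>|lborel. saddle_integrand L k \<beta> c \<sigma> \<tau>)"
    using eventually_ge_at_top[of 1] by eventually_elim (simp add: max_def)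
  show "((\<lambda>\<sigma>. CLINT \<tau>|lborel. saddle_integrand L k \<beta> c \<sigma> \<tau>) \<longlongrightarrow> of_real (sqrt (8 * pi / c))) at_top"
    by (rule Lim_transform_eventually[OF A[unfolded E] C])
qed

end

section \<open>Asymptotics of the Laplace transform\<close>

text \<open>Turns a large \<open>Re z\<close>, whatever \<open>Im z\<close> is, into a large real
  part of the Liouville--Green parameter \<open>csqrt (2 * z)\<close>.\<close>

lemma Re_csqrt_ge:
  assumes "Re z \<ge> 0"
  shows "Re (csqrt z) \<ge> sqrt (Re z)"
proof -
  have "Re z = Re ((csqrt z)\<^sup>2)" by simp
  also have "\<dots> \<le> (Re (csqrt z))\<^sup>2" unfolding power2_eq_square by simp
  finally have "sqrt (Re z) \<le> sqrt ((Re (csqrt z))\<^sup>2)" by (rule real_sqrt_le_mono)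
  thus ?thesis using Re_csqrt[of z] by simp
qed

lemma laplace_model_nonzero:
  assumes "\<beta> > 0" "Re z > 0"
  shows "laplace_model k \<beta> c z \<noteq> 0"
proof -
  have "csqrt z \<noteq> 0" using assms by auto
  thus ?thesis using assms(1) by (simp add: laplace_model_def)
qed

lemma laplace_model_continuous:
  assumes "\<beta> > 0"
  shows "continuous_on {z. Re z > 0} (laplace_model k \<beta> c)"
proof -
  have "Re z > 0 \<Longrightarrow> z \<notin> \<real>\<^sub>\<le>\<^sub>0" for z by (auto simp: complex_nonpos_Reals_iff)
  moreover have "Re z > 0 \<Longrightarrow> of_real \<beta> * csqrt z \<notin> \<real>\<^sub>\<le>\<^sub>0" for z
    using assms Re_csqrt_pos[of z] by (auto simp: complex_nonpos_Reals_iff mult_le_0_iff)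
  ultimately have "laplace_model k \<beta> c holomorphic_on {z. Re z > 0}"
    unfolding laplace_model_def[abs_def] by (intro holomorphic_intros) auto
  thus ?thesis by (rule holomorphic_on_imp_continuous_on)
qed

text \<open>The square determines a continuous function up to a sign, and connectedness fixes the sign.\<close>

lemma tendsto_1_from_square:
  fixes r :: "complex \<Rightarrow> complex"
  assumes cont: "continuous_on {z. Re z > 0} r"
    and pos: "\<And>s. s > 0 \<Longrightarrow> Re (r (of_real s)) > 0"
    and sq: "\<And>e. e > 0 \<Longrightarrow> \<exists>s0>0. \<forall>z. Re z > s0 \<longrightarrow> norm ((r z)\<^sup>2 - 1) < e"
    and e: "e > 0"
  shows "\<exists>s0. \<forall>z. Re z > s0 \<longrightarrow> norm (r z - 1) < e"
proof -
  obtain s0 where s0: "s0 > 0" "\<And>z. Re z > s0 \<Longrightarrow> norm ((r z)\<^sup>2 - 1) < min 1 e"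
    using sq[of "min 1 e"] e by auto
  define S where "S = {z. Re z > s0}"
  \<comment> \<open>A purely imaginary value would have a non-positive square, at distance at least
    1 from 1; hence the tolerance \<open>min 1 e\<close>.\<close>
  have nz: "Re (r z) \<noteq> 0" if "z \<in> S" for z
  proof
    assume 0: "Re (r z) = 0"
    have "Re ((r z)\<^sup>2 - 1) \<le> - 1" using 0 by (simp add: power2_eq_square)
    hence "1 \<le> norm ((r z)\<^sup>2 - 1)" using abs_Re_le_cmod[of "(r z)\<^sup>2 - 1"] by linarith
    thus False using s0(2)[of z] that by (simp add: S_def)
  qed
  have conn: "connected ((\<lambda>z. Re (r z)) ` S)"
  proof (rule connected_continuous_image)
    have "continuous_on S r" by (rule continuous_on_subset[OF cont]) (use s0(1) in \<open>auto simp: S_def\<close>)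
    thus "continuous_on S (\<lambda>z. Re (r z))" by (intro continuous_intros)
    show "connected S" unfolding S_def by (intro convex_connected convex_halfspace_Re_gt)
  qed
  have posS: "Re (r z) > 0" if "z \<in> S" for z
  proof (rule ccontr)
    assume "\<not> 0 < Re (r z)"
    moreover have "of_real (s0 + 1) \<in> S" "Re (r (of_real (s0 + 1))) > 0"
      using s0(1) pos[of "s0 + 1"] by (auto simp: S_def)
    ultimately have "0 \<in> (\<lambda>z. Re (r z)) ` S"
      using connectedD_interval[OF conn, of "Re (r z)" "Re (r (of_real (s0 + 1)))" 0] that by auto
    thus False using nz by auto
  qed
  have "norm (r z - 1) < e" if z: "Re z > s0" for z
  proof -
    \<comment> \<open>In the right half-plane the factor \<open>r z + 1\<close> has modulus at least
      1, so \<open>r z - 1\<close> is no larger than \<open>(r z)\<^sup>2 - 1\<close>.\<close>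
    have "1 \<le> Re (r z + 1)" using posS[of z] z by (simp add: S_def less_imp_le)
    also have "\<dots> \<le> norm (r z + 1)" by (rule complex_Re_le_cmod)
    finally have "norm (r z - 1) * 1 \<le> norm (r z - 1) * norm (r z + 1)" by (intro mult_left_mono) auto
    also have "\<dots> = norm ((r z)\<^sup>2 - 1)" by (simp add: norm_mult[symmetric] power2_eq_square algebra_simps)
    also have "\<dots> < e" using s0(2)[OF z] by simp
    finally show ?thesis by simp
  qed
  thus ?thesis by blast
qed

text \<open>Liouville--Green with \<open>\<omega> = csqrt (2 * z)\<close> shows that
  \<open>v\<close> tends to 1, and the exact formula reads
  \<open>(r z)\<^sup>2 * v z ^ k = 1\<close> for the ratio \<open>r\<close> of transform and model.
  The constants come from the same substitution: \<open>2 * \<omega>\<close> contributes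
  \<open>2 * sqrt 2\<close> to \<open>\<beta>\<close>, and half of
  \<open>k * \<omega> * \<theta>\<close> is \<open>c * csqrt z\<close>.\<close>

lemma bessel_bridge_laplace_asymptotics:
  fixes \<psi> :: "real \<Rightarrow> real" and k :: nat
  assumes M: "prob_space M" and R: "bessel_bridge M k R"
    and pos: "\<forall>t\<in>{0..1}. \<psi> t > 0" and C2: "C2_on_interval 0 1 \<psi>"
    and \<psi>: "continuous_on {0..1} \<psi>"
  defines "Q \<equiv> \<lambda>\<omega>. integral {0..1} (\<lambda>t. (R t \<omega>)\<^sup>2 * \<psi> t)"
    and "\<theta> \<equiv> integral {0..1} (\<lambda>t. sqrt (\<psi> t))"
  defines "L \<equiv> \<lambda>z. CLINT \<omega>|M. exp (- z * complex_of_real (Q \<omega>))"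
    and "\<beta> \<equiv> 2 * sqrt 2 * (\<psi> 0 powr (1/4) * \<psi> 1 powr (1/4))" and "c \<equiv> real k * \<theta> / sqrt 2"
  assumes \<theta>: "\<theta> > 0" and e: "e > 0"
  shows "\<exists>s0. \<forall>z. Re z > s0 \<longrightarrow> norm (L z / laplace_model k \<beta> c z - 1) < e"
proof -
  interpret prob_space M by (rule M)
  note lap = bessel_bridge_laplace_real[OF M R \<psi> pos, folded Q_def]
  have Qm [measurable]: "Q \<in> borel_measurable M" using lap(1) by (simp add: Q_def[abs_def])
  have Q0: "Q \<omega> \<ge> 0" if "\<omega> \<in> space M" for \<omega>
    unfolding Q_def using pos lap(2)[OF that]
    by (intro integral_nonneg integrable_continuous_real) (auto simp: less_imp_le)
  have Lcont: "continuous_on {z. Re z > 0} L"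
    unfolding L_def using laplace_holomorphic[OF Qm Q0] by (intro holomorphic_on_imp_continuous_on) auto
  have \<beta>: "\<beta> > 0" using bspec[OF pos, of 0] bspec[OF pos, of 1] by (simp add: \<beta>_def)
  obtain H where H: "\<And>t. t \<in> {0..1} \<Longrightarrow> \<bar>\<psi> t\<bar> \<le> H"
    using compact_imp_bounded[OF compact_continuous_image[OF \<psi>]] unfolding bounded_iff by fastforce
  define v where "v z = of_real \<beta> * csqrt z * exp (- of_real (sqrt 2 * \<theta>) * csqrt z) * volterra_sol \<psi> (2 * z) 1" for z
  obtain E where E: "E > 0" "\<And>\<omega> u u'. \<lbrakk>Re \<omega> \<ge> 0; norm \<omega> \<ge> E;
      \<And>t. t \<in> {0..1} \<Longrightarrow> (u has_vector_derivative u' t) (at t within {0..1});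
      \<And>t. t \<in> {0..1} \<Longrightarrow> (u' has_vector_derivative \<omega>\<^sup>2 * of_real (\<psi> t) * u t) (at t within {0..1});
      u 0 = 0; u' 0 = 1\<rbrakk> \<Longrightarrow>
      norm (2 * \<omega> * exp (- \<omega> * of_real \<theta>) * of_real (\<psi> 0 powr (1/4) * \<psi> 1 powr (1/4)) * u 1 - 1)
        \<le> E / norm \<omega> + exp (- 2 * Re \<omega> * \<theta>)"
    using liouville_green_asymptotics[OF bspec[OF pos] C2, folded \<theta>_def] by metis
  have v: "\<exists>s0>0. \<forall>z. Re z > s0 \<longrightarrow> norm (v z - 1) < e" if e: "e > 0" for e
  proof -
    have lim: "((\<lambda>x. E / x + exp (- 2 * x * \<theta>)) \<longlongrightarrow> 0) at_top"
      using \<theta> by real_asymp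
    have "\<forall>\<^sub>F x in at_top. E / x + exp (- 2 * x * \<theta>) < e" using order_tendstoD(2)[OF lim e] .
    hence "\<forall>\<^sub>F x in at_top. E / x + exp (- 2 * x * \<theta>) < e \<and> x \<ge> E \<and> x \<ge> 1"
      using eventually_ge_at_top[of E] eventually_ge_at_top[of 1] by eventually_elim auto
    then obtain x where x: "E / x + exp (- 2 * x * \<theta>) < e" "x \<ge> E" "x \<ge> 1"
      by (auto simp: eventually_at_top_linorder)
    show ?thesis
    proof (intro exI[of _ "x\<^sup>2"] conjI allI impI)
      show "x\<^sup>2 > 0" using x by simp
      fix z assume z: "Re z > x\<^sup>2"
      define \<omega> where "\<omega> = csqrt (2 * z)"
      have \<omega>2: "\<omega>\<^sup>2 = 2 * z" by (simp add: \<omega>_def)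
      have \<omega>_eq: "\<omega> = of_real (sqrt 2) * csqrt z" unfolding \<omega>_def using csqrt_of_real_mult[of 2 z] by simp
      have z0: "Re z \<ge> 0" using z order_trans[OF zero_le_power2[of x]] by simp
      have "x\<^sup>2 \<le> Re (2 * z)" using z z0 by simp
      hence "x \<le> sqrt (Re (2 * z))" using x by (intro real_le_rsqrt)
      also have "\<dots> \<le> Re \<omega>" unfolding \<omega>_def using z0 by (intro Re_csqrt_ge) simp
      finally have re: "x \<le> Re \<omega>" .
      hence n: "x \<le> norm \<omega>" using complex_Re_le_cmod[of \<omega>] by linarith
      hence n0: "norm \<omega> > 0" using x by linarith
      have "norm (2 * \<omega> * exp (- \<omega> * of_real \<theta>) * of_real (\<psi> 0 powr (1/4) * \<psi> 1 powr (1/4)) * volterra_sol \<psi> (2 * z) 1 - 1)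
        \<le> E / norm \<omega> + exp (- 2 * Re \<omega> * \<theta>)"
      proof (rule E(2))
        show "Re \<omega> \<ge> 0" "norm \<omega> \<ge> E" using re n x by auto
        show "(volterra_sol \<psi> (2 * z) has_vector_derivative 1 + 2 * z * integral {0..t} (\<lambda>r. of_real (\<psi> r) * volterra_sol \<psi> (2 * z) r)) (at t within {0..1})"
          if "t \<in> {0..1}" for t
          by (rule volterra_sol_ode(1)[OF \<psi> H that])
        show "((\<lambda>t. 1 + 2 * z * integral {0..t} (\<lambda>r. of_real (\<psi> r) * volterra_sol \<psi> (2 * z) r)) has_vector_derivative
           \<omega>\<^sup>2 * of_real (\<psi> t) * volterra_sol \<psi> (2 * z) t) (at t within {0..1})"
          if "t \<in> {0..1}" for t
          unfolding \<omega>2 by (rule volterra_sol_ode(2)[OF \<psi> H that])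
        show "volterra_sol \<psi> (2 * z) 0 = 0" by (rule volterra_sol_0[OF \<psi> H])
      qed simp
      also have "\<dots> \<le> E / x + exp (- 2 * x * \<theta>)"
        using re n n0 x E(1) \<theta> by (intro add_mono divide_left_mono mult_pos_pos) auto
      also have "\<dots> < e" by (rule x(1))
      also have "2 * \<omega> * exp (- \<omega> * of_real \<theta>) * of_real (\<psi> 0 powr (1/4) * \<psi> 1 powr (1/4)) * volterra_sol \<psi> (2 * z) 1 = v z"
        unfolding v_def \<omega>_eq \<beta>_def by (simp add: mult_ac)
      finally show "norm (v z - 1) < e" .
    qed
  qed
  define r where "r z = L z / laplace_model k \<beta> c z" for z
  have r2: "(r z)\<^sup>2 * v z ^ k = 1" if z: "Re z > 0" for z
  proof -
    have "(exp (- of_real c * csqrt z))\<^sup>2 = exp (- of_real (sqrt 2 * \<theta>) * csqrt z) ^ k"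
    proof -
      have "2 * c = real k * (sqrt 2 * \<theta>)" by (simp add: c_def field_simps)
      hence "2 * (- complex_of_real c * csqrt z) = of_nat k * (- of_real (sqrt 2 * \<theta>) * csqrt z)"
        by (metis (no_types, opaque_lifting) mult.assoc mult_minus_left mult_minus_right of_real_mult of_real_numeral of_real_of_nat_eq)
      have "(exp (- of_real c * csqrt z))\<^sup>2 = exp (of_nat 2 * (- complex_of_real c * csqrt z))"
        by (rule exp_of_nat_mult[symmetric])
      also have "of_nat 2 * (- complex_of_real c * csqrt z) = of_nat k * (- of_real (sqrt 2 * \<theta>) * csqrt z)"
        unfolding of_nat_numeral by fact
      also have "exp \<dots> = exp (- of_real (sqrt 2 * \<theta>) * csqrt z) ^ k" by (rule exp_of_nat_mult)
      finally show ?thesis .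
    qed
    hence "(laplace_model k \<beta> c z)\<^sup>2 = (of_real \<beta> * csqrt z) ^ k * exp (- of_real (sqrt 2 * \<theta>) * csqrt z) ^ k"
      unfolding laplace_model_def power_mult_distrib by (simp add: power2_csqrt flip: power_mult) (simp add: power_mult power_mult_distrib mult.commute[of k 2])
    hence v_eq: "v z ^ k = (laplace_model k \<beta> c z)\<^sup>2 * volterra_sol \<psi> (2 * z) 1 ^ k"
      by (simp add: v_def power_mult_distrib)
    have "(r z)\<^sup>2 * v z ^ k = (L z)\<^sup>2 * volterra_sol \<psi> (2 * z) 1 ^ k"
      unfolding v_eq r_def power_divide using laplace_model_nonzero[OF \<beta> z, of k c] by simp
    also have "\<dots> = 1"
      using bessel_bridge_laplace[OF M R \<psi> pos z] by (simp add: L_def Q_def)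
    finally show ?thesis .
  qed
  have sq: "\<exists>s0>0. \<forall>z. Re z > s0 \<longrightarrow> norm ((r z)\<^sup>2 - 1) < e" if e: "e > 0" for e
  proof -
    have "isCont (\<lambda>x::complex. 1 / x ^ k) 1" by (intro continuous_intros) simp
    then obtain d where d: "d > 0" "\<And>x::complex. norm (x - 1) < d \<Longrightarrow> norm (1 / x ^ k - 1) < e"
      using e unfolding continuous_at_eps_delta dist_norm by fastforce
    obtain s0 where s0: "s0 > 0" "\<And>z. Re z > s0 \<Longrightarrow> norm (v z - 1) < d" using v[OF d(1)] by blast
    have "norm ((r z)\<^sup>2 - 1) < e" if "Re z > s0" for z
    proof -
      have "(r z)\<^sup>2 * v z ^ k = 1" using r2[of z] that s0(1) by simp
      moreover from this have "v z ^ k \<noteq> 0" by (metis mult_zero_right zero_neq_one)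
      ultimately have "(r z)\<^sup>2 = 1 / v z ^ k" by (simp add: nonzero_eq_divide_eq)
      thus ?thesis using d(2)[OF s0(2)[OF that]] by simp
    qed
    thus ?thesis using s0(1) by blast
  qed
  have rpos: "Re (r (of_real s)) > 0" if s: "s > 0" for s
  proof -
    have "L (of_real s) = of_real (LINT \<omega>|M. exp (- s * Q \<omega>))"
      unfolding L_def by (simp flip: integral_complex_of_real exp_of_real)
    also have "(LINT \<omega>|M. exp (- s * Q \<omega>)) = (1 / sqrt (Re (volterra_sol \<psi> (of_real (2 * s)) 1))) ^ k"
      using lap(3)[of s] s by (simp add: Q_def)
    finally have "L (of_real s) = of_real ((1 / sqrt (Re (volterra_sol \<psi> (of_real (2 * s)) 1))) ^ k)" .
    moreover have "laplace_model k \<beta> c (of_real s) = of_real (sqrt (\<beta> * sqrt s) ^ k * exp (- c * sqrt s))"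
      using s \<beta> by (simp add: laplace_model_def csqrt_of_real_nonneg exp_of_real flip: of_real_mult of_real_minus of_real_power)
    ultimately have "r (of_real s) = of_real ((1 / sqrt (Re (volterra_sol \<psi> (of_real (2 * s)) 1))) ^ k / (sqrt (\<beta> * sqrt s) ^ k * exp (- c * sqrt s)))"
      unfolding r_def by (simp only: of_real_divide)
    moreover have "(1 / sqrt (Re (volterra_sol \<psi> (of_real (2 * s)) 1))) ^ k / (sqrt (\<beta> * sqrt s) ^ k * exp (- c * sqrt s)) > 0"
      using s \<beta> lap(4)[of s] by (intro divide_pos_pos zero_less_power mult_pos_pos) auto
    ultimately show ?thesis by (simp only: Re_complex_of_real)
  qed
  have "continuous_on {z. Re z > 0} r"
    unfolding r_def[abs_def] using Lcont laplace_model_continuous[OF \<beta>] laplace_model_nonzero[OF \<beta>]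
    by (intro continuous_on_divide) auto
  from tendsto_1_from_square[OF this rpos sq e] show ?thesis by (simp add: r_def)
qed

section \<open>Small deviations\<close>

text \<open>Inversion along the vertical line through \<open>\<sigma> ^ 4\<close>, rescaled by
  \<open>t = \<sigma> ^ 3 * \<tau>\<close>. The Jacobian, the constant \<open>1 / (2 * pi)\<close>
  and \<open>saddle_factor\<close> make up the normalisation.\<close>

lemma cdf_saddle_asymptotics:
  fixes M :: "real measure" and k :: nat and \<beta> c :: real
  assumes M: "real_distribution M" and nonneg: "AE q in M. q \<ge> 0" and \<beta>: "\<beta> > 0" and c: "c > 0"
  defines "L \<equiv> \<lambda>z. CLINT q|M. exp (- z * complex_of_real q)"
  assumes L_asymp: "\<forall>e>0. \<exists>s0. \<forall>z. Re z > s0 \<longrightarrow> norm (L z / laplace_model k \<beta> c z - 1) < e"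
  shows "((\<lambda>\<sigma>. cdf M (c / (2 * \<sigma>\<^sup>2)) / (\<sigma> ^ 3 * saddle_factor k \<beta> c \<sigma> / (2 * pi))) \<longlongrightarrow> sqrt (8 * pi / c)) at_top"
proof -
  interpret real_distribution M by (rule M)
  have L_cont: "continuous_on {z. Re z > 0} L"
  proof -
    have "L z = (CLINT q|M. exp (- z * complex_of_real (max q 0)))" for z
      \<comment> \<open>The law is concentrated on the non-negative axis only up to a null set,
        whereas \<open>laplace_holomorphic\<close> asks for a variable that is non-negative
        everywhere; \<open>max q 0\<close> is one.\<close>
      unfolding L_def using nonneg by (intro integral_cong_AE) (auto simp: max_def)
    moreover have "(\<lambda>z. CLINT q|M. exp (- z * complex_of_real (max q 0))) holomorphic_on {z. Re z > 0}"
      by (rule laplace_holomorphic) auto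
    ultimately show ?thesis using holomorphic_on_imp_continuous_on by auto
  qed
  let ?I = "saddle_integrand L k \<beta> c" and ?F = "saddle_factor k \<beta> c"
  note lim = saddle_integral[OF \<beta> c L_cont L_asymp]
  have eq: "\<forall>\<^sub>F \<sigma> in at_top. Re (CLINT \<tau>|lborel. ?I \<sigma> \<tau>) = cdf M (c / (2 * \<sigma>\<^sup>2)) / (\<sigma> ^ 3 * ?F \<sigma> / (2 * pi))"
    using lim(2) eventually_gt_at_top[of 0]
  proof eventually_elim
    case (elim \<sigma>)
    define x where "x = c / (2 * \<sigma>\<^sup>2)"
    define f where "f t = L (of_real (\<sigma> ^ 4) - \<i> * of_real t) / (of_real (\<sigma> ^ 4) - \<i> * of_real t)" for t
    define g where "g t = exp ((of_real (\<sigma> ^ 4) - \<i> * of_real t) * of_real x) * f t" for t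
    have F: "?F \<sigma> > 0" using saddle_factor_pos[OF elim(2) \<beta>] .
    have line: "complex_of_real (\<sigma> ^ 4) - \<i> * of_real (\<sigma> ^ 3 * \<tau>) = saddle_line \<sigma> \<tau>" for \<tau>
      unfolding saddle_line_def using elim(2) by (simp add: field_simps power_numeral_reduce)
    have gI: "g (0 + \<sigma> ^ 3 * \<tau>) = of_real (?F \<sigma>) * ?I \<sigma> \<tau>" for \<tau>
      unfolding g_def f_def add_0 line saddle_integrand_def x_def using F by simp
    have fI: "f (0 + \<sigma> ^ 3 * \<tau>) = exp (- (saddle_line \<sigma> \<tau> * of_real x)) * (of_real (?F \<sigma>) * ?I \<sigma> \<tau>)" for \<tau>
      unfolding gI[symmetric] unfolding g_def add_0 line by (simp add: exp_minus)
    \<comment> \<open>Along the line \<open>exp (z * x)\<close> has constant modulus, so dividing it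
      out preserves integrability.\<close>
    have "integrable lborel (\<lambda>\<tau>. f (0 + \<sigma> ^ 3 * \<tau>))"
      unfolding fI
    proof (rule Bochner_Integration.integrable_bound)
      show i: "integrable lborel (\<lambda>\<tau>. of_real (exp (- (\<sigma> ^ 4 * x))) * (of_real (?F \<sigma>) * ?I \<sigma> \<tau>))"
        using elim(1) by (intro integrable_mult_right)
      have "continuous_on UNIV (\<lambda>\<tau>. exp (- (saddle_line \<sigma> \<tau> * of_real x)))"
        unfolding saddle_line_def using elim(2) by (intro continuous_intros) auto
      hence [measurable]: "(\<lambda>\<tau>. exp (- (saddle_line \<sigma> \<tau> * of_real x))) \<in> borel_measurable borel"
        by (rule borel_measurable_continuous_onI)
      have [measurable]: "?I \<sigma> \<in> borel_measurable borel"
        using borel_measurable_integrable[OF elim(1)] by simp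
      show "(\<lambda>\<tau>. exp (- (saddle_line \<sigma> \<tau> * of_real x)) * (of_real (?F \<sigma>) * ?I \<sigma> \<tau>)) \<in> borel_measurable lborel"
        by measurable
      show "AE \<tau> in lborel. norm (exp (- (saddle_line \<sigma> \<tau> * of_real x)) * (of_real (?F \<sigma>) * ?I \<sigma> \<tau>))
         \<le> norm (of_real (exp (- (\<sigma> ^ 4 * x))) * (of_real (?F \<sigma>) * ?I \<sigma> \<tau>))"
        unfolding norm_mult[of "exp _"] norm_mult[of "of_real (exp _)"]
        by (intro AE_I2 mult_right_mono) (simp_all add: norm_exp_eq_Re Re_saddle_line)
    qed
    hence fint: "integrable lborel f"
      by (subst (asm) lborel_integrable_real_affine_iff) (use elim(2) in auto)
    have "complex_of_real (cdf M x) = 1 / (2 * pi) * (CLINT t|lborel. g t)"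
      unfolding g_def f_def L_def
      by (rule laplace_inversion[OF nonneg]) (use elim(2) in simp, rule fint[unfolded f_def[abs_def] L_def])
    also have "(CLINT t|lborel. g t) = \<bar>\<sigma> ^ 3\<bar> *\<^sub>R (CLINT \<tau>|lborel. g (0 + \<sigma> ^ 3 * \<tau>))"
      using elim(2) by (intro lborel_integral_real_affine) auto
    also have "\<dots> = of_real (\<sigma> ^ 3 * ?F \<sigma>) * (CLINT \<tau>|lborel. ?I \<sigma> \<tau>)"
      unfolding gI using elim(2) by (simp add: scaleR_conv_of_real)
    finally have "complex_of_real (cdf M x) = of_real (\<sigma> ^ 3 * ?F \<sigma> / (2 * pi)) * (CLINT \<tau>|lborel. ?I \<sigma> \<tau>)" by simp
    hence "Re (complex_of_real (cdf M x)) = Re (of_real (\<sigma> ^ 3 * ?F \<sigma> / (2 * pi)) * (CLINT \<tau>|lborel. ?I \<sigma> \<tau>))" by (rule arg_cong)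
    moreover have "Re (complex_of_real a * z) = a * Re z" for a z by simp
    ultimately have "cdf M x = (\<sigma> ^ 3 * ?F \<sigma> / (2 * pi)) * Re (CLINT \<tau>|lborel. ?I \<sigma> \<tau>)" by (simp only: Re_complex_of_real)
    moreover have "\<sigma> ^ 3 * ?F \<sigma> / (2 * pi) \<noteq> 0" using F elim(2) by simp
    ultimately show ?case unfolding x_def by (simp only: nonzero_mult_div_cancel_left not_False_eq_True)
  qed
  have "((\<lambda>\<sigma>. Re (CLINT \<tau>|lborel. ?I \<sigma> \<tau>)) \<longlongrightarrow> Re (of_real (sqrt (8 * pi / c)))) at_top"
    by (rule tendsto_Re[OF lim(1)])
  from Lim_transform_eventually[OF this eq] show ?thesis by simp
qed

text \<open>The powers of \<open>\<sigma>\<close> combine to \<open>\<sigma> ^ (k - 1)\<close>, the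
  source of the power of \<open>\<epsilon>\<close>. Both sides are positive, and apart from the
  common exponential term their logarithms are linear in the logarithms of the parameters, so these
  are compared.\<close>

lemma asymptotic_constant:
  fixes k :: nat and \<theta> p0 p1 \<epsilon> :: real
  assumes k: "k \<ge> 1" and \<theta>: "\<theta> > 0" and p: "p0 > 0" "p1 > 0" and \<epsilon>: "\<epsilon> > 0"
  defines "\<beta> \<equiv> 2 * sqrt 2 * (p0 powr (1/4) * p1 powr (1/4))" and "c \<equiv> real k * \<theta> / sqrt 2"
  defines "\<sigma> \<equiv> sqrt (c / 2) / \<epsilon>"
  shows "\<sigma> ^ 3 * ((\<sigma> * sqrt \<beta>) ^ k * exp (- c * \<sigma>\<^sup>2 / 2) / \<sigma> ^ 4) / (2 * pi) * sqrt (8 * pi / c)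
    = 2 * sqrt 2 / sqrt pi * (real k * \<theta>) powr ((real k - 2) / 2) * p0 powr (real k / 8) * p1 powr (real k / 8)
      * \<epsilon> powr (- (real k - 1)) * exp (- ((real k)\<^sup>2 * \<theta>\<^sup>2 / 8) * \<epsilon> powr (-2))" (is "?l = ?r")
proof -
  have c: "c > 0" using k \<theta> by (simp add: c_def)
  have \<beta>: "\<beta> > 0" using p by (simp add: \<beta>_def)
  have \<sigma>: "\<sigma> > 0" using c \<epsilon> by (simp add: \<sigma>_def)
  have k0: "real k > 0" using k by simp
  have ln8: "ln (8::real) = 3 * ln 2" using ln_realpow[of 2 3] by simp
  have lnc: "ln c = ln (real k) + ln \<theta> - ln 2 / 2"
    using k0 \<theta> by (simp add: c_def ln_div ln_mult ln_sqrt)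
  have ln\<beta>: "ln \<beta> = 3 / 2 * ln 2 + ln p0 / 4 + ln p1 / 4"
    using p by (simp add: \<beta>_def ln_mult ln_powr ln_sqrt)
  have ln\<sigma>: "ln \<sigma> = (ln c - ln 2) / 2 - ln \<epsilon>"
    using c \<epsilon> by (simp add: \<sigma>_def ln_div ln_sqrt)
  have ex: "c * \<sigma>\<^sup>2 / 2 = (real k)\<^sup>2 * \<theta>\<^sup>2 / 8 * \<epsilon> powr (-2)"
  proof -
    have s2: "\<sigma>\<^sup>2 = c / 2 / \<epsilon>\<^sup>2" using c by (simp add: \<sigma>_def power_divide)
    have cc: "c * c = (real k)\<^sup>2 * \<theta>\<^sup>2 / 2" by (simp add: c_def power2_eq_square)
    have "c * \<sigma>\<^sup>2 / 2 = c * c / (4 * \<epsilon>\<^sup>2)" unfolding s2 by simp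
    also have "\<dots> = (real k)\<^sup>2 * \<theta>\<^sup>2 / 8 * (1 / \<epsilon>\<^sup>2)" unfolding cc by simp
    also have "1 / \<epsilon>\<^sup>2 = \<epsilon> powr (-2)" using \<epsilon> by (simp add: powr_minus divide_inverse)
    finally show ?thesis .
  qed
  have lpos: "?l > 0" using c \<beta> \<sigma> by (intro mult_pos_pos divide_pos_pos zero_less_power) auto
  have rpos: "?r > 0" using k0 \<theta> p \<epsilon> by (intro mult_pos_pos divide_pos_pos) auto
  have "ln ?l = 3 * ln \<sigma> + (real k * (ln \<sigma> + ln \<beta> / 2) - c * \<sigma>\<^sup>2 / 2 - 4 * ln \<sigma>) - (ln 2 + ln pi) + (ln 8 + ln pi - ln c) / 2"
    using c \<beta> \<sigma> by (simp add: ln_mult ln_div ln_sqrt ln_realpow)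
  also have "\<dots> = ln 2 + ln 2 / 2 - ln pi / 2 + (real k - 2) / 2 * (ln (real k) + ln \<theta>) + real k / 8 * ln p0 + real k / 8 * ln p1
      - (real k - 1) * ln \<epsilon> - (real k)\<^sup>2 * \<theta>\<^sup>2 / 8 * \<epsilon> powr (-2)"
    unfolding ex ln\<sigma> ln\<beta> ln8 lnc by (simp add: field_simps)
  also have "\<dots> = ln ?r"
    using k0 \<theta> p \<epsilon> by (simp add: ln_mult ln_div ln_sqrt ln_powr left_diff_distrib)
  finally show ?thesis using lpos rpos by (simp only: ln_inj_iff)
qed

theorem proposition2:
  fixes k :: nat and M :: "'a measure" and R :: "real \<Rightarrow> 'a \<Rightarrow> real"
    and \<psi> :: "real \<Rightarrow> real" and \<theta> :: real
  assumes "k \<ge> 1"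
    and "prob_space M"
    and "bessel_bridge M k R"
    and "\<forall>t\<in>{0..1}. \<psi> t > 0"
    and "C2_on_interval 0 1 \<psi>"
    and "\<theta> = (LBINT t:{0..1}. sqrt (\<psi> t))"
  shows "(\<lambda>\<epsilon>. measure M {\<omega> \<in> space M. weighted_norm \<psi> (\<lambda>t. R t \<omega>) \<le> \<epsilon>})
    \<sim>[at_right 0]
    (\<lambda>\<epsilon>. 2 * sqrt 2 / sqrt pi * (real k * \<theta>) powr ((real k - 2) / 2)
          * \<psi> 0 powr (real k / 8) * \<psi> 1 powr (real k / 8)
          * \<epsilon> powr (- (real k - 1))
          * exp (- ((real k)\<^sup>2 * \<theta>\<^sup>2 / 8) * \<epsilon> powr (-2)))"
proof -
  interpret prob_space M by fact
  note pos = assms(4) and R = assms(3) and C2 = assms(5)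
  have \<psi>: "continuous_on {0..1} \<psi>"
    using C2 unfolding C2_on_interval_def by (meson DERIV_continuous_on)
  have sqc: "continuous_on {0..1} (\<lambda>t. sqrt (\<psi> t))" using \<psi> by (intro continuous_intros)
  have \<theta>_eq: "\<theta> = integral {0..1} (\<lambda>t. sqrt (\<psi> t))"
    unfolding assms(6) by (intro set_borel_integral_eq_integral borel_integrable_atLeastAtMost' sqc)
  obtain t0 where t0: "t0 \<in> {0..1}" "\<And>t. t \<in> {0..1} \<Longrightarrow> sqrt (\<psi> t0) \<le> sqrt (\<psi> t)"
    using continuous_attains_inf[OF _ _ sqc] by auto
  have "integral {0..1} (\<lambda>t::real. sqrt (\<psi> t0)) \<le> \<theta>"
    unfolding \<theta>_eq using t0(2) by (intro integral_le integrable_continuous_real sqc) auto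
  moreover have "sqrt (\<psi> t0) > 0" using pos t0(1) by simp
  ultimately have \<theta>: "\<theta> > 0" by (simp del: real_sqrt_gt_0_iff)
  define Q where "Q \<omega> = integral {0..1} (\<lambda>t. (R t \<omega>)\<^sup>2 * \<psi> t)" for \<omega>
  note lap = bessel_bridge_laplace_real[OF assms(2) R \<psi> pos, folded Q_def]
  have Qm [measurable]: "Q \<in> borel_measurable M" using lap(1) by (simp add: Q_def[abs_def])
  have Q0: "Q \<omega> \<ge> 0" if "\<omega> \<in> space M" for \<omega>
    unfolding Q_def using pos lap(2)[OF that]
    by (intro integral_nonneg integrable_continuous_real) (auto simp: less_imp_le)
  have norm_eq: "weighted_norm \<psi> (\<lambda>t. R t \<omega>) = sqrt (Q \<omega>)" if "\<omega> \<in> space M" for \<omega>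
    unfolding weighted_norm_def Q_def
    by (intro arg_cong[where f = sqrt] set_borel_integral_eq_integral borel_integrable_atLeastAtMost' lap(2) that)
  define D where "D = distr M borel Q"
  have D: "real_distribution D" unfolding D_def by (intro real_distribution_distr) simp
  have Dpos: "AE q in D. q \<ge> 0" unfolding D_def by (subst AE_distr_iff) (auto intro!: AE_I2 Q0)
  have LD: "(CLINT q|D. exp (- z * complex_of_real q)) = (CLINT \<omega>|M. exp (- z * complex_of_real (Q \<omega>)))" for z
    unfolding D_def by (subst integral_distr) auto
  define \<beta> where "\<beta> = 2 * sqrt 2 * (\<psi> 0 powr (1/4) * \<psi> 1 powr (1/4))"
  define c where "c = real k * \<theta> / sqrt 2"
  have p: "\<psi> 0 > 0" "\<psi> 1 > 0" using pos by auto
  have \<beta>: "\<beta> > 0" using p by (simp add: \<beta>_def)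
  have c: "c > 0" using assms(1) \<theta> by (simp add: c_def)
  have asy: "\<forall>e>0. \<exists>s0. \<forall>z. Re z > s0 \<longrightarrow> norm ((CLINT q|D. exp (- z * complex_of_real q)) / laplace_model k \<beta> c z - 1) < e"
    unfolding LD Q_def \<beta>_def c_def \<theta>_eq
    by (intro allI impI bessel_bridge_laplace_asymptotics[OF assms(2) R pos C2 \<psi>]) (use \<theta> \<theta>_eq in simp_all)
  \<comment> \<open>Chosen so that
    \<open>c / (2 * (\<sigma> \<epsilon>)\<^sup>2) = \<epsilon>\<^sup>2\<close>, because the event
    in question is \<open>Q \<le> \<epsilon>\<^sup>2\<close>.\<close>
  define \<sigma> where "\<sigma> \<epsilon> = sqrt (c / 2) / \<epsilon>" for \<epsilon>
  have \<sigma>_lim: "filterlim \<sigma> at_top (at_right 0)"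
    unfolding \<sigma>_def[abs_def] using c by real_asymp
  have main: "((\<lambda>\<epsilon>. cdf D (c / (2 * (\<sigma> \<epsilon>)\<^sup>2)) / (\<sigma> \<epsilon> ^ 3 * saddle_factor k \<beta> c (\<sigma> \<epsilon>) / (2 * pi))) \<longlongrightarrow> sqrt (8 * pi / c)) (at_right 0)"
    by (rule filterlim_compose[OF cdf_saddle_asymptotics[OF D Dpos \<beta> c asy] \<sigma>_lim])
  let ?f = "\<lambda>\<epsilon>. measure M {\<omega> \<in> space M. weighted_norm \<psi> (\<lambda>t. R t \<omega>) \<le> \<epsilon>}"
  let ?g = "\<lambda>\<epsilon>. 2 * sqrt 2 / sqrt pi * (real k * \<theta>) powr ((real k - 2) / 2)
          * \<psi> 0 powr (real k / 8) * \<psi> 1 powr (real k / 8)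
          * \<epsilon> powr (- (real k - 1))
          * exp (- ((real k)\<^sup>2 * \<theta>\<^sup>2 / 8) * \<epsilon> powr (-2))"
  show ?thesis
  proof (rule asymp_equivI')
    have sp: "sqrt (8 * pi / c) \<noteq> 0" using c by simp
    have "((\<lambda>\<epsilon>. cdf D (c / (2 * (\<sigma> \<epsilon>)\<^sup>2)) / (\<sigma> \<epsilon> ^ 3 * saddle_factor k \<beta> c (\<sigma> \<epsilon>) / (2 * pi)) / sqrt (8 * pi / c))
      \<longlongrightarrow> sqrt (8 * pi / c) / sqrt (8 * pi / c)) (at_right 0)"
      by (intro tendsto_divide main tendsto_const sp)
    hence *: "((\<lambda>\<epsilon>. cdf D (c / (2 * (\<sigma> \<epsilon>)\<^sup>2)) / (\<sigma> \<epsilon> ^ 3 * saddle_factor k \<beta> c (\<sigma> \<epsilon>) / (2 * pi) * sqrt (8 * pi / c))) \<longlongrightarrow> 1) (at_right 0)"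
      using sp by simp
    have "\<forall>\<^sub>F \<epsilon> in at_right 0. cdf D (c / (2 * (\<sigma> \<epsilon>)\<^sup>2)) / (\<sigma> \<epsilon> ^ 3 * saddle_factor k \<beta> c (\<sigma> \<epsilon>) / (2 * pi) * sqrt (8 * pi / c)) = ?f \<epsilon> / ?g \<epsilon>"
      using eventually_at_right_less[of 0]
    proof eventually_elim
      case (elim \<epsilon>)
      have "c / (2 * (\<sigma> \<epsilon>)\<^sup>2) = \<epsilon>\<^sup>2" using c elim by (simp add: \<sigma>_def power_divide)
      moreover have "cdf D (\<epsilon>\<^sup>2) = ?f \<epsilon>"
      proof -
        have "cdf D (\<epsilon>\<^sup>2) = measure M (Q -` {..\<epsilon>\<^sup>2} \<inter> space M)"
          unfolding cdf_def D_def by (subst measure_distr) auto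
        also have "Q -` {..\<epsilon>\<^sup>2} \<inter> space M = {\<omega> \<in> space M. weighted_norm \<psi> (\<lambda>t. R t \<omega>) \<le> \<epsilon>}"
        proof (intro set_eqI)
          fix \<omega>
          have "Q \<omega> \<le> \<epsilon>\<^sup>2 \<longleftrightarrow> sqrt (Q \<omega>) \<le> \<epsilon>" if "\<omega> \<in> space M"
            using elim real_sqrt_le_iff[of "Q \<omega>" "\<epsilon>\<^sup>2"] by simp
          thus "\<omega> \<in> Q -` {..\<epsilon>\<^sup>2} \<inter> space M \<longleftrightarrow> \<omega> \<in> {\<omega> \<in> space M. weighted_norm \<psi> (\<lambda>t. R t \<omega>) \<le> \<epsilon>}"
            using norm_eq[of \<omega>] by auto
        qed
        finally show ?thesis .
      qed
      moreover have "\<sigma> \<epsilon> ^ 3 * saddle_factor k \<beta> c (\<sigma> \<epsilon>) / (2 * pi) * sqrt (8 * pi / c) = ?g \<epsilon>"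
        unfolding saddle_factor_def \<sigma>_def \<beta>_def c_def
        by (rule asymptotic_constant[OF assms(1) \<theta> p elim])
      ultimately show ?case by (simp only:)
    qed
    from Lim_transform_eventually[OF * this] show "((\<lambda>\<epsilon>. ?f \<epsilon> / ?g \<epsilon>) \<longlongrightarrow> 1) (at_right 0)" .
  qed
qed

end
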